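(* Let $P$ be a precubical set with boundary operators $d_i^k$, let $b\in\{0,1\}$, and let $x\in P_2$ be a regular element such that no element of $P_2\setminus\{x\}$ has $d_1^{1-b}x$ or $d_2^bx$ in its boundary and the only elements of $P_1$ having $d_1^{1-b}d_2^bx=d_1^bd_1^{1-b}x$ in their boundary are $d_1^{1-b}x$ and $d_2^bx$. Then a precubical subset $Q$ of $P$ such that the inclusion $\iota:|Q|\hookrightarrow|P|$ is a dihomotopy equivalence relative to $|Q|$ is given by $Q_0=P_0\setminus\{d_1^{1-b}d_2^bx\}$, $Q_1=P_1\setminus\{d_1^{1-b}x,d_2^bx\}$, $Q_2=P_2\setminus\{x\}$, and $Q_r=P_r$ $(r>2)$. Moreover, $\mathrm{Extrl}(P)=\mathrm{Extrl}(Q)$, and $\iota$ induces an isomorphism of fundamental bipartite graphs $\vec\pi_1(|Q|,\mathrm{Extrl}(|Q|))\to\vec\pi_1(|P|,\mathrm{Extrl}(|P|))$ and, for each pair of extremal elements $v,w\in\mathrm{Extrl}(P)$, a homotopy equivalence of d-path spaces $\vec{\mathcal P}(|Q|)([v,()],[w,()])\to\vec{\mathcal P}(|P|)([v,()],[w,()])$, $\omega\mapsto\iota\circ\omega$.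
   Context: Precubical sets. $I=[0,1]$. A precubical set is a graded set $P=(P_n)_{n\ge 0}$ with boundary operators $d_i^k: P_n \to P_{n-1}$ ($n>0$, $k=0,1$, $i=1,\dots,n$) satisfying $d_i^k\circ d_j^l = d_{j-1}^l\circ d_i^k$ ($k,l=0,1$, $i<j$). Elements of $P_0$ are called vertices. An element is in the boundary of $z$ if it is obtained from $z$ by applying one or more boundary operators. A morphism of precubical sets is a morphism of graded sets compatible with the boundary operators. A precubical subset of $P$ is a precubical set $Q$ with $Q_n\subseteq P_n$ for all $n$ whose boundary operators coincide with those of $P$ on $Q$. Regular elements. Let $\Box$ be the category whose objects are the standard cubes $I^n$ ($n\geq 0$, $I^0=\{()\}$) and whose non-identity morphisms are composites of the maps $\delta_i^k: I^n\to I^{n+1}$ ($i\in\{1,\dots,n+1\}$, $k\in\{0,1\}$), $\delta_i^k(u_1,\dots,u_n)=(u_1,\dots,u_{i-1},k,u_i,\dots,u_n)$. Precubical sets are the presheaves on $\Box$. Let $\mathbb I^n=\Box(-,I^n)$. For $x\in P_n$ let $x_\sharp:\mathbb I^n\to P$ be the unique morphism with $x_\sharp(\mathrm{id}_{I^n})=x$; $x$ is regular if $x_\sharp$ is injective. d-spaces. A d-space is a topological space $X$ with a set $dX\subseteq X^I$ of paths (called d-paths) containing all constant paths and closed under composition with (not necessarily strictly) increasing continuous maps $I\to I$ and under concatenation. A d-map is a continuous map $f$ between d-spaces such that $f\circ\omega$ is a d-path for each d-path $\omega$. A d-subspace $A$ of $X$ is a subspace with $dA=\{\omega\in A^I \mid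 \omega \text{ is a d-path when regarded as a path in } X\}$. Geometric realization. $|P|=(\coprod_{n\ge 0}P_n\times I^n)/\sim$ with $P_n$ discrete and $\sim$ generated by $(d_i^kx,u)\sim(x,\delta_i^k(u))$; classes are written $[x,u]$. Its d-paths are the increasing reparametrizations of finite concatenations of paths of the form $t\mapsto[x,\alpha(t)]$, where $x\in P_n$ and $\alpha:I\to I^n$ is continuous and order-preserving (componentwise order on $I^n$). If $Q$ is a precubical subset of $P$, then $|Q|$ is regarded as a d-subspace of $|P|$. Dihomotopy. For d-maps $f,g:X\to Y$ coinciding on a d-subspace $A$ of $X$, a dihomotopy relative to $A$ from $f$ to $g$ is a homotopy $H:X\times I\to Y$ from $f$ to $g$ such that each $H(-,t)$ is a d-map which coincides with $f$ and $g$ on $A$; $f,g$ are then called dihomotopic relative to $A$. If $X$ and $Y$ are d-spaces with a common d-subspace $A$, a d-map $f:X\to Y$ with $f(a)=a$ for all $a\in A$ is a dihomotopy equivalence relative to $A$ if there is a d-map $g:Y\to X$ with $g(a)=a$ for all $a\in A$ such that $g\circ f$ and $f\circ g$ are dihomotopic relative to $A$ to the identities. Extremal elements and fundamental bipartite graph. A vertex $v\in P_0$ is minimal (maximal) if there is no $x\in P_1$ with $d_1^1x=v$ ($d_1^0x=v$); it is extremal if it is minimal or maximal. $\mathrm{Extrl}(P)$ is the $0$-dimensional precubical subset of extremal elements. The fundamental category $\vec\pi_1(X)$ of a d-space $X$ has the points of $X$ as objects and, as morphisms from $x$ to $y$, the dihomotopy classes relative to $\{0,1\}$ (endpoints fixed)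 of d-paths from $x$ to $y$ (composition by concatenation); it is functorial in d-maps. A point $a\in X$ is minimal (maximal) if any morphism in $\vec\pi_1(X)$ with target (source) $a$ has source (target) $a$, and extremal if it is minimal or maximal; $\mathrm{Extrl}(X)$ is the d-subspace of extremal points. The fundamental bipartite graph of $X$ is the full subcategory $\vec\pi_1(X,\mathrm{Extrl}(X))$ of $\vec\pi_1(X)$ on $\mathrm{Extrl}(X)$. For $a,b\in X$, the d-path space $\vec{\mathcal P}(X)(a,b)$ is the subspace of $X^I$ (compact-open topology) of d-paths from $a$ to $b$. *)

theory Defs
  imports "HOL-Analysis.Analysis"
begin

section \<open>Precubical sets\<close>

text \<open>The grades \<open>cells P n\<close> live in one ambient type and need not be disjoint, so the boundary
  operators carry the degree of their argument: \<open>bd P n i k\<close> is $d_i^k : P_n \to P_{n-1}$.\<close>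

record 'a precubical =
  cells :: "nat \<Rightarrow> 'a set"
  bd :: "nat \<Rightarrow> nat \<Rightarrow> nat \<Rightarrow> 'a \<Rightarrow> 'a"

definition precubical_set :: "'a precubical \<Rightarrow> bool" where
  "precubical_set P \<longleftrightarrow>
     (\<forall>n i k x. n > 0 \<longrightarrow> i \<in> {1..n} \<longrightarrow> k \<in> {0,1} \<longrightarrow> x \<in> cells P n \<longrightarrow>
        bd P n i k x \<in> cells P (n - 1)) \<and>
     (\<forall>n i j k l x. 1 \<le> i \<longrightarrow> i < j \<longrightarrow> j \<le> n \<longrightarrow> k \<in> {0,1} \<longrightarrow> l \<in> {0,1} \<longrightarrow> x \<in> cells P n \<longrightarrow>
        bd P (n - 1) i k (bd P n j l x) = bd P (n - 1) (j - 1) l (bd P n i k x))"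

text \<open>\<open>in_boundary P m y n z\<close>: the element \<open>y\<close> of degree \<open>m\<close> is in the boundary of the element
  \<open>z\<close> of degree \<open>n\<close>.\<close>

inductive in_boundary :: "'a precubical \<Rightarrow> nat \<Rightarrow> 'a \<Rightarrow> nat \<Rightarrow> 'a \<Rightarrow> bool" for P where
  one: "z \<in> cells P (Suc n) \<Longrightarrow> i \<in> {1..Suc n} \<Longrightarrow> k \<in> {0,1} \<Longrightarrow>
          in_boundary P n (bd P (Suc n) i k z) (Suc n) z"
| more: "in_boundary P (Suc m) y n z \<Longrightarrow> i \<in> {1..Suc m} \<Longrightarrow> k \<in> {0,1} \<Longrightarrow>
          in_boundary P m (bd P (Suc m) i k y) n z"

text \<open>Morphisms are taken extensional in each degree, so that equality of morphisms is equality
  in HOL.\<close>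

definition precubical_hom :: "'a precubical \<Rightarrow> 'b precubical \<Rightarrow> (nat \<Rightarrow> 'a \<Rightarrow> 'b) set" where
  "precubical_hom P P' =
     {f. (\<forall>n. f n \<in> cells P n \<rightarrow>\<^sub>E cells P' n) \<and>
         (\<forall>n i k x. n > 0 \<longrightarrow> i \<in> {1..n} \<longrightarrow> k \<in> {0,1} \<longrightarrow> x \<in> cells P n \<longrightarrow>
            f (n - 1) (bd P n i k x) = bd P' n i k (f n x))}"

definition precubical_subset :: "'a precubical \<Rightarrow> 'a precubical \<Rightarrow> bool" where
  "precubical_subset Q P \<longleftrightarrow>
     precubical_set Q \<and> (\<forall>n. cells Q n \<subseteq> cells P n) \<and>
     (\<forall>n i k x. n > 0 \<longrightarrow> i \<in> {1..n} \<longrightarrow> k \<in> {0,1} \<longrightarrow> x \<in> cells Q n \<longrightarrow> bd Q n i k x = bd P n i k x)"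


section \<open>Standard cubes and regular elements\<close>

text \<open>A point of $I^n$ is an extensional function on \<open>{1..n}\<close>; the only point of $I^0$ is
  \<open>\<lambda>_. undefined\<close>.\<close>

definition cube_topology :: "nat \<Rightarrow> (nat \<Rightarrow> real) topology" where
  "cube_topology n = product_topology (\<lambda>_. top_of_set {0..1}) {1..n}"

definition cube :: "nat \<Rightarrow> (nat \<Rightarrow> real) set" where
  "cube n = {1..n} \<rightarrow>\<^sub>E {0..1}"

abbreviation unit_point :: "nat \<Rightarrow> real" where
  "unit_point \<equiv> (\<lambda>_. undefined)"

lemma topspace_cube_topology [simp]: "topspace (cube_topology n) = cube n"
  by (simp add: cube_topology_def cube_def)

text \<open>\<open>coface n i k\<close> is $\delta_i^k : I^n \to I^{n+1}$.\<close>

definition coface :: "nat \<Rightarrow> nat \<Rightarrow> nat \<Rightarrow> (nat \<Rightarrow> real) \<Rightarrow> (nat \<Rightarrow> real)" where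
  "coface n i k u =
     (\<lambda>j\<in>{1..Suc n}. if j < i then u j else if j = i then real k else u (j - 1))"

text \<open>\<open>box_hom m n\<close> is the set $\Box(I^m, I^n)$.\<close>

inductive is_box_map :: "nat \<Rightarrow> nat \<Rightarrow> ((nat \<Rightarrow> real) \<Rightarrow> (nat \<Rightarrow> real)) \<Rightarrow> bool" for m where
  ident: "is_box_map m m (restrict id (cube m))"
| coface: "is_box_map m n f \<Longrightarrow> i \<in> {1..Suc n} \<Longrightarrow> k \<in> {0,1} \<Longrightarrow>
             is_box_map m (Suc n) (compose (cube m) (coface n i k) f)"

definition box_hom :: "nat \<Rightarrow> nat \<Rightarrow> ((nat \<Rightarrow> real) \<Rightarrow> (nat \<Rightarrow> real)) set" where
  "box_hom m n = {f. is_box_map m n f}"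

definition standard_cube :: "nat \<Rightarrow> ((nat \<Rightarrow> real) \<Rightarrow> (nat \<Rightarrow> real)) precubical" where
  "standard_cube n =
     \<lparr>cells = (\<lambda>m. box_hom m n),
      bd = (\<lambda>m i k f. compose (cube (m - 1)) f (coface (m - 1) i k))\<rparr>"

definition sharp :: "'a precubical \<Rightarrow> nat \<Rightarrow> 'a \<Rightarrow> nat \<Rightarrow> ((nat \<Rightarrow> real) \<Rightarrow> (nat \<Rightarrow> real)) \<Rightarrow> 'a" where
  "sharp P n x = (THE f. f \<in> precubical_hom (standard_cube n) P \<and> f n (restrict id (cube n)) = x)"

definition regular :: "'a precubical \<Rightarrow> nat \<Rightarrow> 'a \<Rightarrow> bool" where
  "regular P n x \<longleftrightarrow> (\<forall>m. inj_on (sharp P n x m) (cells (standard_cube n) m))"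


section \<open>d-spaces\<close>

text \<open>Elements of $X^I$ are functions on the reals that are extensional on \<open>{0..1}\<close>.\<close>

definition paths :: "'p topology \<Rightarrow> (real \<Rightarrow> 'p) set" where
  "paths X = {\<omega> \<in> extensional {0..1}. pathin X \<omega>}"

text \<open>The reparametrizations are the increasing continuous maps $I \to I$; neither strictness nor
  preservation of the endpoints is required.\<close>

definition reparam :: "(real \<Rightarrow> real) \<Rightarrow> bool" where
  "reparam \<phi> \<longleftrightarrow> continuous_on {0..1} \<phi> \<and> \<phi> \<in> {0..1} \<rightarrow> {0..1} \<and> mono_on {0..1} \<phi>"

definition path_concat :: "(real \<Rightarrow> 'p) \<Rightarrow> (real \<Rightarrow> 'p) \<Rightarrow> (real \<Rightarrow> 'p)" where
  "path_concat \<omega> \<nu> = (\<lambda>t\<in>{0..1}. if t \<le> 1/2 then \<omega> (2 * t) else \<nu> (2 * t - 1))"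

record 'p dspace =
  topo :: "'p topology"
  dpaths :: "(real \<Rightarrow> 'p) set"

abbreviation points :: "'p dspace \<Rightarrow> 'p set" where
  "points X \<equiv> topspace (topo X)"

definition is_dspace :: "'p dspace \<Rightarrow> bool" where
  "is_dspace X \<longleftrightarrow>
     dpaths X \<subseteq> paths (topo X) \<and>
     (\<forall>a \<in> points X. (\<lambda>t\<in>{0..1}. a) \<in> dpaths X) \<and>
     (\<forall>\<omega> \<in> dpaths X. \<forall>\<phi>. reparam \<phi> \<longrightarrow> compose {0..1} \<omega> \<phi> \<in> dpaths X) \<and>
     (\<forall>\<omega> \<in> dpaths X. \<forall>\<nu> \<in> dpaths X. \<omega> 1 = \<nu> 0 \<longrightarrow> path_concat \<omega> \<nu> \<in> dpaths X)"

definition dmap :: "'p dspace \<Rightarrow> 'q dspace \<Rightarrow> ('p \<Rightarrow> 'q) \<Rightarrow> bool" where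
  "dmap X Y f \<longleftrightarrow>
     continuous_map (topo X) (topo Y) f \<and> (\<forall>\<omega> \<in> dpaths X. compose {0..1} f \<omega> \<in> dpaths Y)"

definition dsubspace :: "'p dspace \<Rightarrow> 'p set \<Rightarrow> 'p dspace" where
  "dsubspace X S =
     \<lparr>topo = subtopology (topo X) S, dpaths = {\<omega> \<in> dpaths X. \<omega> \<in> {0..1} \<rightarrow> S}\<rparr>"

definition is_dsubspace :: "'p dspace \<Rightarrow> 'p dspace \<Rightarrow> bool" where
  "is_dsubspace A X \<longleftrightarrow> points A \<subseteq> points X \<and> A = dsubspace X (points A)"


section \<open>Dihomotopy\<close>

definition dihomotopic_rel ::
    "'p dspace \<Rightarrow> 'q dspace \<Rightarrow> 'p set \<Rightarrow> ('p \<Rightarrow> 'q) \<Rightarrow> ('p \<Rightarrow> 'q) \<Rightarrow> bool" where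
  "dihomotopic_rel X Y S f g \<longleftrightarrow>
     dmap X Y f \<and> dmap X Y g \<and> S \<subseteq> points X \<and> (\<forall>a\<in>S. f a = g a) \<and>
     homotopic_with (\<lambda>h. dmap X Y h \<and> (\<forall>a\<in>S. h a = f a \<and> h a = g a)) (topo X) (topo Y) f g"

definition dihomotopy_equivalence_rel ::
    "'p dspace \<Rightarrow> 'p dspace \<Rightarrow> 'p dspace \<Rightarrow> ('p \<Rightarrow> 'p) \<Rightarrow> bool" where
  "dihomotopy_equivalence_rel A X Y f \<longleftrightarrow>
     is_dspace X \<and> is_dspace Y \<and> is_dsubspace A X \<and> is_dsubspace A Y \<and>
     dmap X Y f \<and> (\<forall>a \<in> points A. f a = a) \<and>
     (\<exists>g. dmap Y X g \<and> (\<forall>a \<in> points A. g a = a) \<and>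
          dihomotopic_rel X X (points A) (g \<circ> f) id \<and>
          dihomotopic_rel Y Y (points A) (f \<circ> g) id)"


section \<open>Fundamental category and fundamental bipartite graph\<close>

text \<open>\<open>Comp C f g\<close> is ``first \<open>f\<close>, then \<open>g\<close>''.\<close>

record ('o, 'm) category =
  Obj :: "'o set"
  Hom :: "'o \<Rightarrow> 'o \<Rightarrow> 'm set"
  Id :: "'o \<Rightarrow> 'm"
  Comp :: "'m \<Rightarrow> 'm \<Rightarrow> 'm"

definition full_subcategory :: "('o, 'm) category \<Rightarrow> 'o set \<Rightarrow> ('o, 'm) category" where
  "full_subcategory C S = C\<lparr>Obj := Obj C \<inter> S\<rparr>"

definition is_functor ::
    "('o, 'm) category \<Rightarrow> ('o2, 'm2) category \<Rightarrow> ('o \<Rightarrow> 'o2) \<Rightarrow> ('m \<Rightarrow> 'm2) \<Rightarrow> bool" where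
  "is_functor C D F F' \<longleftrightarrow>
     F \<in> Obj C \<rightarrow> Obj D \<and>
     (\<forall>a \<in> Obj C. \<forall>b \<in> Obj C. F' \<in> Hom C a b \<rightarrow> Hom D (F a) (F b)) \<and>
     (\<forall>a \<in> Obj C. F' (Id C a) = Id D (F a)) \<and>
     (\<forall>a \<in> Obj C. \<forall>b \<in> Obj C. \<forall>c \<in> Obj C. \<forall>f \<in> Hom C a b. \<forall>g \<in> Hom C b c.
        F' (Comp C f g) = Comp D (F' f) (F' g))"

definition is_category_iso ::
    "('o, 'm) category \<Rightarrow> ('o2, 'm2) category \<Rightarrow> ('o \<Rightarrow> 'o2) \<Rightarrow> ('m \<Rightarrow> 'm2) \<Rightarrow> bool" where
  "is_category_iso C D F F' \<longleftrightarrow>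
     is_functor C D F F' \<and>
     (\<exists>G G'. is_functor D C G G' \<and>
        (\<forall>a \<in> Obj C. G (F a) = a) \<and>
        (\<forall>a \<in> Obj C. \<forall>b \<in> Obj C. \<forall>f \<in> Hom C a b. G' (F' f) = f) \<and>
        (\<forall>a \<in> Obj D. F (G a) = a) \<and>
        (\<forall>a \<in> Obj D. \<forall>b \<in> Obj D. \<forall>f \<in> Hom D a b. F' (G' f) = f))"

definition dinterval :: "real dspace" where
  "dinterval = \<lparr>topo = top_of_set {0..1}, dpaths = {\<phi> \<in> extensional {0..1}. reparam \<phi>}\<rparr>"

text \<open>Being dihomotopic relative to \<open>{0, 1}\<close> includes having the same endpoints.\<close>

definition dihomotopy_relation :: "'p dspace \<Rightarrow> (real \<Rightarrow> 'p) rel" where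
  "dihomotopy_relation X =
     {(\<omega>, \<nu>). \<omega> \<in> dpaths X \<and> \<nu> \<in> dpaths X \<and> dihomotopic_rel dinterval X {0, 1} \<omega> \<nu>}"

definition dpaths_between :: "'p dspace \<Rightarrow> 'p \<Rightarrow> 'p \<Rightarrow> (real \<Rightarrow> 'p) set" where
  "dpaths_between X a b = {\<omega> \<in> dpaths X. \<omega> 0 = a \<and> \<omega> 1 = b}"

definition fundamental_category :: "'p dspace \<Rightarrow> ('p, (real \<Rightarrow> 'p) set) category" where
  "fundamental_category X =
     \<lparr>Obj = points X,
      Hom = (\<lambda>a b. dpaths_between X a b // dihomotopy_relation X),
      Id = (\<lambda>a. dihomotopy_relation X `` {\<lambda>t\<in>{0..1}. a}),
      Comp = (\<lambda>c c'. \<Union>\<omega>\<in>c. \<Union>\<nu>\<in>c'. dihomotopy_relation X `` {path_concat \<omega> \<nu>})\<rparr>"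

text \<open>The arrow part of the functor induced by a d-map \<open>f\<close> into \<open>Y\<close>; its object part is \<open>f\<close>.\<close>

definition induced_arrow ::
    "'q dspace \<Rightarrow> ('p \<Rightarrow> 'q) \<Rightarrow> (real \<Rightarrow> 'p) set \<Rightarrow> (real \<Rightarrow> 'q) set" where
  "induced_arrow Y f c = (\<Union>\<omega>\<in>c. dihomotopy_relation Y `` {compose {0..1} f \<omega>})"

definition minimal_point :: "'p dspace \<Rightarrow> 'p \<Rightarrow> bool" where
  "minimal_point X a \<longleftrightarrow> a \<in> points X \<and>
     (\<forall>y \<in> Obj (fundamental_category X). \<forall>c \<in> Hom (fundamental_category X) y a. y = a)"

definition maximal_point :: "'p dspace \<Rightarrow> 'p \<Rightarrow> bool" where
  "maximal_point X a \<longleftrightarrow> a \<in> points X \<and>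
     (\<forall>y \<in> Obj (fundamental_category X). \<forall>c \<in> Hom (fundamental_category X) a y. y = a)"

definition extremal_subspace :: "'p dspace \<Rightarrow> 'p dspace" where
  "extremal_subspace X = dsubspace X {a. minimal_point X a \<or> maximal_point X a}"

definition fundamental_bipartite_graph :: "'p dspace \<Rightarrow> ('p, (real \<Rightarrow> 'p) set) category" where
  "fundamental_bipartite_graph X =
     full_subcategory (fundamental_category X) (points (extremal_subspace X))"


section \<open>d-path spaces\<close>

definition compact_open_topology :: "'p topology \<Rightarrow> 'q topology \<Rightarrow> ('p \<Rightarrow> 'q) topology" where
  "compact_open_topology X Y =
     topology_generated_by
       {{f \<in> extensional (topspace X). continuous_map X Y f \<and> f \<in> K \<rightarrow> U} | K U.
          compactin X K \<and> openin Y U}"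

definition dpath_space :: "'p dspace \<Rightarrow> 'p \<Rightarrow> 'p \<Rightarrow> (real \<Rightarrow> 'p) topology" where
  "dpath_space X a b =
     subtopology (compact_open_topology (top_of_set {0..1}) (topo X)) (dpaths_between X a b)"

lemma topspace_compact_open_topology:
  "topspace (compact_open_topology X Y) = {f \<in> extensional (topspace X). continuous_map X Y f}"
  (is "_ = ?C")
proof -
  have "?C \<in> {{f \<in> extensional (topspace X). continuous_map X Y f \<and> f \<in> K \<rightarrow> U} | K U.
          compactin X K \<and> openin Y U}"
    by (rule CollectI, rule exI[of _ "{}"], rule exI[of _ "{}"]) auto
  then show ?thesis
    unfolding compact_open_topology_def topology_generated_by_topspace by blast
qed

text \<open>The library relation \<open>homotopy_equivalent_space\<close> does not name the map.\<close>

definition homotopy_equivalence_map :: "'p topology \<Rightarrow> 'q topology \<Rightarrow> ('p \<Rightarrow> 'q) \<Rightarrow> bool" where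
  "homotopy_equivalence_map X Y f \<longleftrightarrow>
     continuous_map X Y f \<and>
     (\<exists>g. continuous_map Y X g \<and>
          homotopic_with (\<lambda>_. True) X X (g \<circ> f) id \<and>
          homotopic_with (\<lambda>_. True) Y Y (f \<circ> g) id)"


section \<open>Geometric realization\<close>

definition quotient_topology :: "'p topology \<Rightarrow> 'p rel \<Rightarrow> 'p set topology" where
  "quotient_topology X R =
     topology (\<lambda>U. U \<subseteq> topspace X // R \<and> openin X {p \<in> topspace X. R `` {p} \<in> U})"

lemma openin_quotient_topology:
  "openin (quotient_topology X R) U \<longleftrightarrow>
     U \<subseteq> topspace X // R \<and> openin X {p \<in> topspace X. R `` {p} \<in> U}"
proof -
  have "istopology (\<lambda>U. U \<subseteq> topspace X // R \<and> openin X {p \<in> topspace X. R `` {p} \<in> U})"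
    unfolding istopology_def
  proof (intro conjI allI impI)
    fix S T
    assume "S \<subseteq> topspace X // R \<and> openin X {p \<in> topspace X. R `` {p} \<in> S}"
      and "T \<subseteq> topspace X // R \<and> openin X {p \<in> topspace X. R `` {p} \<in> T}"
    moreover have "{p \<in> topspace X. R `` {p} \<in> S \<inter> T} =
        {p \<in> topspace X. R `` {p} \<in> S} \<inter> {p \<in> topspace X. R `` {p} \<in> T}"
      by blast
    ultimately show "S \<inter> T \<subseteq> topspace X // R" and "openin X {p \<in> topspace X. R `` {p} \<in> S \<inter> T}"
      by auto
  next
    fix \<K>
    assume K: "\<forall>K\<in>\<K>. K \<subseteq> topspace X // R \<and> openin X {p \<in> topspace X. R `` {p} \<in> K}"
    then show "\<Union>\<K> \<subseteq> topspace X // R" by blast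
    have "{p \<in> topspace X. R `` {p} \<in> \<Union>\<K>} = (\<Union>K\<in>\<K>. {p \<in> topspace X. R `` {p} \<in> K})"
      by blast
    then show "openin X {p \<in> topspace X. R `` {p} \<in> \<Union>\<K>}"
      using K by auto
  qed
  then show ?thesis
    by (simp add: quotient_topology_def topology_inverse')
qed

lemma topspace_quotient_topology [simp]: "topspace (quotient_topology X R) = topspace X // R"
proof
  show "topspace (quotient_topology X R) \<subseteq> topspace X // R"
    using openin_quotient_topology openin_topspace by blast
  have "{p \<in> topspace X. R `` {p} \<in> topspace X // R} = topspace X"
    by (auto intro: quotientI)
  then show "topspace X // R \<subseteq> topspace (quotient_topology X R)"
    by (intro openin_subset) (simp add: openin_quotient_topology)
qed

type_synonym 'a precell = "nat \<times> 'a \<times> (nat \<Rightarrow> real)"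

definition precells :: "'a precubical \<Rightarrow> 'a precell topology" where
  "precells P =
     sum_topology (\<lambda>n. prod_topology (discrete_topology (cells P n)) (cube_topology n)) UNIV"

definition gluing :: "'a precubical \<Rightarrow> 'a precell rel" where
  "gluing P =
     {((n, bd P (Suc n) i k x, u), (Suc n, x, coface n i k u)) | n i k x u.
        x \<in> cells P (Suc n) \<and> i \<in> {1..Suc n} \<and> k \<in> {0,1} \<and> u \<in> cube n}"

definition gluing_equiv :: "'a precubical \<Rightarrow> 'a precell rel" where
  "gluing_equiv P = (gluing P \<union> (gluing P)\<inverse>)\<^sup>*"

text \<open>\<open>pt P n x u\<close> is the point $[x,u]$ for $x \in P_n$ and $u \in I^n$.\<close>

definition pt :: "'a precubical \<Rightarrow> nat \<Rightarrow> 'a \<Rightarrow> (nat \<Rightarrow> real) \<Rightarrow> 'a precell set" where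
  "pt P n x u = gluing_equiv P `` {(n, x, u)}"

definition cube_dpath :: "nat \<Rightarrow> (real \<Rightarrow> nat \<Rightarrow> real) \<Rightarrow> bool" where
  "cube_dpath n \<alpha> \<longleftrightarrow>
     continuous_map (top_of_set {0..1}) (cube_topology n) \<alpha> \<and>
     (\<forall>j \<in> {1..n}. mono_on {0..1} (\<lambda>t. \<alpha> t j))"

inductive_set finite_concats :: "'a precubical \<Rightarrow> (real \<Rightarrow> 'a precell set) set" for P where
  cell: "x \<in> cells P n \<Longrightarrow> cube_dpath n \<alpha> \<Longrightarrow> (\<lambda>t\<in>{0..1}. pt P n x (\<alpha> t)) \<in> finite_concats P"
| concat: "\<omega> \<in> finite_concats P \<Longrightarrow> \<nu> \<in> finite_concats P \<Longrightarrow> \<omega> 1 = \<nu> 0 \<Longrightarrow>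
             path_concat \<omega> \<nu> \<in> finite_concats P"

definition realization :: "'a precubical \<Rightarrow> 'a precell set dspace" where
  "realization P =
     \<lparr>topo = quotient_topology (precells P) (gluing_equiv P),
      dpaths = {compose {0..1} \<omega> \<phi> | \<omega> \<phi>. \<omega> \<in> finite_concats P \<and> reparam \<phi>}\<rparr>"

text \<open>For a precubical subset \<open>Q\<close> of \<open>P\<close>, \<open>subrealization P Q\<close> is $|Q|$ regarded as a d-subspace of
  $|P|$, so that the inclusion of $|Q|$ in $|P|$ is the identity on points.\<close>

definition subrealization :: "'a precubical \<Rightarrow> 'a precubical \<Rightarrow> 'a precell set dspace" where
  "subrealization P Q =
     dsubspace (realization P) {pt P n x u | n x u. x \<in> cells Q n \<and> u \<in> cube n}"


subsection \<open>The realization is a d-space\<close>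

lemma reparam_compose:
  assumes "reparam \<phi>" "reparam \<psi>" shows "reparam (\<phi> \<circ> \<psi>)"
proof -
  have "\<psi> ` {0..1} \<subseteq> {0..1}" using assms by (auto simp: reparam_def)
  then have "continuous_on {0..1} (\<phi> \<circ> \<psi>)"
    using assms continuous_on_compose continuous_on_subset unfolding reparam_def by blast
  then show ?thesis
    using assms by (auto simp: reparam_def monotone_on_def Pi_iff)
qed

lemma compose_reparam_assoc:
  assumes "reparam \<psi>"
  shows "compose {0..1} (compose {0..1} \<omega> \<phi>) \<psi> = compose {0..1} \<omega> (\<phi> \<circ> \<psi>)"
  using assms by (auto simp: compose_def fun_eq_iff reparam_def Pi_iff)

lemma finite_concats_extensional:
  "\<omega> \<in> finite_concats P \<Longrightarrow> \<omega> \<in> extensional {0..1}"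
  by (induction rule: finite_concats.induct) (unfold path_concat_def, rule restrict_extensional, rule restrict_extensional)

lemma reparam_id: "reparam (\<lambda>t. t)"
  by (auto simp: reparam_def monotone_on_def)

lemma path_concat_paths:
  assumes "\<omega> \<in> paths X" "\<nu> \<in> paths X" "\<omega> 1 = \<nu> 0"
  shows "path_concat \<omega> \<nu> \<in> paths X"
proof -
  let ?I = "top_of_set {0..1::real}"
  have "continuous_map ?I X (\<lambda>t. if t \<le> 1/2 then \<omega> (2 * t) else \<nu> (2 * t - 1))"
  proof (rule continuous_map_cases_le)
    show "continuous_map ?I euclideanreal (\<lambda>x. x)" "continuous_map ?I euclideanreal (\<lambda>x. 1/2)"
      by (auto simp: continuous_map_id_subt)
    have *: "continuous_map ?I X \<omega>" "continuous_map ?I X \<nu>"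
      using assms by (auto simp: paths_def pathin_def)
    show "continuous_map (subtopology ?I {x \<in> topspace ?I. x \<le> 1/2}) X (\<lambda>x. \<omega> (2 * x))"
      by (rule continuous_map_compose[OF _ *(1), unfolded o_def])
        (auto simp: subtopology_subtopology intro!: continuous_intros)
    show "continuous_map (subtopology ?I {x \<in> topspace ?I. 1/2 \<le> x}) X (\<lambda>x. \<nu> (2 * x - 1))"
      by (rule continuous_map_compose[OF _ *(2), unfolded o_def])
        (auto simp: subtopology_subtopology intro!: continuous_intros)
    show "\<omega> (2 * x) = \<nu> (2 * x - 1)" if "x \<in> topspace ?I" "x = 1/2" for x
      unfolding that(2) using assms(3) by simp
  qed
  then have "continuous_map ?I X (path_concat \<omega> \<nu>)"
    by (rule continuous_map_eq) (auto simp: path_concat_def)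
  moreover have "path_concat \<omega> \<nu> \<in> extensional {0..1}"
    unfolding path_concat_def by (rule restrict_extensional)
  ultimately show ?thesis by (simp add: paths_def pathin_def)
qed

lemma continuous_map_pt:
  assumes "x \<in> cells P n"
  shows "continuous_map (cube_topology n) (topo (realization P)) (pt P n x)"
proof -
  have 1: "continuous_map (cube_topology n) (precells P) (\<lambda>u. (n, x, u))"
    unfolding precells_def
    by (rule continuous_map_compose[of _ "prod_topology (discrete_topology (cells P n)) (cube_topology n)"
          "\<lambda>u. (x, u)" _ "\<lambda>p. (n, p)", unfolded o_def])
      (use assms in \<open>auto intro!: continuous_map_pairedI continuous_map_component_injection\<close>)
  have 2: "continuous_map (precells P) (quotient_topology (precells P) (gluing_equiv P))
             (\<lambda>p. gluing_equiv P `` {p})"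
    by (auto simp: continuous_map_def openin_quotient_topology intro: quotientI)
  show ?thesis
    using continuous_map_compose[OF 1 2] by (simp add: realization_def pt_def[abs_def] o_def)
qed

lemma finite_concats_paths:
  "\<omega> \<in> finite_concats P \<Longrightarrow> \<omega> \<in> paths (topo (realization P))"
proof (induction rule: finite_concats.induct)
  case (cell x n \<alpha>)
  have "continuous_map (top_of_set {0..1}) (topo (realization P)) (pt P n x \<circ> \<alpha>)"
    using cell by (auto simp: cube_dpath_def intro: continuous_map_compose continuous_map_pt)
  then have "continuous_map (top_of_set {0..1}) (topo (realization P)) (\<lambda>t\<in>{0..1}. pt P n x (\<alpha> t))"
    by (rule continuous_map_eq) auto
  then show ?case unfolding paths_def pathin_def using restrict_extensional by blast
next
  case (concat \<omega> \<nu>)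
  then show ?case by (blast intro: path_concat_paths)
qed

lemma compose_reparam_paths:
  assumes "\<omega> \<in> paths X" "reparam \<phi>" shows "compose {0..1} \<omega> \<phi> \<in> paths X"
proof -
  have "continuous_map (top_of_set {0..1}) (top_of_set {0..1}) \<phi>"
    using assms by (auto simp: reparam_def)
  then have "continuous_map (top_of_set {0..1}) X (\<omega> \<circ> \<phi>)"
    using assms(1) continuous_map_compose unfolding paths_def pathin_def by blast
  then have "continuous_map (top_of_set {0..1}) X (compose {0..1} \<omega> \<phi>)"
    by (rule continuous_map_eq) (auto simp: compose_def)
  then show ?thesis by (simp add: paths_def pathin_def compose_extensional)
qed

definition fixed_reparam :: "(real \<Rightarrow> real) \<Rightarrow> bool" where
  "fixed_reparam \<phi> \<longleftrightarrow> reparam \<phi> \<and> \<phi> 0 = 0 \<and> \<phi> 1 = 1"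

definition fixed_reparams :: "'a precubical \<Rightarrow> (real \<Rightarrow> 'a precell set) set" where
  "fixed_reparams P = {compose {0..1} \<omega> \<phi> | \<omega> \<phi>. \<omega> \<in> finite_concats P \<and> fixed_reparam \<phi>}"

lemma fixed_reparams_reparam:
  assumes "\<omega> \<in> fixed_reparams P" "fixed_reparam \<phi>"
  shows "compose {0..1} \<omega> \<phi> \<in> fixed_reparams P"
proof -
  obtain \<omega>' \<psi> where w: "\<omega>' \<in> finite_concats P" "fixed_reparam \<psi>" "\<omega> = compose {0..1} \<omega>' \<psi>"
    using assms by (auto simp: fixed_reparams_def)
  have "compose {0..1} \<omega> \<phi> = compose {0..1} \<omega>' (\<psi> \<circ> \<phi>)"
    using w assms compose_reparam_assoc by (auto simp: fixed_reparam_def)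
  moreover have "fixed_reparam (\<psi> \<circ> \<phi>)"
    using w assms by (auto simp: fixed_reparam_def intro: reparam_compose)
  ultimately show ?thesis using w by (auto simp: fixed_reparams_def)
qed

lemma reparam_join:
  assumes f: "continuous_on {0..c} f" "mono_on {0..c} f" "f \<in> {0..c} \<rightarrow> {0..d}"
    and g: "continuous_on {c..1} g" "mono_on {c..1} g" "g \<in> {c..1} \<rightarrow> {d..1}"
    and c: "0 \<le> c" "c \<le> 1" "0 \<le> d" "d \<le> 1" "f c = d" "g c = d"
  shows "reparam (\<lambda>t. if t \<le> c then f t else g t)"
  unfolding reparam_def
proof (intro conjI)
  have "{0..1} = {0..c} \<union> {c..1}" using c by auto
  then show "continuous_on {0..1} (\<lambda>t. if t \<le> c then f t else g t)"
    using f g c by (auto intro!: continuous_on_If[of "{0..c}" "{c..1}"])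
  show "(\<lambda>t. if t \<le> c then f t else g t) \<in> {0..1} \<rightarrow> {0..1}"
  proof
    fix t :: real assume t: "t \<in> {0..1}"
    show "(if t \<le> c then f t else g t) \<in> {0..1}"
    proof (cases "t \<le> c")
      case True
      then have "f t \<in> {0..d}" using f(3) t by (auto simp: Pi_iff)
      then show ?thesis using True c by auto
    next
      case False
      then have "g t \<in> {d..1}" using g(3) t by (auto simp: Pi_iff)
      then show ?thesis using False c by auto
    qed
  qed
  show "mono_on {0..1} (\<lambda>t. if t \<le> c then f t else g t)"
  proof (rule mono_onI)
    fix r s :: real assume rs: "r \<in> {0..1}" "s \<in> {0..1}" "r \<le> s"
    consider "s \<le> c" | "r \<le> c" "c < s" | "c < r" using rs by linarith
    then show "(if r \<le> c then f r else g r) \<le> (if s \<le> c then f s else g s)"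
    proof cases
      case 1 then show ?thesis using rs f(2) by (auto simp: monotone_on_def)
    next
      case 2
      then have "f r \<le> d" "d \<le> g s" using rs f(3) g(3) by (auto simp: Pi_iff)
      then show ?thesis using 2 by auto
    next
      case 3 then show ?thesis using rs g(2) by (auto simp: monotone_on_def)
    qed
  qed
qed

lemma fixed_reparams_concat:
  assumes "\<omega> \<in> fixed_reparams P" "\<nu> \<in> fixed_reparams P" "\<omega> 1 = \<nu> 0"
  shows "path_concat \<omega> \<nu> \<in> fixed_reparams P"
proof -
  obtain \<omega>' \<phi> where w: "\<omega>' \<in> finite_concats P" "fixed_reparam \<phi>" "\<omega> = compose {0..1} \<omega>' \<phi>"
    using assms by (auto simp: fixed_reparams_def)
  obtain \<nu>' \<psi> where v: "\<nu>' \<in> finite_concats P" "fixed_reparam \<psi>" "\<nu> = compose {0..1} \<nu>' \<psi>"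
    using assms by (auto simp: fixed_reparams_def)
  have "\<omega>' 1 = \<nu>' 0"
    using assms(3) w v by (simp add: compose_def fixed_reparam_def)
  then have con: "path_concat \<omega>' \<nu>' \<in> finite_concats P"
    using w v by (auto intro: finite_concats.concat)
  define \<theta> where "\<theta> t = (if t \<le> 1/2 then \<phi> (2 * t) / 2 else (\<psi> (2 * t - 1) + 1) / 2)" for t
  have ph: "continuous_on {0..1} \<phi>" "\<And>t. 0 \<le> t \<Longrightarrow> t \<le> 1 \<Longrightarrow> 0 \<le> \<phi> t \<and> \<phi> t \<le> 1" "mono_on {0..1} \<phi>"
      "\<phi> 0 = 0" "\<phi> 1 = 1"
    and ps: "continuous_on {0..1} \<psi>" "\<And>t. 0 \<le> t \<Longrightarrow> t \<le> 1 \<Longrightarrow> 0 \<le> \<psi> t \<and> \<psi> t \<le> 1" "mono_on {0..1} \<psi>"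
      "\<psi> 0 = 0" "\<psi> 1 = 1"
    using w v by (auto simp: fixed_reparam_def reparam_def Pi_iff)
  have "reparam \<theta>"
    unfolding \<theta>_def
  proof (rule reparam_join[where d = "1/2"])
    show "continuous_on {0..1/2} (\<lambda>t. \<phi> (2 * t) / 2)"
      by (intro continuous_intros continuous_on_compose2[OF ph(1)]) auto
    show "continuous_on {1/2..1} (\<lambda>t. (\<psi> (2 * t - 1) + 1) / 2)"
      by (intro continuous_intros continuous_on_compose2[OF ps(1)]) auto
    show "mono_on {0..1/2} (\<lambda>t. \<phi> (2 * t) / 2)"
      using ph(3) by (auto simp: monotone_on_def)
    show "mono_on {1/2..1} (\<lambda>t. (\<psi> (2 * t - 1) + 1) / 2)"
      using ps(3) by (auto simp: monotone_on_def)
  qed (use ph ps in auto)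
  then have chi: "fixed_reparam \<theta>"
    using ph ps by (simp add: fixed_reparam_def \<theta>_def)
  have "path_concat \<omega> \<nu> t = compose {0..1} (path_concat \<omega>' \<nu>') \<theta> t" for t
  proof (cases "t \<in> {0..1}")
    case True
    then have ct: "\<theta> t \<in> {0..1}" using chi by (auto simp: fixed_reparam_def reparam_def)
    show ?thesis
    proof (cases "t \<le> 1/2")
      case le: True
      then have "\<theta> t \<le> 1/2" using True ph(2)[of "2*t"] by (auto simp: \<theta>_def)
      then show ?thesis using True le ct
        by (auto simp: path_concat_def compose_def w(3) \<theta>_def)
    next
      case gt: False
      have p: "0 \<le> \<psi> (2 * t - 1)" using True gt ps(2)[of "2*t-1"] by auto
      have "\<nu>' (\<psi> (2 * t - 1)) = path_concat \<omega>' \<nu>' (\<theta> t)"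
      proof (cases "\<psi> (2 * t - 1) = 0")
        case True then show ?thesis using gt \<open>\<omega>' 1 = \<nu>' 0\<close> by (simp add: path_concat_def \<theta>_def)
      next
        case False
        have th: "\<theta> t = (\<psi> (2 * t - 1) + 1) / 2"
          unfolding \<theta>_def by (rule if_not_P[OF gt])
        have "2 * \<theta> t - 1 = \<psi> (2 * t - 1)" unfolding th by (simp add: field_simps)
        moreover have "\<not> \<theta> t \<le> 1/2" unfolding th using False p by simp
        ultimately show ?thesis unfolding path_concat_def restrict_apply'[OF ct] by simp
      qed
      moreover have "path_concat \<omega> \<nu> t = \<nu>' (\<psi> (2 * t - 1))"
        using True gt by (simp add: path_concat_def compose_def v(3))
      ultimately show ?thesis using True by (simp add: compose_def)
    qed
  qed (auto simp: path_concat_def compose_def)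
  then have "path_concat \<omega> \<nu> = compose {0..1} (path_concat \<omega>' \<nu>') \<theta>"
    by (rule ext)
  then show ?thesis using con chi unfolding fixed_reparams_def by blast
qed

lemma finite_concats_fixed:
  "\<omega> \<in> finite_concats P \<Longrightarrow> \<omega> \<in> fixed_reparams P"
  unfolding fixed_reparams_def fixed_reparam_def
  using reparam_id finite_concats_extensional[of \<omega> P]
  by (auto intro!: exI[of _ \<omega>] exI[of _ "\<lambda>t. t"] simp: compose_def fun_eq_iff extensional_def)

lemma compose_reparam_fixed:
  assumes "\<omega> \<in> finite_concats P" "reparam \<phi>"
  shows "compose {0..1} \<omega> \<phi> \<in> fixed_reparams P"
  using assms
proof (induction arbitrary: \<phi> rule: finite_concats.induct)
  case (cell x n \<alpha>)
  have r: "continuous_map (top_of_set {0..1}) (top_of_set {0..1}) \<phi>" "\<phi> \<in> {0..1} \<rightarrow> {0..1}"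
     "mono_on {0..1} \<phi>"
    using cell by (auto simp: reparam_def)
  have "continuous_map (top_of_set {0..1}) (cube_topology n) (\<alpha> \<circ> \<phi>)"
    using cell(2) r(1) continuous_map_compose unfolding cube_dpath_def by blast
  then have "cube_dpath n (\<alpha> \<circ> \<phi>)"
    using cell(2) r unfolding cube_dpath_def by (auto simp: monotone_on_def Pi_iff)
  then have "(\<lambda>t\<in>{0..1}. pt P n x ((\<alpha> \<circ> \<phi>) t)) \<in> finite_concats P"
    by (rule finite_concats.cell[OF cell(1)])
  moreover have "(\<lambda>t\<in>{0..1}. pt P n x ((\<alpha> \<circ> \<phi>) t)) = compose {0..1} (\<lambda>t\<in>{0..1}. pt P n x (\<alpha> t)) \<phi>"
    using r by (auto simp: compose_def fun_eq_iff)
  ultimately show ?case using finite_concats_fixed by metis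
next
  case (concat \<omega> \<nu>)
  have c: "continuous_on {0..1} \<phi>" and m: "\<And>s t. 0 \<le> s \<Longrightarrow> s \<le> t \<Longrightarrow> t \<le> 1 \<Longrightarrow> \<phi> s \<le> \<phi> t"
    and b: "\<And>t. 0 \<le> t \<Longrightarrow> t \<le> 1 \<Longrightarrow> 0 \<le> \<phi> t \<and> \<phi> t \<le> 1"
    using concat.prems by (auto simp: reparam_def monotone_on_def Pi_iff)
  consider "\<phi> 1 \<le> 1/2" | "1/2 \<le> \<phi> 0" | "\<phi> 0 < 1/2" "1/2 < \<phi> 1" by linarith
  then show ?case
  proof cases
    case 1
    then have u: "\<phi> t \<le> 1/2" if "0 \<le> t" "t \<le> 1" for t using m[of t 1] that by auto
    have "reparam (\<lambda>t. 2 * \<phi> t)"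
      using c m b u by (auto simp: reparam_def monotone_on_def intro!: continuous_intros)
         (smt (verit) u)+
    from concat.IH(1)[OF this]
    have "compose {0..1} \<omega> (\<lambda>t. 2 * \<phi> t) \<in> fixed_reparams P" .
    moreover have "compose {0..1} (path_concat \<omega> \<nu>) \<phi> = compose {0..1} \<omega> (\<lambda>t. 2 * \<phi> t)"
      using b u by (auto simp: compose_def path_concat_def fun_eq_iff)
    ultimately show ?thesis by simp
  next
    case 2
    then have u: "1/2 \<le> \<phi> t" if "0 \<le> t" "t \<le> 1" for t using m[of 0 t] that by auto
    have "reparam (\<lambda>t. 2 * \<phi> t - 1)"
      using c m b u by (auto simp: reparam_def monotone_on_def intro!: continuous_intros)
         (smt (verit) u)+
    from concat.IH(2)[OF this]
    have "compose {0..1} \<nu> (\<lambda>t. 2 * \<phi> t - 1) \<in> fixed_reparams P" .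
    moreover have "path_concat \<omega> \<nu> (\<phi> t) = \<nu> (2 * \<phi> t - 1)" if "0 \<le> t" "t \<le> 1" for t
    proof (cases "\<phi> t = 1/2")
      case True
      show ?thesis unfolding True using concat.hyps(3) by (simp add: path_concat_def)
    next
      case False
      then show ?thesis using b[OF that] u[OF that] by (simp add: path_concat_def)
    qed
    then have "compose {0..1} (path_concat \<omega> \<nu>) \<phi> = compose {0..1} \<nu> (\<lambda>t. 2 * \<phi> t - 1)"
      by (auto simp: compose_def fun_eq_iff)
    ultimately show ?thesis by simp
  next
    case 3
    obtain s where s: "0 \<le> s" "s \<le> 1" "\<phi> s = 1/2"
      using IVT'[of \<phi> 0 "1/2" 1] 3 c by auto
    have s0: "0 < s" "s < 1" using s 3 by (auto simp: less_le)
    have in1: "0 \<le> s * t \<and> s * t \<le> s" if "0 \<le> t" "t \<le> 1" for t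
      using that s0 by (simp add: mult_left_le)
    have in2: "s \<le> s + (1 - s) * t \<and> s + (1 - s) * t \<le> 1" if "0 \<le> t" "t \<le> 1" for t
    proof -
      have "(1 - s) * t \<le> 1 - s" using that s0 by (intro mult_left_le) auto
      moreover have "0 \<le> (1 - s) * t" using that s0 by simp
      ultimately show ?thesis by linarith
    qed
    let ?f = "\<lambda>t. 2 * \<phi> (s * t)" and ?g = "\<lambda>t. 2 * \<phi> (s + (1 - s) * t) - 1"
    have rf: "reparam ?f"
      unfolding reparam_def
    proof (intro conjI)
      show "continuous_on {0..1} ?f"
      proof (intro continuous_intros continuous_on_compose2[OF c])
        show "(\<lambda>t. s * t) ` {0..1} \<subseteq> {0..1}"
        proof (rule image_subsetI)
          fix t :: real assume "t \<in> {0..1}"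
          then show "s * t \<in> {0..1}" using in1[of t] s0 by (auto simp: mult_le_one)
        qed
      qed
      show "?f \<in> {0..1} \<rightarrow> {0..1}"
      proof
        fix t :: real assume "t \<in> {0..1}"
        then show "?f t \<in> {0..1}"
          using in1[of t] s s0 m[of "s * t" s] b[of "s * t"] by (auto simp: mult_le_one)
      qed
      show "mono_on {0..1} ?f"
      proof (rule mono_onI)
        fix r t :: real assume rt: "r \<in> {0..1}" "t \<in> {0..1}" "r \<le> t"
        then have "s * r \<le> s * t" using s0 by (intro mult_left_mono) auto
        then show "?f r \<le> ?f t" using in1[of r] in1[of t] rt s0 m[of "s * r" "s * t"] by (auto simp: mult_le_one)
      qed
    qed
    have rg: "reparam ?g"
      unfolding reparam_def
    proof (intro conjI)
      show "continuous_on {0..1} ?g"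
      proof (intro continuous_intros continuous_on_compose2[OF c])
        show "(\<lambda>t. s + (1 - s) * t) ` {0..1} \<subseteq> {0..1}"
        proof (rule image_subsetI)
          fix t :: real assume "t \<in> {0..1}"
          then show "s + (1 - s) * t \<in> {0..1}" using in2[of t] s0 by auto
        qed
      qed
      show "?g \<in> {0..1} \<rightarrow> {0..1}"
      proof
        fix t :: real assume "t \<in> {0..1}"
        then show "?g t \<in> {0..1}"
          using in2[of t] s s0 m[of s "s + (1 - s) * t"] b[of "s + (1 - s) * t"] by auto
      qed
      show "mono_on {0..1} ?g"
      proof (rule mono_onI)
        fix r t :: real assume rt: "r \<in> {0..1}" "t \<in> {0..1}" "r \<le> t"
        then have "(1 - s) * r \<le> (1 - s) * t" using s0 by (intro mult_left_mono) auto
        then show "?g r \<le> ?g t" using in2[of r] in2[of t] rt s0 m[of "s + (1 - s) * r" "s + (1 - s) * t"] by auto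
      qed
    qed
    let ?w = "compose {0..1} \<omega> ?f" and ?v = "compose {0..1} \<nu> ?g"
    have "2 * \<phi> s = 1" using s by simp
    then have "?w 1 = ?v 0" using concat.hyps(3) by (simp add: compose_def)
    then have wv: "path_concat ?w ?v \<in> fixed_reparams P"
      using concat.IH rf rg fixed_reparams_concat by blast
    define \<theta> where "\<theta> t = (if t \<le> s then t / (2 * s) else (1 + (t - s) / (1 - s)) / 2)" for t
    have "reparam \<theta>"
      unfolding \<theta>_def
    proof (rule reparam_join[where d = "1/2"])
      show "continuous_on {0..s} (\<lambda>t. t / (2 * s))" "continuous_on {s..1} (\<lambda>t. (1 + (t - s) / (1 - s)) / 2)"
        using s0 by (auto intro!: continuous_intros)
      show "mono_on {0..s} (\<lambda>t. t / (2 * s))" "mono_on {s..1} (\<lambda>t. (1 + (t - s) / (1 - s)) / 2)"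
        using s0 by (auto intro!: mono_onI divide_right_mono)
      show "(\<lambda>t. t / (2 * s)) \<in> {0..s} \<rightarrow> {0..1/2}" "(\<lambda>t. (1 + (t - s) / (1 - s)) / 2) \<in> {s..1} \<rightarrow> {1/2..1}"
        using s0 by (auto simp: field_simps)
    qed (use s0 in auto)
    then have chi: "fixed_reparam \<theta>" using s0 by (auto simp: fixed_reparam_def \<theta>_def)
    have "compose {0..1} (path_concat \<omega> \<nu>) \<phi> t = compose {0..1} (path_concat ?w ?v) \<theta> t" for t
    proof (cases "t \<in> {0..1}")
      case True
      then have ct: "\<theta> t \<in> {0..1}" using chi by (auto simp: fixed_reparam_def reparam_def)
      show ?thesis
      proof (cases "t \<le> s")
        case le: True
        then have "\<phi> t \<le> 1/2" using m[of t s] s True by auto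
        then have 1: "path_concat \<omega> \<nu> (\<phi> t) = \<omega> (2 * \<phi> t)"
          using b[of t] True by (simp add: path_concat_def)
        have th: "\<theta> t = t / (2 * s)" unfolding \<theta>_def by (rule if_P[OF le])
        have th2: "\<theta> t \<le> 1/2" unfolding th using le s0 by (simp add: field_simps)
        have "s * (2 * \<theta> t) = t" unfolding th using s0 by simp
        moreover have "2 * \<theta> t \<in> {0..1}" using ct th2 by auto
        ultimately have "?w (2 * \<theta> t) = \<omega> (2 * \<phi> t)" by (simp add: compose_def)
        then have "path_concat ?w ?v (\<theta> t) = \<omega> (2 * \<phi> t)"
          unfolding path_concat_def restrict_apply'[OF ct] using th2 by simp
        then show ?thesis using True 1 by (simp add: compose_def[of _ "path_concat _ _"])
      next
        case gt: False
        have "1/2 \<le> \<phi> t" using m[of s t] s True gt by auto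
        then have 1: "path_concat \<omega> \<nu> (\<phi> t) = \<nu> (2 * \<phi> t - 1)"
        proof (cases "\<phi> t = 1/2")
          case eq: True
          show ?thesis unfolding eq using concat.hyps(3) by (simp add: path_concat_def)
        next
          case False
          then show ?thesis using b[of t] True \<open>1/2 \<le> \<phi> t\<close> by (simp add: path_concat_def)
        qed
        have th: "\<theta> t = (1 + (t - s) / (1 - s)) / 2" unfolding \<theta>_def by (rule if_not_P[OF gt])
        have th2: "\<theta> t > 1/2" unfolding th using gt s0 by simp
        have "2 * ((1 + y) / 2) - 1 = y" for y :: real by (simp add: field_simps)
        then have "2 * \<theta> t - 1 = (t - s) / (1 - s)" unfolding th .
        then have "s + (1 - s) * (2 * \<theta> t - 1) = t" using s0 by simp
        moreover have "2 * \<theta> t - 1 \<in> {0..1}" using ct th2 by auto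
        ultimately have "?v (2 * \<theta> t - 1) = \<nu> (2 * \<phi> t - 1)" by (simp add: compose_def)
        then have "path_concat ?w ?v (\<theta> t) = \<nu> (2 * \<phi> t - 1)"
          unfolding path_concat_def restrict_apply'[OF ct] using th2 by simp
        then show ?thesis using True 1 by (simp add: compose_def[of _ "path_concat _ _"])
      qed
    qed (auto simp: compose_def)
    then have "compose {0..1} (path_concat \<omega> \<nu>) \<phi> = compose {0..1} (path_concat ?w ?v) \<theta>"
      by (rule ext)
    then show ?thesis using fixed_reparams_reparam[OF wv chi] by simp
  qed
qed

lemma dpaths_realization: "dpaths (realization P) = fixed_reparams P"
proof
  show "dpaths (realization P) \<subseteq> fixed_reparams P"
    unfolding realization_def using compose_reparam_fixed by fastforce
  show "fixed_reparams P \<subseteq> dpaths (realization P)"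
    unfolding realization_def fixed_reparams_def fixed_reparam_def by fastforce
qed

proposition is_dspace_realization: "is_dspace (realization P)"
  unfolding is_dspace_def
proof (intro conjI ballI allI impI)
  show "dpaths (realization P) \<subseteq> paths (topo (realization P))"
  proof
    fix \<omega> assume "\<omega> \<in> dpaths (realization P)"
    then obtain \<nu> \<phi> where "\<omega> = compose {0..1} \<nu> \<phi>" "\<nu> \<in> finite_concats P" "reparam \<phi>"
      unfolding realization_def by auto
    then show "\<omega> \<in> paths (topo (realization P))"
      by (metis finite_concats_paths compose_reparam_paths)
  qed
next
  fix a assume "a \<in> points (realization P)"
  then obtain n x u where a: "a = pt P n x u" "x \<in> cells P n" "u \<in> cube n"
    by (auto simp: realization_def precells_def pt_def elim!: quotientE)
  have "cube_dpath n (\<lambda>_. u)"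
    using a by (auto simp: cube_dpath_def monotone_on_def)
  from finite_concats.cell[OF a(2) this] show "(\<lambda>t\<in>{0..1}. a) \<in> dpaths (realization P)"
    using finite_concats_fixed a(1) by (auto simp: dpaths_realization)
next
  fix \<omega> \<phi> assume a: "\<omega> \<in> dpaths (realization P)" "reparam \<phi>"
  then obtain \<nu> \<psi> where w: "\<omega> = compose {0..1} \<nu> \<psi>" "\<nu> \<in> finite_concats P" "reparam \<psi>"
    unfolding realization_def by auto
  have "compose {0..1} \<omega> \<phi> = compose {0..1} \<nu> (\<psi> \<circ> \<phi>)"
    unfolding w(1) by (rule compose_reparam_assoc[OF a(2)])
  then show "compose {0..1} \<omega> \<phi> \<in> dpaths (realization P)"
    using w a reparam_compose unfolding dpaths_realization by (metis compose_reparam_fixed)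
next
  fix \<omega> \<nu> assume "\<omega> \<in> dpaths (realization P)" "\<nu> \<in> dpaths (realization P)" "\<omega> 1 = \<nu> 0"
  then show "path_concat \<omega> \<nu> \<in> dpaths (realization P)"
    by (simp add: dpaths_realization fixed_reparams_concat)
qed

lemma is_dspace_dsubspace:
  assumes "is_dspace X" shows "is_dspace (dsubspace X S)"
  unfolding is_dspace_def
proof (intro conjI ballI allI impI)
  show "dpaths (dsubspace X S) \<subseteq> paths (topo (dsubspace X S))"
    using assms by (auto simp: is_dspace_def dsubspace_def paths_def pathin_subtopology Pi_iff)
  show "(\<lambda>t\<in>{0..1}. a) \<in> dpaths (dsubspace X S)" if "a \<in> points (dsubspace X S)" for a
    using assms that by (auto simp: is_dspace_def dsubspace_def)
  show "compose {0..1} \<omega> \<phi> \<in> dpaths (dsubspace X S)"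
    if "\<omega> \<in> dpaths (dsubspace X S)" "reparam \<phi>" for \<omega> \<phi>
    using assms that by (auto simp: is_dspace_def dsubspace_def reparam_def compose_def Pi_iff)
  show "path_concat \<omega> \<nu> \<in> dpaths (dsubspace X S)"
    if "\<omega> \<in> dpaths (dsubspace X S)" "\<nu> \<in> dpaths (dsubspace X S)" "\<omega> 1 = \<nu> 0" for \<omega> \<nu>
    using assms that by (auto simp: is_dspace_def dsubspace_def path_concat_def Pi_iff)
qed


section \<open>Extremal elements\<close>

definition minimal_vertex :: "'a precubical \<Rightarrow> 'a \<Rightarrow> bool" where
  "minimal_vertex P v \<longleftrightarrow> v \<in> cells P 0 \<and> \<not> (\<exists>x \<in> cells P 1. bd P 1 1 1 x = v)"

definition maximal_vertex :: "'a precubical \<Rightarrow> 'a \<Rightarrow> bool" where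
  "maximal_vertex P v \<longleftrightarrow> v \<in> cells P 0 \<and> \<not> (\<exists>x \<in> cells P 1. bd P 1 1 0 x = v)"

definition Extrl :: "'a precubical \<Rightarrow> 'a precubical" where
  "Extrl P =
     P\<lparr>cells := (\<lambda>n. if n = 0 then {v. minimal_vertex P v \<or> maximal_vertex P v} else {})\<rparr>"

end

theory Submission
  imports Defs
begin

text \<open>For \<open>b = 1\<close> the free corner of the square \<open>x\<close> is its top left vertex, and the square can be pushed
  onto its bottom and right edges along the direction \<open>(1, -1)\<close>:
  $r(s,t) = (\min(1,s+t), \max(0,s+t-1))$. This retraction is order-preserving and fixes the two
  remaining edges, so the straight-line homotopy from the identity to \<open>r\<close> runs through
  order-preserving maps. The hypotheses say that the interior of \<open>x\<close>, the two free edges and the free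
  vertex are attached to nothing else (a 3-cube cannot contain \<open>x\<close>, by regularity), so the homotopy
  extends by the identity to a directed deformation of $|P|$ onto $|Q|$; the case \<open>b = 0\<close> is
  symmetric. Composing paths with this deformation gives the statements about d-path spaces and
  fundamental categories. Extremal points are compared by means of the function
  $[y,u] \mapsto \sum_i u_i(1-u_i)$ on $|P|$, which detects that a path is not constant.\<close>

section \<open>d-maps and the fundamental category\<close>

text \<open>Equality of points of $|P|$ is a generated equivalence relation on precells, and the
  proof is arranged so that it never has to be decided. The homotopy is written on representatives:
  a point of a free edge has a precell of its own besides the one on the boundary of the square, and
  both must move in the same way, so what has to be checked is compatibility with the generating
  relation. To tell points apart, an invariant of classes is enough. The summand $u(1-u)$ vanishes
  at 0 and 1, hence the sum does not notice a coordinate inserted by a coface.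

  The comparison of extremal points is not formal: a point could become minimal in $|Q|$ because the
  d-paths that reach it in $|P|$ start in the removed region. If such a d-path started at $y$
  outside $|Q|$, the retraction would send all points of the square below $y$ to one point. But it
  carries the beginning of a free edge onto the beginning of a kept edge, where the invariant is not
  constant. Maximal points are treated at the opposite vertex of the square.\<close>

lemma dpath_in_points:
  assumes "is_dspace X" "\<omega> \<in> dpaths X" "t \<in> {0..1}"
  shows "\<omega> t \<in> points X"
proof -
  have "pathin (topo X) \<omega>" using assms(1,2) unfolding is_dspace_def paths_def by blast
  then show ?thesis using assms(3) by (auto simp: pathin_def continuous_map_def Pi_iff)
qed

lemma dpath_extensional:
  assumes "is_dspace X" "\<omega> \<in> dpaths X"
  shows "\<omega> \<in> extensional {0..1}"
  using assms by (auto simp: is_dspace_def paths_def)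

lemma continuous_map_dpath:
  assumes "is_dspace X" "\<omega> \<in> dpaths X"
  shows "continuous_map (top_of_set {0..1}) (topo X) \<omega>"
  using assms by (auto simp: is_dspace_def paths_def pathin_def)

text \<open>Unfolding \<open>homotopic_with\<close> asks that the predicate on intermediate maps
  ignore values outside the space; this provides it for d-maps.\<close>

lemma dmap_cong:
  assumes X: "is_dspace X" and eq: "\<And>a. a \<in> points X \<Longrightarrow> f a = g a"
  shows "dmap X Y f \<longleftrightarrow> dmap X Y g"
proof -
  have "compose {0..1} f \<omega> = compose {0..1} g \<omega>" if "\<omega> \<in> dpaths X" for \<omega>
    using dpath_in_points[OF X that] eq by (auto simp: compose_def fun_eq_iff)
  moreover have "continuous_map (topo X) (topo Y) f \<longleftrightarrow> continuous_map (topo X) (topo Y) g"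
    using eq by (metis continuous_map_eq)
  ultimately show ?thesis by (auto simp: dmap_def)
qed

text \<open>The identity of the interval is itself a d-path of \<open>dinterval\<close>, which gives
  one direction; closure of d-paths under reparametrization gives the other.\<close>

lemma dmap_dinterval_iff:
  assumes X: "is_dspace X"
  shows "dmap dinterval X h \<longleftrightarrow> restrict h {0..1} \<in> dpaths X"
proof
  assume h: "dmap dinterval X h"
  have "(\<lambda>t\<in>{0..1::real}. t) \<in> dpaths dinterval"
    by (auto simp: dinterval_def reparam_def monotone_on_def cong: continuous_on_cong_simp)
  then have "compose {0..1} h (\<lambda>t\<in>{0..1}. t) \<in> dpaths X" using h unfolding dmap_def by blast
  moreover have "compose {0..1} h (\<lambda>t\<in>{0..1}. t) = restrict h {0..1}"
    by (auto simp: compose_def fun_eq_iff)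
  ultimately show "restrict h {0..1} \<in> dpaths X" by simp
next
  assume h: "restrict h {0..1} \<in> dpaths X"
  have "continuous_map (top_of_set {0..1}) (topo X) h"
    by (rule continuous_map_eq[OF continuous_map_dpath[OF X h]]) auto
  moreover have "compose {0..1} h \<phi> \<in> dpaths X" if p: "reparam \<phi>" for \<phi>
  proof -
    have "compose {0..1} h \<phi> = compose {0..1} (restrict h {0..1}) \<phi>"
      using p by (auto simp: compose_def fun_eq_iff reparam_def Pi_iff)
    then show ?thesis using X h p by (simp add: is_dspace_def)
  qed
  ultimately show "dmap dinterval X h" by (simp add: dmap_def dinterval_def)
qed

lemma dpaths_betweenD:
  assumes "\<omega> \<in> dpaths_between X a b" shows "\<omega> \<in> dpaths X" "\<omega> 0 = a" "\<omega> 1 = b"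
  using assms by (auto simp: dpaths_between_def)

section \<open>Dihomotopy of d-paths relative to the endpoints\<close>

text \<open>Trades d-maps out of \<open>dinterval\<close> for d-paths with fixed ends. The
  intermediate maps of \<open>homotopic_with\<close> are arbitrary outside \<open>{0..1}\<close>,
  whereas d-paths are extensional, hence the restriction.\<close>

lemma dihomotopy_relation_iff:
  assumes X: "is_dspace X"
  shows "(\<omega>, \<nu>) \<in> dihomotopy_relation X \<longleftrightarrow>
    (\<exists>a b. \<omega> \<in> dpaths_between X a b \<and> \<nu> \<in> dpaths_between X a b \<and>
       homotopic_with (\<lambda>h. restrict h {0..1} \<in> dpaths_between X a b) (top_of_set {0..1}) (topo X) \<omega> \<nu>)"
    (is "?L \<longleftrightarrow> ?R")
proof
  assume L: ?L
  have "homotopic_with (\<lambda>h. restrict h {0..1} \<in> dpaths_between X (\<omega> 0) (\<omega> 1))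
          (top_of_set {0..1}) (topo X) \<omega> \<nu>"
    by (rule homotopic_with_mono[of "\<lambda>h. dmap dinterval X h \<and> (\<forall>a\<in>{0, 1}. h a = \<omega> a \<and> h a = \<nu> a)"])
       (use L in \<open>auto simp: dihomotopy_relation_def dihomotopic_rel_def dpaths_between_def
          dmap_dinterval_iff[OF X, unfolded dinterval_def] dinterval_def\<close>)
  then show ?R using L
    by (intro exI[of _ "\<omega> 0"] exI[of _ "\<omega> 1"])
       (auto simp: dihomotopy_relation_def dihomotopic_rel_def dpaths_between_def)
next
  assume ?R
  then obtain a b where *: "\<omega> \<in> dpaths_between X a b" "\<nu> \<in> dpaths_between X a b"
       "homotopic_with (\<lambda>h. restrict h {0..1} \<in> dpaths_between X a b) (top_of_set {0..1}) (topo X) \<omega> \<nu>"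
    by blast
  have "homotopic_with (\<lambda>h. dmap dinterval X h \<and> (\<forall>a\<in>{0, 1}. h a = \<omega> a \<and> h a = \<nu> a))
          (topo dinterval) (topo X) \<omega> \<nu>"
    unfolding dinterval_def dspace.select_convs dmap_dinterval_iff[OF X, unfolded dinterval_def]
    by (rule homotopic_with_mono[OF *(3)]) (use * in \<open>auto simp: dpaths_between_def\<close>)
  then show ?L
    using * dpath_extensional[OF X]
    by (auto simp: dihomotopy_relation_def dihomotopic_rel_def dmap_dinterval_iff[OF X, unfolded dinterval_def]
        dinterval_def dpaths_between_def extensional_restrict)
qed

lemma equiv_dihomotopy_relation:
  assumes X: "is_dspace X" shows "equiv (dpaths X) (dihomotopy_relation X)"
proof (intro equivI)
  show "dihomotopy_relation X \<subseteq> dpaths X \<times> dpaths X"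
    by (auto simp: dihomotopy_relation_def)
  show "refl_on (dpaths X) (dihomotopy_relation X)"
  proof (rule refl_onI)
    fix \<omega> assume w: "\<omega> \<in> dpaths X"
    then show "(\<omega>, \<omega>) \<in> dihomotopy_relation X"
      unfolding dihomotopy_relation_iff[OF X]
      using continuous_map_dpath[OF X w] dpath_extensional[OF X w]
      by (auto simp: dpaths_between_def extensional_restrict)
  qed
  show "sym (dihomotopy_relation X)"
    unfolding dihomotopy_relation_iff[OF X] sym_def using homotopic_with_symD by blast
  show "trans (dihomotopy_relation X)"
  proof (rule transI)
    fix \<omega> \<nu> \<mu> assume a: "(\<omega>, \<nu>) \<in> dihomotopy_relation X" "(\<nu>, \<mu>) \<in> dihomotopy_relation X"
    then show "(\<omega>, \<mu>) \<in> dihomotopy_relation X"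
      unfolding dihomotopy_relation_iff[OF X]
      by (auto simp: dpaths_between_def intro!: exI[of _ "\<mu> 0"] exI[of _ "\<mu> 1"] intro: homotopic_with_trans)
  qed
qed

lemma dihomotopy_class_eqI:
  assumes "is_dspace X" "(\<omega>, \<nu>) \<in> dihomotopy_relation X"
  shows "dihomotopy_relation X `` {\<omega>} = dihomotopy_relation X `` {\<nu>}"
  using equiv_class_eq[OF equiv_dihomotopy_relation[OF assms(1)] assms(2)] .

lemma dihomotopy_relation_refl:
  assumes "is_dspace X" "\<omega> \<in> dpaths X"
  shows "(\<omega>, \<omega>) \<in> dihomotopy_relation X"
  using equiv_dihomotopy_relation[OF assms(1)] assms(2) by (meson equivE refl_onD)

lemma dihomotopy_relationI:
  fixes X :: "'p dspace" and h :: "real \<times> real \<Rightarrow> 'p"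
  assumes X: "is_dspace X"
    and h: "continuous_map (prod_topology (top_of_set {0..1}) (top_of_set {0..1})) (topo X) h"
    and h0: "\<And>t. t \<in> {0..1} \<Longrightarrow> h (0, t) = \<omega> t" and h1: "\<And>t. t \<in> {0..1} \<Longrightarrow> h (1, t) = \<nu> t"
    and d: "\<And>s. s \<in> {0..1} \<Longrightarrow> (\<lambda>t\<in>{0..1}. h (s, t)) \<in> dpaths_between X a b"
    and e: "\<omega> \<in> extensional {0..1}" "\<nu> \<in> extensional {0..1}"
  shows "(\<omega>, \<nu>) \<in> dihomotopy_relation X"
proof -
  have w: "\<omega> = (\<lambda>t\<in>{0..1}. h (0, t))" "\<nu> = (\<lambda>t\<in>{0..1}. h (1, t))"
    using h0 h1 e by (auto simp: fun_eq_iff extensional_def)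
  have hom: "homotopic_with (\<lambda>h. restrict h {0..1} \<in> dpaths_between X a b) (top_of_set {0..1}) (topo X) \<omega> \<nu>"
  proof (subst homotopic_with)
    fix h k :: "real \<Rightarrow> 'p" assume "\<And>x. x \<in> topspace (top_of_set {0..1}) \<Longrightarrow> h x = k x"
    then have "restrict h {0..1} = restrict k {0..1}" by (auto simp: fun_eq_iff)
    then show "(restrict h {0..1} \<in> dpaths_between X a b) = (restrict k {0..1} \<in> dpaths_between X a b)"
      by simp
  next
    show "\<exists>h :: real \<times> real \<Rightarrow> 'p. continuous_map (prod_topology (top_of_set {0..1}) (top_of_set {0..1})) (topo X) h \<and>
         (\<forall>x\<in>topspace (top_of_set {0..1}). h (0, x) = \<omega> x) \<and>
         (\<forall>x\<in>topspace (top_of_set {0..1}). h (1, x) = \<nu> x) \<and>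
         (\<forall>t\<in>{0..1}. (\<lambda>x\<in>{0..1}. h (t, x)) \<in> dpaths_between X a b)"
    proof (rule exI[of _ h], intro conjI)
      show "\<forall>x\<in>topspace (top_of_set {0..1}). h (0, x) = \<omega> x"
        "\<forall>x\<in>topspace (top_of_set {0..1}). h (1, x) = \<nu> x" using h0 h1 by simp_all
    qed (use h d in blast)+
  qed
  have "\<omega> \<in> dpaths_between X a b" "\<nu> \<in> dpaths_between X a b"
    unfolding w using d by auto
  then show ?thesis
    unfolding dihomotopy_relation_iff[OF X] using hom by blast
qed

lemma dihomotopy_relationE:
  fixes X :: "'p dspace"
  assumes X: "is_dspace X" and "(\<omega>, \<nu>) \<in> dihomotopy_relation X"
  obtains h :: "real \<times> real \<Rightarrow> 'p" and a b where "continuous_map (prod_topology (top_of_set {0..1}) (top_of_set {0..1})) (topo X) h"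
    "\<And>t. h (0, t) = \<omega> t" "\<And>t. h (1, t) = \<nu> t"
    "\<And>s. s \<in> {0..1} \<Longrightarrow> (\<lambda>t\<in>{0..1}. h (s, t)) \<in> dpaths_between X a b"
    "\<omega> \<in> dpaths_between X a b" "\<nu> \<in> dpaths_between X a b"
  using assms(2) unfolding dihomotopy_relation_iff[OF X] homotopic_with_def by blast

lemma dihomotopy_relation_dmap:
  assumes X: "is_dspace X" and Y: "is_dspace Y" and f: "dmap X Y f"
    and r: "(\<omega>, \<nu>) \<in> dihomotopy_relation X"
  shows "(compose {0..1} f \<omega>, compose {0..1} f \<nu>) \<in> dihomotopy_relation Y"
proof -
  obtain h :: "real \<times> real \<Rightarrow> 'a" and a b where h: "continuous_map (prod_topology (top_of_set {0..1}) (top_of_set {0..1})) (topo X) h"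
    "\<And>t. h (0, t) = \<omega> t" "\<And>t. h (1, t) = \<nu> t"
    "\<And>s. s \<in> {0..1} \<Longrightarrow> (\<lambda>t\<in>{0..1}. h (s, t)) \<in> dpaths_between X a b"
    "\<omega> \<in> dpaths_between X a b" "\<nu> \<in> dpaths_between X a b"
    using dihomotopy_relationE[OF X r] by metis
  show ?thesis
  proof (rule dihomotopy_relationI[OF Y, of "f \<circ> h"])
    show "continuous_map (prod_topology (top_of_set {0..1}) (top_of_set {0..1})) (topo Y) (f \<circ> h)"
      using h(1) f continuous_map_compose unfolding dmap_def by blast
    fix s :: real assume s: "s \<in> {0..1}"
    have "compose {0..1} f (\<lambda>t\<in>{0..1}. h (s, t)) \<in> dpaths Y"
      using f h(4)[OF s] unfolding dmap_def dpaths_between_def by blast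
    moreover have "compose {0..1} f (\<lambda>t\<in>{0..1}. h (s, t)) = (\<lambda>t\<in>{0..1}. (f \<circ> h) (s, t))"
      by (auto simp: compose_def fun_eq_iff)
    ultimately show "(\<lambda>t\<in>{0..1}. (f \<circ> h) (s, t)) \<in> dpaths_between Y (f a) (f b)"
      using h(4)[OF s] by (auto simp: dpaths_between_def)
  qed (auto simp: h compose_def)
qed

lemma path_concat_ends:
  "path_concat \<omega> \<nu> 0 = \<omega> 0" "path_concat \<omega> \<nu> 1 = \<nu> 1"
  by (simp_all add: path_concat_def)

lemma path_concat_dpaths_between:
  assumes "is_dspace X" "\<omega> \<in> dpaths_between X a b" "\<nu> \<in> dpaths_between X b c"
  shows "path_concat \<omega> \<nu> \<in> dpaths_between X a c"
  using assms by (auto simp: dpaths_between_def is_dspace_def path_concat_ends)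

lemma dihomotopy_relation_concat:
  assumes X: "is_dspace X" and r: "(\<omega>, \<omega>') \<in> dihomotopy_relation X" "(\<nu>, \<nu>') \<in> dihomotopy_relation X"
    and e: "\<omega> 1 = \<nu> 0"
  shows "(path_concat \<omega> \<nu>, path_concat \<omega>' \<nu>') \<in> dihomotopy_relation X"
proof -
  let ?I = "top_of_set {0..1::real}"
  obtain h :: "real \<times> real \<Rightarrow> 'a" and a b where h: "continuous_map (prod_topology ?I ?I) (topo X) h"
    "\<And>t. h (0, t) = \<omega> t" "\<And>t. h (1, t) = \<omega>' t"
    "\<And>s. s \<in> {0..1} \<Longrightarrow> (\<lambda>t\<in>{0..1}. h (s, t)) \<in> dpaths_between X a b"
    "\<omega> \<in> dpaths_between X a b" "\<omega>' \<in> dpaths_between X a b"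
    using dihomotopy_relationE[OF X r(1)] by metis
  obtain k :: "real \<times> real \<Rightarrow> 'a" and b' c where k: "continuous_map (prod_topology ?I ?I) (topo X) k"
    "\<And>t. k (0, t) = \<nu> t" "\<And>t. k (1, t) = \<nu>' t"
    "\<And>s. s \<in> {0..1} \<Longrightarrow> (\<lambda>t\<in>{0..1}. k (s, t)) \<in> dpaths_between X b' c"
    "\<nu> \<in> dpaths_between X b' c" "\<nu>' \<in> dpaths_between X b' c"
    using dihomotopy_relationE[OF X r(2)] by metis
  have b: "b' = b" using e h(5) k(5) by (simp add: dpaths_between_def)
  let ?g = "\<lambda>p. if snd p \<le> 1/2 then h (fst p, 2 * snd p) else k (fst p, 2 * snd p - 1)"
  \<comment> \<open>Fixed endpoints are what makes the two homotopies agree along the seam t =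
    1/2.\<close>
  have ends: "h (s, 1) = b" "k (s, 0) = b" if "s \<in> {0..1}" for s
    using h(4)[OF that] k(4)[OF that] b by (auto simp: dpaths_between_def)
  show ?thesis
  proof (rule dihomotopy_relationI[OF X, of ?g])
    show "continuous_map (prod_topology ?I ?I) (topo X) ?g"
    proof (rule continuous_map_cases_le)
      let ?Z = "prod_topology ?I ?I"
      show "continuous_map ?Z euclideanreal snd" "continuous_map ?Z euclideanreal (\<lambda>x. 1/2)"
        using continuous_map_into_fulltopology[OF continuous_map_snd[of ?I ?I]] by simp_all
      have s: "continuous_map (subtopology ?Z A) ?I fst" for A
        by (rule continuous_map_from_subtopology[OF continuous_map_fst])
      have t: "continuous_map (subtopology ?Z A) euclideanreal snd" for A
        by (rule continuous_map_from_subtopology[OF continuous_map_into_fulltopology[OF continuous_map_snd]])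
      have 1: "continuous_map (subtopology ?Z {x \<in> topspace ?Z. snd x \<le> 1/2}) ?I (\<lambda>x. 2 * snd x)"
        by (rule continuous_map_into_subtopology, rule continuous_intros, rule continuous_intros, rule t) auto
      have 2: "continuous_map (subtopology ?Z {x \<in> topspace ?Z. 1/2 \<le> snd x}) ?I (\<lambda>x. 2 * snd x - 1)"
        by (rule continuous_map_into_subtopology, rule continuous_intros, rule continuous_intros,
            rule continuous_intros, rule t, rule continuous_intros) auto
      show "continuous_map (subtopology ?Z {x \<in> topspace ?Z. snd x \<le> 1/2}) (topo X) (\<lambda>x. h (fst x, 2 * snd x))"
        by (rule continuous_map_compose[OF continuous_map_pairedI[OF s 1] h(1), unfolded o_def])
      show "continuous_map (subtopology ?Z {x \<in> topspace ?Z. 1/2 \<le> snd x}) (topo X) (\<lambda>x. k (fst x, 2 * snd x - 1))"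
        by (rule continuous_map_compose[OF continuous_map_pairedI[OF s 2] k(1), unfolded o_def])
      show "h (fst x, 2 * snd x) = k (fst x, 2 * snd x - 1)" if "x \<in> topspace ?Z" "snd x = 1/2" for x
        using that(1) ends unfolding that(2) by auto
    qed
    fix s :: real assume s: "s \<in> {0..1}"
    have "path_concat (\<lambda>t\<in>{0..1}. h (s, t)) (\<lambda>t\<in>{0..1}. k (s, t)) = (\<lambda>t\<in>{0..1}. ?g (s, t))"
      by (auto simp: path_concat_def fun_eq_iff)
    then show "(\<lambda>t\<in>{0..1}. ?g (s, t)) \<in> dpaths_between X a c"
      using path_concat_dpaths_between[OF X h(4)[OF s]] k(4)[OF s] b by metis
  qed (auto simp: h k path_concat_def)
qed

section \<open>Composition and induced functors on fundamental categories\<close>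

lemma compose_path_concat:
  "compose {0..1} f (path_concat \<omega> \<nu>) = path_concat (compose {0..1} f \<omega>) (compose {0..1} f \<nu>)"
  by (auto simp: path_concat_def compose_def fun_eq_iff)

text \<open>The union in \<open>induced_arrow\<close> runs over representatives. All its members are
  the same class, and there is at least one of them, so the union is that class.\<close>

lemma induced_arrow_class:
  assumes X: "is_dspace X" and Y: "is_dspace Y" and f: "dmap X Y f" and w: "\<omega> \<in> dpaths X"
  shows "induced_arrow Y f (dihomotopy_relation X `` {\<omega>}) = dihomotopy_relation Y `` {compose {0..1} f \<omega>}"
proof -
  have "dihomotopy_relation Y `` {compose {0..1} f \<nu>} = dihomotopy_relation Y `` {compose {0..1} f \<omega>}"
    if "(\<omega>, \<nu>) \<in> dihomotopy_relation X" for \<nu>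
    using dihomotopy_class_eqI[OF Y dihomotopy_relation_dmap[OF X Y f that]] by simp
  then have "induced_arrow Y f (dihomotopy_relation X `` {\<omega>}) =
      (\<Union>\<nu>\<in>dihomotopy_relation X `` {\<omega>}. dihomotopy_relation Y `` {compose {0..1} f \<omega>})"
    unfolding induced_arrow_def by simp
  also have "\<dots> = dihomotopy_relation Y `` {compose {0..1} f \<omega>}"
    using dihomotopy_relation_refl[OF X w] by (intro SUP_eq_const) auto
  finally show ?thesis .
qed

text \<open>As for \<open>induced_arrow\<close>: the double union ranges over equal classes, by
  \<open>dihomotopy_relation_concat\<close>, and over nonempty index sets.\<close>

lemma Comp_class:
  assumes X: "is_dspace X" and w: "\<omega> \<in> dpaths X" and v: "\<nu> \<in> dpaths X" and e: "\<omega> 1 = \<nu> 0"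
  shows "Comp (fundamental_category X) (dihomotopy_relation X `` {\<omega>}) (dihomotopy_relation X `` {\<nu>}) =
    dihomotopy_relation X `` {path_concat \<omega> \<nu>}"
proof -
  have "dihomotopy_relation X `` {path_concat \<omega>' \<nu>'} = dihomotopy_relation X `` {path_concat \<omega> \<nu>}"
    if "(\<omega>, \<omega>') \<in> dihomotopy_relation X" "(\<nu>, \<nu>') \<in> dihomotopy_relation X" for \<omega>' \<nu>'
    using dihomotopy_class_eqI[OF X dihomotopy_relation_concat[OF X that e]] by simp
  then have "Comp (fundamental_category X) (dihomotopy_relation X `` {\<omega>}) (dihomotopy_relation X `` {\<nu>}) =
      (\<Union>\<omega>'\<in>dihomotopy_relation X `` {\<omega>}. \<Union>\<nu>'\<in>dihomotopy_relation X `` {\<nu>}. dihomotopy_relation X `` {path_concat \<omega> \<nu>})"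
    unfolding fundamental_category_def by simp
  also have "\<dots> = (\<Union>\<omega>'\<in>dihomotopy_relation X `` {\<omega>}. dihomotopy_relation X `` {path_concat \<omega> \<nu>})"
    using dihomotopy_relation_refl[OF X v] by (intro arg_cong[of _ _ Union] image_cong refl SUP_eq_const) auto
  also have "\<dots> = dihomotopy_relation X `` {path_concat \<omega> \<nu>}"
    using dihomotopy_relation_refl[OF X w] by (intro SUP_eq_const) auto
  finally show ?thesis .
qed

lemma Hom_fundamental_categoryE:
  assumes "c \<in> Hom (fundamental_category X) a b"
  obtains \<omega> where "\<omega> \<in> dpaths_between X a b" "c = dihomotopy_relation X `` {\<omega>}"
  using assms by (auto simp: fundamental_category_def elim: quotientE)

lemma Hom_fundamental_categoryI:
  "\<omega> \<in> dpaths_between X a b \<Longrightarrow> dihomotopy_relation X `` {\<omega>} \<in> Hom (fundamental_category X) a b"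
  by (auto simp: fundamental_category_def intro: quotientI)

lemma dmap_dpaths_between:
  assumes "dmap X Y f" "\<omega> \<in> dpaths_between X a b"
  shows "compose {0..1} f \<omega> \<in> dpaths_between Y (f a) (f b)"
  using assms by (auto simp: dmap_def dpaths_between_def compose_def)

lemma full_subcategory_simps:
  "Obj (full_subcategory C S) = Obj C \<inter> S" "Hom (full_subcategory C S) = Hom C"
  "Id (full_subcategory C S) = Id C" "Comp (full_subcategory C S) = Comp C"
  by (simp_all add: full_subcategory_def)

lemma Obj_fundamental_category: "Obj (fundamental_category X) = points X"
  by (simp add: fundamental_category_def)

lemma is_functor_induced_arrow:
  assumes X: "is_dspace X" and Y: "is_dspace Y" and f: "dmap X Y f" and ST: "f \<in> points X \<inter> S \<rightarrow> T"
  shows "is_functor (full_subcategory (fundamental_category X) S) (full_subcategory (fundamental_category Y) T)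
           f (induced_arrow Y f)"
  unfolding is_functor_def full_subcategory_simps Obj_fundamental_category
proof (intro conjI ballI funcsetI)
  fix a assume a: "a \<in> points X \<inter> S"
  then show "f a \<in> points Y \<inter> T"
    using f ST by (auto simp: dmap_def continuous_map_def Pi_iff)
  have c: "(\<lambda>t\<in>{0..1}. a) \<in> dpaths X" using X a by (auto simp: is_dspace_def)
  have "compose {0..1} f (\<lambda>t\<in>{0..1::real}. a) = (\<lambda>t\<in>{0..1}. f a)"
    by (auto simp: compose_def fun_eq_iff)
  then show "induced_arrow Y f (Id (fundamental_category X) a) = Id (fundamental_category Y) (f a)"
    using induced_arrow_class[OF X Y f c] by (simp only: fundamental_category_def category.select_convs)
next
  fix a b c assume "c \<in> Hom (fundamental_category X) a b"
  then obtain \<omega> where w: "\<omega> \<in> dpaths_between X a b" "c = dihomotopy_relation X `` {\<omega>}"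
    by (elim Hom_fundamental_categoryE)
  show "induced_arrow Y f c \<in> Hom (fundamental_category Y) (f a) (f b)"
    unfolding w(2) induced_arrow_class[OF X Y f dpaths_betweenD(1)[OF w(1)]]
    by (intro Hom_fundamental_categoryI dmap_dpaths_between[OF f w(1)])
next
  fix a b c k l
  assume k: "k \<in> Hom (fundamental_category X) a b" and l: "l \<in> Hom (fundamental_category X) b c"
  obtain \<omega> where w: "\<omega> \<in> dpaths_between X a b" "k = dihomotopy_relation X `` {\<omega>}"
    using k by (elim Hom_fundamental_categoryE)
  obtain \<nu> where v: "\<nu> \<in> dpaths_between X b c" "l = dihomotopy_relation X `` {\<nu>}"
    using l by (elim Hom_fundamental_categoryE)
  note w' = dpaths_betweenD[OF w(1)] and v' = dpaths_betweenD[OF v(1)]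
  note fw = dpaths_betweenD[OF dmap_dpaths_between[OF f w(1)]]
    and fv = dpaths_betweenD[OF dmap_dpaths_between[OF f v(1)]]
  have wv: "path_concat \<omega> \<nu> \<in> dpaths X"
    using path_concat_dpaths_between[OF X w(1) v(1)] by (rule dpaths_betweenD)
  have e: "\<omega> 1 = \<nu> 0" "compose {0..1} f \<omega> 1 = compose {0..1} f \<nu> 0"
    using w' v' by (auto simp: compose_def)
  show "induced_arrow Y f (Comp (fundamental_category X) k l) =
      Comp (fundamental_category Y) (induced_arrow Y f k) (induced_arrow Y f l)"
    unfolding w(2) v(2) Comp_class[OF X w'(1) v'(1) e(1)] induced_arrow_class[OF X Y f w'(1)]
      induced_arrow_class[OF X Y f v'(1)] induced_arrow_class[OF X Y f wv]
      Comp_class[OF Y fw(1) fv(1) e(2)] compose_path_concat ..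
qed

text \<open>A quotient set is empty only if the set itself is, so the existence of a morphism is the
  existence of a d-path.\<close>

lemma minimal_point_iff:
  "minimal_point X a \<longleftrightarrow> a \<in> points X \<and> (\<forall>y \<in> points X. dpaths_between X y a \<noteq> {} \<longrightarrow> y = a)"
  unfolding minimal_point_def
  by (auto simp: fundamental_category_def quotient_def)

lemma maximal_point_iff:
  "maximal_point X a \<longleftrightarrow> a \<in> points X \<and> (\<forall>y \<in> points X. dpaths_between X a y \<noteq> {} \<longrightarrow> y = a)"
  unfolding maximal_point_def
  by (auto simp: fundamental_category_def quotient_def)

section \<open>Path spaces\<close>

text \<open>Tube lemma: if the path at time \<open>s\<close> maps \<open>K\<close> into
  \<open>U\<close>, then the compact set consisting of \<open>s\<close> times the image of
  \<open>K\<close> lies in the open preimage of \<open>U\<close> under \<open>H\<close>. A box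
  around it gives a neighbourhood of times and a subbasic neighbourhood of paths.\<close>

lemma continuous_map_compact_open_homotopy:
  fixes H :: "real \<times> 'p \<Rightarrow> 'q"
  assumes H: "continuous_map (prod_topology (top_of_set {0..1}) X) Y H"
  shows "continuous_map
    (prod_topology (top_of_set {0..1}) (compact_open_topology (top_of_set {0..1}) X))
    (compact_open_topology (top_of_set {0..1}) Y)
    (\<lambda>(s, \<omega>). compose {0..1::real} (\<lambda>a. H (s, a)) \<omega>)"
    (is "continuous_map ?Z _ ?F")
proof -
  let ?I = "top_of_set {0..1::real}"
  have F: "continuous_map ?I Y (?F (s, \<omega>))" if "s \<in> {0..1}" "continuous_map ?I X \<omega>" for s \<omega>
  proof -
    have "continuous_map ?I (prod_topology ?I X) (\<lambda>t. (s, \<omega> t))"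
      using that by (auto intro: continuous_map_pairedI)
    from continuous_map_compose[OF this H] show ?thesis
      by (rule continuous_map_eq) (auto simp: compose_def)
  qed
  have top: "(s, \<omega>) \<in> topspace ?Z \<longleftrightarrow> s \<in> {0..1} \<and> \<omega> \<in> extensional {0..1} \<and> continuous_map ?I X \<omega>" for s \<omega>
    by (simp add: topspace_compact_open_topology)
  show ?thesis
    unfolding compact_open_topology_def[of ?I Y]
  proof (rule continuous_on_generated_topo)
    fix W assume "W \<in> {{f \<in> extensional (topspace ?I). continuous_map ?I Y f \<and> f \<in> K \<rightarrow> U} | K U.
          compactin ?I K \<and> openin Y U}"
    then obtain K U where K: "compactin ?I K" and U: "openin Y U"
      and W: "W = {f \<in> extensional (topspace ?I). continuous_map ?I Y f \<and> f \<in> K \<rightarrow> U}" by blast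
    let ?O = "{p \<in> topspace (prod_topology ?I X). H p \<in> U}"
    have opn: "openin (prod_topology ?I X) ?O"
      using H U by (simp add: continuous_map_def)
    have KI: "K \<subseteq> {0..1}" using K by (auto simp: compactin_def)
    show "openin ?Z (?F -` W \<inter> topspace ?Z)"
    proof (subst openin_subopen, intro ballI)
      fix p assume p: "p \<in> ?F -` W \<inter> topspace ?Z"
      obtain s \<omega> where so: "p = (s, \<omega>)" by (cases p)
      have s: "s \<in> {0..1}" and w: "\<omega> \<in> extensional {0..1}" "continuous_map ?I X \<omega>"
        using p so top by auto
      have sub: "{s} \<times> \<omega> ` K \<subseteq> ?O"
      proof -
        have "H (s, \<omega> t) \<in> U" if "t \<in> K" for t
          using p so W that KI by (auto simp: compose_def Pi_iff subset_eq)
        moreover have "\<omega> t \<in> topspace X" if "t \<in> K" for t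
          using w(2) that KI by (auto simp: continuous_map_def Pi_iff subset_eq)
        ultimately show ?thesis using s by auto
      qed
      have "compactin X (\<omega> ` K)" using image_compactin[OF K w(2)] .
      then obtain J V where J: "openin ?I J" "s \<in> J" and V: "openin X V" "\<omega> ` K \<subseteq> V" and JV: "J \<times> V \<subseteq> ?O"
        using tube_lemma_right[OF opn _ _ sub] s by auto
      let ?WV = "{f \<in> extensional (topspace ?I). continuous_map ?I X f \<and> f \<in> K \<rightarrow> V}"
      have "openin (compact_open_topology ?I X) ?WV"
        unfolding compact_open_topology_def using K V by (intro topology_generated_by_Basis) blast
      then have o: "openin ?Z (J \<times> ?WV)" using J by (simp add: openin_prod_Times_iff)
      have "?F (r, \<nu>) \<in> W" if r: "r \<in> J" and v: "\<nu> \<in> ?WV" for r \<nu>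
      proof -
        have "r \<in> {0..1}" using r J(1) openin_subset by force
        then have "continuous_map ?I Y (?F (r, \<nu>))" using F v by blast
        moreover have "?F (r, \<nu>) \<in> K \<rightarrow> U"
        proof
          fix t assume t: "t \<in> K"
          then have "(r, \<nu> t) \<in> ?O" using JV r v by (auto simp: Pi_iff subset_eq)
          then show "?F (r, \<nu>) t \<in> U" using t KI by (auto simp: compose_def subset_eq)
        qed
        ultimately show ?thesis unfolding W by simp
      qed
      moreover have "p \<in> J \<times> ?WV" using so J V w by auto
      ultimately show "\<exists>T. openin ?Z T \<and> p \<in> T \<and> T \<subseteq> ?F -` W \<inter> topspace ?Z"
        using o openin_subset[OF o] by (intro exI[of _ "J \<times> ?WV"]) auto
    qed
  next
    \<comment> \<open>The subbasic set for empty \<open>K\<close> and \<open>U\<close> contains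
      every path, so the subbasis covers the image.\<close>
    have "{f \<in> extensional (topspace ?I). continuous_map ?I Y f \<and> f \<in> {} \<rightarrow> {}} \<in>
        {{f \<in> extensional (topspace ?I). continuous_map ?I Y f \<and> f \<in> K \<rightarrow> U} | K U.
          compactin ?I K \<and> openin Y U}"
      by (rule CollectI, rule exI[of _ "{}"], rule exI[of _ "{}"]) auto
    moreover have "?F ` topspace ?Z \<subseteq>
        {f \<in> extensional (topspace ?I). continuous_map ?I Y f \<and> f \<in> {} \<rightarrow> {}}"
      using F by (auto simp: topspace_compact_open_topology)
    ultimately show "?F ` topspace ?Z \<subseteq>
        \<Union>{{f \<in> extensional (topspace ?I). continuous_map ?I Y f \<and> f \<in> K \<rightarrow> U} | K U.
          compactin ?I K \<and> openin Y U}" by blast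
  qed
qed

text \<open>A map is a homotopy that does not depend on time, read at time 0.\<close>

lemma continuous_map_compact_open_compose:
  assumes f: "continuous_map X Y f"
  shows "continuous_map (compact_open_topology (top_of_set {0..1::real}) X)
    (compact_open_topology (top_of_set {0..1}) Y) (compose {0..1} f)"
proof -
  let ?C = "compact_open_topology (top_of_set {0..1::real}) X"
  have "continuous_map (prod_topology (top_of_set {0..1::real}) X) Y (f \<circ> snd)"
    by (rule continuous_map_compose[OF continuous_map_snd f])
  from continuous_map_compact_open_homotopy[OF this]
  have 1: "continuous_map (prod_topology (top_of_set {0..1::real}) ?C)
    (compact_open_topology (top_of_set {0..1}) Y) (\<lambda>(s, \<omega>). compose {0..1} f \<omega>)"
    by (simp add: o_def)
  have "continuous_map ?C (prod_topology (top_of_set {0..1::real}) ?C) (\<lambda>\<omega>. (0, \<omega>))"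
    by (intro continuous_map_pairedI) auto
  from continuous_map_compose[OF this 1] show ?thesis by (simp add: o_def)
qed

lemma topspace_dpath_space:
  assumes "is_dspace X"
  shows "topspace (dpath_space X a b) = dpaths_between X a b"
  using dpath_extensional[OF assms] continuous_map_dpath[OF assms]
  by (auto simp: dpath_space_def topspace_compact_open_topology dpaths_between_def)

lemma continuous_map_dpath_space:
  assumes X: "is_dspace X" and Y: "is_dspace Y" and f: "dmap X Y f"
  shows "continuous_map (dpath_space X a b) (dpath_space Y (f a) (f b)) (compose {0..1} f)"
proof -
  have "continuous_map (topo X) (topo Y) f" using f by (simp add: dmap_def)
  from continuous_map_compact_open_compose[OF this]
  have "continuous_map (dpath_space X a b) (compact_open_topology (top_of_set {0..1}) (topo Y)) (compose {0..1} f)"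
    unfolding dpath_space_def by (rule continuous_map_from_subtopology)
  moreover have "compose {0..1} f \<in> topspace (dpath_space X a b) \<rightarrow> dpaths_between Y (f a) (f b)"
    unfolding topspace_dpath_space[OF X] using dmap_dpaths_between[OF f] by blast
  ultimately show ?thesis
    unfolding dpath_space_def[of Y] by (rule continuous_map_into_subtopology)
qed

section \<open>Directed deformation retracts\<close>

text \<open>A strong deformation retraction through d-maps. Because \<open>S\<close> stays fixed at
  all times, composing a d-path between points of \<open>S\<close> with \<open>H\<close> never moves
  its ends; the three comparisons of the d-subspace with \<open>X\<close> rest on this.\<close>

locale dideformation_retract =
  fixes X :: "'p dspace" and S :: "'p set" and H :: "real \<times> 'p \<Rightarrow> 'p"
  assumes dspace: "is_dspace X"
    and subset: "S \<subseteq> points X"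
    and continuous: "continuous_map (prod_topology (top_of_set {0..1}) (topo X)) (topo X) H"
    and start: "\<And>a. a \<in> points X \<Longrightarrow> H (0, a) = a"
    and finish: "\<And>a. a \<in> points X \<Longrightarrow> H (1, a) \<in> S"
    and fixed: "\<And>s a. s \<in> {0..1} \<Longrightarrow> a \<in> S \<Longrightarrow> H (s, a) = a"
    and dmap_at: "\<And>s. s \<in> {0..1} \<Longrightarrow> dmap X X (\<lambda>a. H (s, a))"
begin

abbreviation "A \<equiv> dsubspace X S"
abbreviation "g \<equiv> \<lambda>a. H (1, a)"

lemma dspace_A: "is_dspace A"
  using is_dspace_dsubspace[OF dspace] .

lemma points_A: "points A = S"
  using subset by (auto simp: dsubspace_def)

lemma dpaths_A: "\<omega> \<in> dpaths A \<longleftrightarrow> \<omega> \<in> dpaths X \<and> (\<forall>t \<in> {0..1}. \<omega> t \<in> S)"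
  by (auto simp: dsubspace_def)

lemma dmap_inclusion: "dmap A X id"
  using dpath_extensional[OF dspace]
  by (auto simp: dmap_def dpaths_A compose_def extensional_restrict dsubspace_def
      intro: continuous_map_from_subtopology)

lemma dmap_g: "dmap X A g"
  using dmap_at[of 1] finish dpath_in_points[OF dspace]
  by (auto simp: dmap_def dpaths_A compose_def dsubspace_def intro!: continuous_map_into_subtopology)

lemma dmap_id: "dmap X X id"
  using dmap_at[of 0] dmap_cong[OF dspace, of "\<lambda>a. H (0, a)" id] start by auto

lemma dmap_id_A: "dmap A A id"
  using dpath_extensional[OF dspace_A]
  by (auto simp: dmap_def compose_def extensional_restrict)

lemma homotopic_id_g:
  "homotopic_with (\<lambda>h. dmap X X h \<and> (\<forall>a\<in>S. h a = a)) (topo X) (topo X) id g"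
proof (subst homotopic_with)
  fix h k :: "'p \<Rightarrow> 'p" assume "\<And>x. x \<in> points X \<Longrightarrow> h x = k x"
  then show "(dmap X X h \<and> (\<forall>a\<in>S. h a = a)) = (dmap X X k \<and> (\<forall>a\<in>S. k a = a))"
    using dmap_cong[OF dspace, of h k] subset by (metis subsetD)
next
  show "\<exists>h :: real \<times> 'p \<Rightarrow> 'p. continuous_map (prod_topology (top_of_set {0..1}) (topo X)) (topo X) h \<and>
      (\<forall>x\<in>points X. h (0, x) = id x) \<and> (\<forall>x\<in>points X. h (1, x) = H (1, x)) \<and>
      (\<forall>t\<in>{0..1}. dmap X X (\<lambda>x. h (t, x)) \<and> (\<forall>a\<in>S. h (t, a) = a))"
    using continuous start dmap_at fixed by (intro exI[of _ H]) simp
qed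

text \<open>On \<open>A\<close> the retraction already is the identity, so one homotopy is constant.
  The other one is \<open>H\<close> run backwards, since \<open>H\<close> starts at the
  identity.\<close>

lemma dihomotopy_equivalence: "dihomotopy_equivalence_rel A A X id"
proof -
  have "subtopology (subtopology (topo X) S) S = subtopology (topo X) S"
    by (simp add: subtopology_subtopology)
  then have "A = dsubspace A S"
    by (auto simp: dsubspace_def)
  then have AA: "is_dsubspace A A" "is_dsubspace A X"
    unfolding is_dsubspace_def points_A using subset by simp_all
  have g1: "g a = a" if "a \<in> S" for a
    using fixed[of 1 a] that by simp
  have gA: "dmap A A (g \<circ> id)"
    using dmap_cong[OF dspace_A, of "g \<circ> id" id A] dmap_id_A g1 points_A by simp
  have 1: "dihomotopic_rel A A (points A) (g \<circ> id) id"
    unfolding dihomotopic_rel_def points_A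
  proof (intro conjI ballI)
    have "continuous_map (topo A) (topo A) (g \<circ> id)" using gA unfolding dmap_def by blast
    then show "homotopic_with (\<lambda>h. dmap A A h \<and> (\<forall>a\<in>S. h a = (g \<circ> id) a \<and> h a = id a)) (topo A) (topo A) (g \<circ> id) id"
      by (rule homotopic_with_equal[rotated 2]) (use gA dmap_id_A g1 points_A in simp_all)
  qed (use gA dmap_id_A g1 in simp_all)
  have 2: "dihomotopic_rel X X (points A) (id \<circ> g) id"
    unfolding dihomotopic_rel_def points_A
  proof (intro conjI ballI)
    show "homotopic_with (\<lambda>h. dmap X X h \<and> (\<forall>a\<in>S. h a = (id \<circ> g) a \<and> h a = id a)) (topo X) (topo X) (id \<circ> g) id"
      unfolding id_o by (rule homotopic_with_mono[OF homotopic_with_symD[OF homotopic_id_g]]) (use g1 in simp)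
  qed (use dmap_at[of 1] dmap_id g1 subset in simp_all)
  show ?thesis
    unfolding dihomotopy_equivalence_rel_def
  proof (intro conjI exI[of _ g])
    show "\<forall>a\<in>points A. id a = a" "\<forall>a\<in>points A. g a = a" unfolding points_A using g1 by simp_all
  qed (rule dspace_A dspace AA dmap_inclusion dmap_g 1 2)+
qed

text \<open>The homotopy applies \<open>H\<close> to every point of the path; the ends lie in
  \<open>S\<close> and therefore stay put.\<close>

lemma homotopic_path:
  assumes w: "\<omega> \<in> dpaths_between X a b" and ab: "a \<in> S" "b \<in> S"
  shows "(\<omega>, compose {0..1} g \<omega>) \<in> dihomotopy_relation X"
proof (rule dihomotopy_relationI[OF dspace, of "\<lambda>(s, t). H (s, \<omega> t)" _ _ a b])
  note w' = dpaths_betweenD[OF w]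
  have 1: "continuous_map (prod_topology (top_of_set {0..1::real}) (top_of_set {0..1::real})) (topo X) (\<omega> \<circ> snd)"
    by (rule continuous_map_compose[OF continuous_map_snd continuous_map_dpath[OF dspace w'(1)]])
  have "continuous_map (prod_topology (top_of_set {0..1::real}) (top_of_set {0..1::real}))
      (prod_topology (top_of_set {0..1}) (topo X)) (\<lambda>p. (fst p, (\<omega> \<circ> snd) p))"
    by (rule continuous_map_pairedI[OF continuous_map_fst 1])
  from continuous_map_compose[OF this continuous]
  show "continuous_map (prod_topology (top_of_set {0..1}) (top_of_set {0..1})) (topo X) (\<lambda>(s, t). H (s, \<omega> t))"
    by (simp add: o_def case_prod_unfold)
  show "(case (0, t) of (s, t) \<Rightarrow> H (s, \<omega> t)) = \<omega> t" if "t \<in> {0..1}" for t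
    using start dpath_in_points[OF dspace w'(1) that] by simp
  show "(case (1, t) of (s, t) \<Rightarrow> H (s, \<omega> t)) = compose {0..1} g \<omega> t" if "t \<in> {0..1}" for t
    using that by (simp add: compose_def)
  fix s :: real assume s: "s \<in> {0..1}"
  have "compose {0..1} (\<lambda>a. H (s, a)) \<omega> = (\<lambda>t\<in>{0..1}. case (s, t) of (s, t) \<Rightarrow> H (s, \<omega> t))"
    by (auto simp: compose_def)
  then show "(\<lambda>t\<in>{0..1}. case (s, t) of (s, t) \<Rightarrow> H (s, \<omega> t)) \<in> dpaths_between X a b"
    using dmap_dpaths_between[OF dmap_at[OF s] w] fixed[OF s] ab by simp
qed (use dpath_extensional[OF dspace dpaths_betweenD(1)[OF w]] in auto)

lemma compose_g_A:
  assumes "\<omega> \<in> dpaths A" shows "compose {0..1} g \<omega> = \<omega>"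
  using assms fixed[of 1] dpath_extensional[OF dspace_A assms]
  by (auto simp: dpaths_A compose_def fun_eq_iff extensional_def)

lemma compose_id_ext: "\<omega> \<in> extensional {0..1} \<Longrightarrow> compose {0..1} id \<omega> = \<omega>"
  by (auto simp: compose_def fun_eq_iff extensional_def)

text \<open>Composition with \<open>g\<close> is the homotopy inverse. Applying \<open>H\<close>
  pointwise to paths is continuous for the compact-open topology and preserves the ends, so it
  deforms the larger path space into the smaller one.\<close>

lemma dpath_space_equivalence:
  assumes ab: "a \<in> S" "b \<in> S"
  shows "homotopy_equivalence_map (dpath_space A a b) (dpath_space X a b) (\<lambda>\<omega>. compose {0..1} id \<omega>)"
  unfolding homotopy_equivalence_map_def
proof (intro conjI exI)
  show i: "continuous_map (dpath_space A a b) (dpath_space X a b) (compose {0..1} id)"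
    using continuous_map_dpath_space[OF dspace_A dspace dmap_inclusion] by simp
  show r: "continuous_map (dpath_space X a b) (dpath_space A a b) (compose {0..1} g)"
    using continuous_map_dpath_space[OF dspace dspace_A dmap_g, of a b] ab fixed by simp
  show "homotopic_with (\<lambda>_. True) (dpath_space A a b) (dpath_space A a b)
     (compose {0..1} g \<circ> compose {0..1} id) id"
    by (rule homotopic_with_equal[OF _ _ continuous_map_compose[OF i r]])
      (auto simp: topspace_dpath_space[OF dspace_A] dpaths_between_def compose_g_A
         compose_id_ext[OF dpath_extensional[OF dspace_A]])
  have "homotopic_with (\<lambda>_. True) (dpath_space X a b) (dpath_space X a b) id (compose {0..1} id \<circ> compose {0..1} g)"
  proof (subst homotopic_with)
    let ?Z = "prod_topology (top_of_set {0..1::real}) (dpath_space X a b)"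
    let ?F = "\<lambda>(s, \<omega>). compose {0..1} (\<lambda>a. H (s, a)) \<omega>"
    have "continuous_map ?Z (prod_topology (top_of_set {0..1}) (compact_open_topology (top_of_set {0..1}) (topo X))) (\<lambda>p. (fst p, snd p))"
      unfolding dpath_space_def
      by (rule continuous_map_pairedI[OF continuous_map_fst continuous_map_into_fulltopology[OF continuous_map_snd]])
    from continuous_map_compose[OF this continuous_map_compact_open_homotopy[OF continuous]]
    have F1: "continuous_map ?Z (compact_open_topology (top_of_set {0..1}) (topo X)) ?F"
      by (simp add: o_def case_prod_unfold)
    have F2: "?F \<in> topspace ?Z \<rightarrow> dpaths_between X a b"
    proof
      fix p assume "p \<in> topspace ?Z"
      then obtain s \<omega> where p: "p = (s, \<omega>)" "s \<in> {0..1}" "\<omega> \<in> dpaths_between X a b"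
        using topspace_dpath_space[OF dspace] by auto
      show "?F p \<in> dpaths_between X a b"
        using dmap_dpaths_between[OF dmap_at[OF p(2)] p(3)] fixed[OF p(2)] ab p(1) by simp
    qed
    have F: "continuous_map ?Z (dpath_space X a b) ?F"
      using continuous_map_into_subtopology[OF F1 F2] by (simp add: dpath_space_def)
    have F0: "?F (0, \<omega>) = \<omega>" if "\<omega> \<in> topspace (dpath_space X a b)" for \<omega>
    proof -
      from that have w: "\<omega> \<in> dpaths X" by (simp add: topspace_dpath_space[OF dspace] dpaths_between_def)
      have "compose {0..1} (\<lambda>a. H (0, a)) \<omega> t = \<omega> t" for t
      using dpath_extensional[OF dspace w] start dpath_in_points[OF dspace w]
      by (auto simp: compose_def extensional_def)
      then show ?thesis by auto
    qed
    have F1: "?F (1, \<omega>) = (compose {0..1} id \<circ> compose {0..1} g) \<omega>" for \<omega>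
      by (auto simp: compose_def)
    show "\<exists>h :: real \<times> (real \<Rightarrow> 'p) \<Rightarrow> (real \<Rightarrow> 'p). continuous_map ?Z (dpath_space X a b) h \<and>
        (\<forall>\<omega>\<in>topspace (dpath_space X a b). h (0, \<omega>) = id \<omega>) \<and>
        (\<forall>\<omega>\<in>topspace (dpath_space X a b). h (1, \<omega>) = (compose {0..1} id \<circ> compose {0..1} g) \<omega>) \<and>
        (\<forall>t\<in>{0..1}. True)"
    proof (intro exI[of _ ?F] conjI ballI)
      show "?F (0, \<omega>) = id \<omega>" if "\<omega> \<in> topspace (dpath_space X a b)" for \<omega>
        using F0[OF that] by simp
    qed (use F F1 in blast)+
  qed simp
  then show "homotopic_with (\<lambda>_. True) (dpath_space X a b) (dpath_space X a b) (compose {0..1} id \<circ> compose {0..1} g) id"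
    by (rule homotopic_with_symD)
qed

text \<open>The inverse functor is induced by \<open>g\<close>. Both assumptions together force the
  extremal points of \<open>X\<close> into \<open>S\<close>, and then \<open>homotopic_path\<close>
  says that retracting a d-path between extremal points does not change its class.\<close>

lemma fundamental_bipartite_graph_iso:
  assumes min: "\<And>a. minimal_point A a \<longleftrightarrow> minimal_point X a"
    and max: "\<And>a. maximal_point A a \<longleftrightarrow> maximal_point X a"
  shows "is_category_iso (fundamental_bipartite_graph A) (fundamental_bipartite_graph X) id (induced_arrow X id)"
proof -
  let ?E = "{a. minimal_point X a \<or> maximal_point X a}"
  have "minimal_point A a \<Longrightarrow> a \<in> S" "maximal_point A a \<Longrightarrow> a \<in> S" for a
    by (simp_all add: minimal_point_def maximal_point_def points_A)
  then have ES: "?E \<subseteq> S" using min max by blast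
  have E: "points (extremal_subspace A) = ?E" "points (extremal_subspace X) = ?E"
    unfolding extremal_subspace_def min max using ES subset points_A
    by (auto simp: dsubspace_def)
  let ?C = "full_subcategory (fundamental_category A) ?E"
  let ?D = "full_subcategory (fundamental_category X) ?E"
  have O: "Obj ?C = ?E" "Obj ?D = ?E"
    using ES subset points_A by (auto simp: full_subcategory_simps Obj_fundamental_category)
  have gS: "g a = a" if "a \<in> ?E" for a using fixed[of 1 a] ES that by auto
  have F: "is_functor ?C ?D id (induced_arrow X id)"
    by (rule is_functor_induced_arrow[OF dspace_A dspace dmap_inclusion]) auto
  have G: "is_functor ?D ?C g (induced_arrow A g)"
    by (rule is_functor_induced_arrow[OF dspace dspace_A dmap_g]) (use gS in auto)
  have 1: "induced_arrow A g (induced_arrow X id c) = c" if c: "c \<in> Hom ?C a b" for a b c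
  proof -
    obtain \<omega> where w: "\<omega> \<in> dpaths_between A a b" "c = dihomotopy_relation A `` {\<omega>}"
      using c unfolding full_subcategory_simps by (elim Hom_fundamental_categoryE)
    note w' = dpaths_betweenD(1)[OF w(1)]
    have wX: "\<omega> \<in> dpaths X" using w' by (simp add: dpaths_A)
    show ?thesis
      unfolding w(2) induced_arrow_class[OF dspace_A dspace dmap_inclusion w']
        compose_id_ext[OF dpath_extensional[OF dspace_A w']]
        induced_arrow_class[OF dspace dspace_A dmap_g wX] compose_g_A[OF w'] ..
  qed
  have 2: "induced_arrow X id (induced_arrow A g c) = c"
    if c: "c \<in> Hom ?D a b" and ab: "a \<in> ?E" "b \<in> ?E" for a b c
  proof -
    obtain \<omega> where w: "\<omega> \<in> dpaths_between X a b" "c = dihomotopy_relation X `` {\<omega>}"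
      using c unfolding full_subcategory_simps by (elim Hom_fundamental_categoryE)
    note w' = dpaths_betweenD(1)[OF w(1)]
    have gw: "compose {0..1} g \<omega> \<in> dpaths A" using dmap_g w' by (simp add: dmap_def)
    show ?thesis
      unfolding w(2) induced_arrow_class[OF dspace dspace_A dmap_g w']
        induced_arrow_class[OF dspace_A dspace dmap_inclusion gw]
        compose_id_ext[OF dpath_extensional[OF dspace_A gw]]
      by (rule dihomotopy_class_eqI[OF dspace homotopic_path[OF w(1)], symmetric]) (use ab ES in blast)+
  qed
  show ?thesis
    unfolding fundamental_bipartite_graph_def E is_category_iso_def
  proof (intro conjI exI)
    show "is_functor ?C ?D id (induced_arrow X id)" by (rule F)
    show "is_functor ?D ?C g (induced_arrow A g)" by (rule G)
    show "\<forall>a\<in>Obj ?C. g (id a) = a" "\<forall>a\<in>Obj ?D. id (g a) = a"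
      unfolding O using gS by simp_all
    show "\<forall>a\<in>Obj ?C. \<forall>b\<in>Obj ?C. \<forall>c\<in>Hom ?C a b. induced_arrow A g (induced_arrow X id c) = c"
      using 1 by blast
    show "\<forall>a\<in>Obj ?D. \<forall>b\<in>Obj ?D. \<forall>c\<in>Hom ?D a b. induced_arrow X id (induced_arrow A g c) = c"
      unfolding O using 2 by blast
  qed
qed

end

section \<open>Faces of a regular square\<close>

text \<open>Edges live in degree \<open>1\<close>; the default orientation would rewrite this to
  \<open>Suc 0\<close>, a form in which rules about \<open>cells P 1\<close> no longer
  match.\<close>

declare One_nat_def [simp del] One_nat_def [symmetric, simp]

section \<open>Box maps and morphisms out of a standard cube\<close>

lemma coface_in_cube:
  assumes "u \<in> cube n" "i \<in> {1..Suc n}" "k \<in> {0,1}"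
  shows "coface n i k u \<in> cube (Suc n)"
proof -
  have u: "u j \<in> {0..1}" if "j \<in> {1..n}" for j
    using assms(1) that by (auto simp: cube_def)
  have "coface n i k u j \<in> {0..1}" if "j \<in> {1..Suc n}" for j
  proof -
    consider "j < i" | "j = i" | "i < j" by linarith
    then show ?thesis
    proof cases
      case 3
      then have "j - 1 \<in> {1..n}" using assms(2) that by auto
      then have "u (j - 1) \<in> {0..1}" using u by blast
      then show ?thesis using 3 that by (simp add: coface_def)
    qed (use u assms(2,3) that in \<open>auto simp: coface_def\<close>)
  qed
  then show ?thesis by (auto simp: cube_def coface_def)
qed

lemma box_map_le: "is_box_map m n f \<Longrightarrow> m \<le> n"
  by (induction rule: is_box_map.induct) auto

lemma box_map_self: "is_box_map n n f \<longleftrightarrow> f = restrict id (cube n)"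
proof
  assume "is_box_map n n f"
  then show "f = restrict id (cube n)"
    by cases (auto dest: box_map_le)
qed (auto intro: is_box_map.ident)

text \<open>Cubes are built up by cofaces on the left, but the boundary operators of the standard cube
  act by cofaces on the right.\<close>

lemma box_map_coface_right:
  assumes "is_box_map m n f" "m < n"
  shows "\<exists>f' i k. is_box_map (Suc m) n f' \<and> i \<in> {1..Suc m} \<and> k \<in> {0,1} \<and>
           f = compose (cube m) f' (coface m i k)"
  using assms
proof induction
  case (coface n f i k)
  show ?case
  proof (cases "m = n")
    case True
    then have f: "f = restrict id (cube m)" using coface.hyps(1) by (simp add: box_map_self)
    show ?thesis
    proof (intro exI conjI)
      show "is_box_map (Suc m) (Suc n) (restrict id (cube (Suc m)))"
        unfolding True by (rule is_box_map.ident)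
      show "compose (cube m) (coface n i k) f = compose (cube m) (restrict id (cube (Suc m))) (coface m i k)"
        using coface_in_cube[of _ m i k] coface.hyps(2,3) unfolding f True by (auto simp: compose_def)
    qed (use coface True in auto)
  next
    case False
    then have "m < n" using box_map_le[OF coface.hyps(1)] by simp
    then obtain f' i' k' where f': "is_box_map (Suc m) n f'" "i' \<in> {1..Suc m}" "k' \<in> {0,1}"
      "f = compose (cube m) f' (coface m i' k')"
      using coface.IH by blast
    show ?thesis
    proof (intro exI conjI)
      show "is_box_map (Suc m) (Suc n) (compose (cube (Suc m)) (coface n i k) f')"
        using f' coface.hyps by (auto intro: is_box_map.coface)
      show "compose (cube m) (coface n i k) f =
          compose (cube m) (compose (cube (Suc m)) (coface n i k) f') (coface m i' k')"
        using coface_in_cube[OF _ f'(2,3)] unfolding f'(4) by (auto simp: compose_def)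
    qed (use f' in auto)
  qed
qed simp

lemma cells_standard_cube: "cells (standard_cube n) m = {f. is_box_map m n f}"
  by (simp add: standard_cube_def box_hom_def)

lemma bd_standard_cube: "bd (standard_cube n) m i k f = compose (cube (m - 1)) f (coface (m - 1) i k)"
  by (simp add: standard_cube_def)

text \<open>The uniqueness half of the Yoneda lemma: every box map arises from the identity by
  boundary operators of the standard cube, with which morphisms commute. The induction on the degree
  runs downward from \<open>n\<close>.\<close>

lemma precubical_hom_standard_cube_unique:
  assumes f: "f \<in> precubical_hom (standard_cube n) P" and g: "g \<in> precubical_hom (standard_cube n) P"
    and eq: "f n (restrict id (cube n)) = g n (restrict id (cube n))"
  shows "f = g"
proof -
  have "f m \<phi> = g m \<phi>" if "is_box_map m n \<phi>" for m \<phi>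
    using box_map_le[OF that] that
  proof (induction arbitrary: \<phi> rule: inc_induct)
    case base
    then show ?case using eq unfolding box_map_self by (simp only:)
  next
    case (step m)
    obtain \<phi>' i k where p: "is_box_map (Suc m) n \<phi>'" "i \<in> {1..Suc m}" "k \<in> {0,1}"
      "\<phi> = compose (cube m) \<phi>' (coface m i k)"
      using box_map_coface_right[OF step.prems] step.hyps by blast
    have h: "h m \<phi> = bd P (Suc m) i k (h (Suc m) \<phi>')" if "h \<in> precubical_hom (standard_cube n) P" for h
    proof -
      have "\<forall>n' i k x. n' > 0 \<longrightarrow> i \<in> {1..n'} \<longrightarrow> k \<in> {0,1} \<longrightarrow> x \<in> cells (standard_cube n) n' \<longrightarrow>
            h (n' - 1) (bd (standard_cube n) n' i k x) = bd P n' i k (h n' x)"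
        using that unfolding precubical_hom_def by blast
      from this[rule_format, of "Suc m" i k \<phi>'] show ?thesis
        using p by (simp add: cells_standard_cube bd_standard_cube)
    qed
    have "f m \<phi> = bd P (Suc m) i k (f (Suc m) \<phi>')" by (rule h[OF f])
    also have "\<dots> = bd P (Suc m) i k (g (Suc m) \<phi>')" using step.IH[OF p(1)] by (rule arg_cong)
    also have "\<dots> = g m \<phi>" by (rule h[OF g, symmetric])
    finally show ?case .
  qed
  \<comment> \<open>Agreement on cells is equality because morphisms are extensional in each
    degree.\<close>
  moreover have "f m \<in> extensional {\<phi>. is_box_map m n \<phi>}" "g m \<in> extensional {\<phi>. is_box_map m n \<phi>}" for m
    using f g by (auto simp: precubical_hom_def cells_standard_cube PiE_iff)
  ultimately have "f m = g m" for m by (intro extensionalityI[of _ "{\<phi>. is_box_map m n \<phi>}"]) simp_all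
  then show ?thesis by blast
qed

lemma precubical_bd:
  assumes "precubical_set P" "i \<in> {1..n}" "k \<in> {0,1}" "y \<in> cells P n"
  shows "bd P n i k y \<in> cells P (n - 1)"
  using assms by (auto simp: precubical_set_def)

lemma precubical_bd_bd:
  assumes "precubical_set P" "1 \<le> i" "i < j" "j \<le> n" "k \<in> {0,1}" "l \<in> {0,1}" "y \<in> cells P n"
  shows "bd P (n - 1) i k (bd P n j l y) = bd P (n - 1) (j - 1) l (bd P n i k y)"
  using assms unfolding precubical_set_def by blast

lemma precubical_square_bd_bd:
  assumes "precubical_set P" "k \<in> {0,1}" "l \<in> {0,1}" "y \<in> cells P 2"
  shows "bd P 1 1 k (bd P 2 2 l y) = bd P 1 1 l (bd P 2 1 k y)"
  using precubical_bd_bd[OF assms(1), of 1 2 2 k l y] assms by simp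

section \<open>The edge, the square and their faces in coordinates\<close>

definition edge_point :: "real \<Rightarrow> nat \<Rightarrow> real" where
  "edge_point s = (\<lambda>j\<in>{1}. s)"

definition square_point :: "real \<Rightarrow> real \<Rightarrow> nat \<Rightarrow> real" where
  "square_point s t = (\<lambda>j\<in>{1,2}. if j = 1 then s else t)"

lemma edge_point_1 [simp]: "edge_point s 1 = s"
  by (simp add: edge_point_def)

lemma square_point_12 [simp]: "square_point s t 1 = s" "square_point s t 2 = t"
  by (simp_all add: square_point_def)

lemma square_point_inj [simp]: "square_point s t = square_point s' t' \<longleftrightarrow> s = s' \<and> t = t'"
  by (metis square_point_12)

lemma atLeastAtMost_1_2: "{1..2} = {1, 2::nat}"
  by auto

lemma cube_0: "u \<in> cube 0 \<longleftrightarrow> u = unit_point"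
  by (auto simp: cube_def)

lemma unit_point_in_cube [simp]: "unit_point \<in> cube 0"
  by (simp add: cube_0)

lemma edge_point_in_cube [simp]: "edge_point s \<in> cube 1 \<longleftrightarrow> 0 \<le> s \<and> s \<le> 1"
  by (auto simp: cube_def edge_point_def)

lemma square_point_in_cube [simp]: "square_point s t \<in> cube 2 \<longleftrightarrow> 0 \<le> s \<and> s \<le> 1 \<and> 0 \<le> t \<and> t \<le> 1"
  by (auto simp: cube_def square_point_def PiE_iff atLeastAtMost_1_2)

lemma cube_1E:
  assumes "u \<in> cube 1" obtains s where "0 \<le> s" "s \<le> 1" "u = edge_point s"
proof (rule that[of "u 1"])
  show "u = edge_point (u 1)"
    by (rule extensionalityI[of _ "{1}"]) (use assms in \<open>auto simp: cube_def PiE_iff edge_point_def\<close>)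
qed (use assms in \<open>auto simp: cube_def PiE_iff\<close>)

lemma cube_2E:
  assumes "u \<in> cube 2" obtains s t where "0 \<le> s" "s \<le> 1" "0 \<le> t" "t \<le> 1" "u = square_point s t"
proof (rule that[of "u 1" "u 2"])
  show "u = square_point (u 1) (u 2)"
    by (rule extensionalityI[of _ "{1,2}"])
      (use assms in \<open>auto simp: cube_def PiE_iff atLeastAtMost_1_2 square_point_def\<close>)
qed (use assms in \<open>auto simp: cube_def PiE_iff\<close>)

lemma coface_0: "coface 0 1 k u = edge_point (real k)"
  by (auto simp: coface_def edge_point_def)

lemma coface_1:
  "coface 1 1 k (edge_point s) = square_point (real k) s"
  "coface 1 2 k (edge_point s) = square_point s (real k)"
  by (auto simp: coface_def square_point_def edge_point_def Suc_1 atLeastAtMost_1_2)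

text \<open>Written as the boundary of the identity cell of the standard square, so that a morphism
  can be evaluated on it by compatibility with the boundary operators.\<close>

definition square_face :: "nat \<Rightarrow> nat \<Rightarrow> (nat \<Rightarrow> real) \<Rightarrow> nat \<Rightarrow> real" where
  "square_face i k = compose (cube 1) (restrict id (cube 2)) (coface 1 i k)"

definition square_vertex :: "nat \<Rightarrow> nat \<Rightarrow> (nat \<Rightarrow> real) \<Rightarrow> nat \<Rightarrow> real" where
  "square_vertex k l = (\<lambda>u\<in>cube 0. square_point k l)"

lemma square_face_edge_point:
  assumes "0 \<le> s" "s \<le> 1" "k \<in> {0,1}"
  shows "square_face 1 k (edge_point s) = square_point k s" "square_face 2 k (edge_point s) = square_point s k"
  using assms by (auto simp: square_face_def compose_def coface_1)

lemma box_map_square_face: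
  assumes "i \<in> {1,2}" "k \<in> {0,1}" shows "is_box_map 1 2 (square_face i k)"
proof -
  have i: "i \<in> {1..Suc 1}" using assms(1) by auto
  then have "is_box_map 1 (Suc 1) (compose (cube 1) (coface 1 i k) (restrict id (cube 1)))"
    using assms(2) by (intro is_box_map.intros)
  moreover have "compose (cube 1) (coface 1 i k) (restrict id (cube 1)) = square_face i k"
    using coface_in_cube[OF _ i assms(2)] unfolding square_face_def Suc_1 by (auto simp: compose_def)
  ultimately show ?thesis by (simp add: Suc_1)
qed

lemma box_map_1_2:
  "is_box_map 1 2 f \<Longrightarrow> \<exists>i\<in>{1,2}. \<exists>k\<in>{0,1}. f = square_face i k"
proof -
  assume "is_box_map 1 2 f"
  then obtain f' i k where f: "is_box_map 2 2 f'" "i \<in> {1..2}" "k \<in> {0,1}" "f = compose (cube 1) f' (coface 1 i k)"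
    using box_map_coface_right[of 1 2 f] unfolding Suc_1 by auto
  then show ?thesis unfolding box_map_self square_face_def atLeastAtMost_1_2 by blast
qed

lemma compose_square_face:
  assumes "i \<in> {1,2}" "k \<in> {0,1}" "l \<in> {0,1}"
  shows "compose (cube 0) (square_face i k) (coface 0 1 l) = (if i = 1 then square_vertex k l else square_vertex l k)"
proof -
  have "0 \<le> real l" "real l \<le> 1" using assms(3) by auto
  note e = square_face_edge_point[OF this assms(2)]
  have "square_face i k (edge_point l) = (if i = 1 then square_point k l else square_point l k)"
    using assms(1) e by auto
  then show ?thesis unfolding compose_def square_vertex_def coface_0 by simp
qed

lemma box_map_square_vertex:
  assumes "k \<in> {0,1}" "l \<in> {0,1}" shows "is_box_map 0 2 (square_vertex k l)"
proof -
  have "is_box_map 0 (Suc 0) (compose (cube 0) (coface 0 1 k) (restrict id (cube 0)))"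
    by (rule is_box_map.coface[OF is_box_map.ident _ assms(1)]) simp
  then have "is_box_map 0 1 (compose (cube 0) (coface 0 1 k) (restrict id (cube 0)))"
    unfolding One_nat_def .
  then have "is_box_map 0 (Suc 1) (compose (cube 0) (coface 1 2 l) (compose (cube 0) (coface 0 1 k) (restrict id (cube 0))))"
    by (rule is_box_map.coface[OF _ _ assms(2)]) simp
  moreover have "compose (cube 0) (coface 1 2 l) (compose (cube 0) (coface 0 1 k) (restrict id (cube 0))) = square_vertex k l"
    by (auto simp: compose_def square_vertex_def coface_0 coface_1)
  ultimately show ?thesis by (simp add: Suc_1)
qed

lemma box_map_0_2:
  assumes "is_box_map 0 2 f" shows "\<exists>k\<in>{0,1}. \<exists>l\<in>{0,1}. f = square_vertex k l"
proof -
  obtain f' i l where "is_box_map (Suc 0) 2 f'" "i \<in> {1..Suc 0}" "l \<in> {0,1}" "f = compose (cube 0) f' (coface 0 i l)"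
    using box_map_coface_right[OF assms zero_less_numeral] by blast
  then have f: "is_box_map 1 2 f'" "l \<in> {0,1}" "f = compose (cube 0) f' (coface 0 1 l)"
    by (simp_all add: le_antisym)
  then obtain i k where "i \<in> {1,2}" "k \<in> {0,1}" "f' = square_face i k" using box_map_1_2 by blast
  then show ?thesis using compose_square_face[of i k l] f by (auto split: if_splits)
qed

lemma square_face_inj:
  assumes "i \<in> {1,2}" "i' \<in> {1,2}" "k \<in> {0,1}" "k' \<in> {0,1}" "square_face i k = square_face i' k'"
  shows "i = i' \<and> k = k'"
proof -
  have "square_face i k (edge_point s) = square_face i' k' (edge_point s)" for s
    using assms(5) by simp
  \<comment> \<open>A side of the square is determined by its two ends.\<close>
  from this[of 0] this[of 1] show ?thesis
    using assms(1-4) by (auto simp: square_face_edge_point)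
qed

lemma square_vertex_inj:
  "square_vertex k l = square_vertex k' l' \<Longrightarrow> k = k' \<and> l = l'"
  unfolding square_vertex_def by (drule fun_cong[of _ _ unit_point]) simp

section \<open>The morphism defined by a square, and regularity\<close>

text \<open>The existence half of the Yoneda lemma for squares. Since \<open>sharp\<close> is a
  definite description, regularity yields nothing about faces before a morphism with this value is
  constructed.\<close>

lemma sharp_square:
  assumes P: "precubical_set P" and x: "x \<in> cells P 2"
  shows "sharp P 2 x \<in> precubical_hom (standard_cube 2) P \<and> sharp P 2 x 2 (restrict id (cube 2)) = x"
proof -
  \<comment> \<open>\<open>I\<close> and \<open>V\<close> read off the indices from a side or vertex
    given as a map; \<open>square_face_inj\<close> and \<open>square_vertex_inj\<close> guarantee
    that the choice returns the intended ones.\<close>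
  define I where "I \<phi> = (SOME p. fst p \<in> {1,2} \<and> snd p \<in> {0,1} \<and> \<phi> = square_face (fst p) (snd p))" for \<phi>
  define V where "V \<phi> = (SOME p. \<phi> = square_vertex (fst p) (snd p))" for \<phi>
  define F where "F m = (\<lambda>\<phi>\<in>{\<phi>. is_box_map m 2 \<phi>}.
     if m = 2 then x
     else if m = 1 then bd P 2 (fst (I \<phi>)) (snd (I \<phi>)) x
     else bd P 1 1 (fst (V \<phi>)) (bd P 2 2 (snd (V \<phi>)) x))" for m
  have F2: "F 2 (restrict id (cube 2)) = x"
    by (simp add: F_def is_box_map.ident)
  have F1: "F 1 (square_face i k) = bd P 2 i k x" if "i \<in> {1,2}" "k \<in> {0,1}" for i k
  proof -
    have "fst (I (square_face i k)) \<in> {1,2} \<and> snd (I (square_face i k)) \<in> {0,1} \<and>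
        square_face i k = square_face (fst (I (square_face i k))) (snd (I (square_face i k)))"
      unfolding I_def by (rule someI[of _ "(i, k)"]) (use that in simp)
    then have "i = fst (I (square_face i k)) \<and> k = snd (I (square_face i k))"
      using square_face_inj[OF that(1) _ that(2)] by blast
    then show ?thesis
      using that box_map_square_face by (simp add: F_def)
  qed
  have F0: "F 0 (square_vertex k l) = bd P 1 1 k (bd P 2 2 l x)" if "k \<in> {0,1}" "l \<in> {0,1}" for k l
  proof -
    have "square_vertex k l = square_vertex (fst (V (square_vertex k l))) (snd (V (square_vertex k l)))"
      unfolding V_def by (rule someI[of _ "(k, l)"]) simp
    then have "k = fst (V (square_vertex k l)) \<and> l = snd (V (square_vertex k l))"
      by (rule square_vertex_inj)
    then show ?thesis
      using that box_map_square_vertex by (simp add: F_def)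
  qed
  have face: "bd P 2 i k x \<in> cells P 1" if "i \<in> {1,2}" "k \<in> {0,1}" for i k
    using precubical_bd[OF P, of i 2 k x] that x by auto
  have "F m \<phi> \<in> cells P m" if "is_box_map m 2 \<phi>" for m \<phi>
  proof -
    note box = that
    have "m = 2 \<or> m = 1 \<or> m = 0" using box_map_le[OF box] by linarith
    then show ?thesis
    proof (elim disjE)
      assume "m = 2" then show ?thesis using box x by (simp add: F_def)
    next
      assume m: "m = 1"
      then obtain i k where "i \<in> {1,2}" "k \<in> {0,1}" "\<phi> = square_face i k" using box_map_1_2 box by blast
      then show ?thesis using F1 face m by simp
    next
      assume m: "m = 0"
      then obtain k l where kl: "k \<in> {0,1}" "l \<in> {0,1}" "\<phi> = square_vertex k l" using box_map_0_2 box by blast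
      have "bd P 1 1 k (bd P 2 2 l x) \<in> cells P (1 - 1)"
        using face[of 2 l] kl by (intro precubical_bd[OF P]) simp_all
      then show ?thesis using kl m F0 by simp
    qed
  qed
  moreover have "F (m - 1) (bd (standard_cube 2) m i k \<phi>) = bd P m i k (F m \<phi>)"
    if "m > 0" "i \<in> {1..m}" "k \<in> {0,1}" "is_box_map m 2 \<phi>" for m i k \<phi>
  proof -
    note h = that
    have "m = 2 \<or> m = 1" using box_map_le[OF h(4)] h(1) by linarith
    then show ?thesis
    proof (elim disjE)
      assume m: "m = 2"
      then have "\<phi> = restrict id (cube 2)" using h(4) by (simp add: box_map_self)
      then have "F (m - 1) (bd (standard_cube 2) m i k \<phi>) = F 1 (square_face i k)"
        unfolding bd_standard_cube square_face_def using m by simp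
      also have "\<dots> = bd P m i k (F m \<phi>)"
        unfolding \<open>\<phi> = _\<close> m F2 by (rule F1) (use h m in \<open>simp_all add: atLeastAtMost_1_2\<close>)
      finally show ?thesis .
    next
      assume m: "m = 1"
      then obtain j l where jl: "j \<in> {1,2}" "l \<in> {0,1}" "\<phi> = square_face j l" using box_map_1_2 h(4) by blast
      have i: "i = 1" using h(2) m by simp
      have "F (m - 1) (bd (standard_cube 2) m i k \<phi>) = F 0 (if j = 1 then square_vertex l k else square_vertex k l)"
        unfolding bd_standard_cube m i jl(3) compose_square_face[OF jl(1,2) h(3), symmetric] by simp
      also have "\<dots> = (if j = 1 then bd P 1 1 l (bd P 2 2 k x) else bd P 1 1 k (bd P 2 2 l x))"
        using F0[OF jl(2) h(3)] F0[OF h(3) jl(2)] by simp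
      \<comment> \<open>For \<open>j = 2\<close> this is the value chosen on vertices; for
        \<open>j = 1\<close> the precubical identity interchanges the two boundary
        operators.\<close>
      also have "\<dots> = bd P 1 1 k (bd P 2 j l x)"
        using jl(1) precubical_square_bd_bd[OF P jl(2) h(3) x] by auto
      also have "\<dots> = bd P m i k (F m \<phi>)"
        unfolding m i jl(3) F1[OF jl(1,2)] ..
      finally show ?thesis .
    qed
  qed
  ultimately have "F \<in> precubical_hom (standard_cube 2) P"
    unfolding precubical_hom_def cells_standard_cube PiE_iff mem_Collect_eq
    using restrict_extensional by (simp add: F_def[abs_def])
  then have "F \<in> precubical_hom (standard_cube 2) P \<and> F 2 (restrict id (cube 2)) = x"
    using F2 by blast
  then show ?thesis
    unfolding sharp_def
  proof (rule theI[of "\<lambda>f. f \<in> precubical_hom (standard_cube 2) P \<and> f 2 (restrict id (cube 2)) = x" F])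
    fix f assume f: "f \<in> precubical_hom (standard_cube 2) P \<and> f 2 (restrict id (cube 2)) = x"
    then have "f 2 (restrict id (cube 2)) = F 2 (restrict id (cube 2))" unfolding F2 by blast
    then show "f = F"
      using precubical_hom_standard_cube_unique f \<open>F \<in> precubical_hom _ P\<close> by blast
  qed
qed

lemma sharp_square_bd:
  assumes P: "precubical_set P" and x: "x \<in> cells P 2"
    and m: "m > 0" "i \<in> {1..m}" "k \<in> {0,1}" "is_box_map m 2 \<phi>"
  shows "sharp P 2 x (m - 1) (compose (cube (m - 1)) \<phi> (coface (m - 1) i k)) = bd P m i k (sharp P 2 x m \<phi>)"
proof -
  have "\<forall>n i k \<phi>. n > 0 \<longrightarrow> i \<in> {1..n} \<longrightarrow> k \<in> {0,1} \<longrightarrow> \<phi> \<in> cells (standard_cube 2) n \<longrightarrow>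
            sharp P 2 x (n - 1) (bd (standard_cube 2) n i k \<phi>) = bd P n i k (sharp P 2 x n \<phi>)"
    using sharp_square[OF P x] unfolding precubical_hom_def by blast
  then show ?thesis
    using m unfolding cells_standard_cube bd_standard_cube mem_Collect_eq by blast
qed

lemma sharp_square_face:
  assumes P: "precubical_set P" and x: "x \<in> cells P 2" and ik: "i \<in> {1,2}" "k \<in> {0,1}"
  shows "sharp P 2 x 1 (square_face i k) = bd P 2 i k x"
proof -
  have "i \<in> {1..2}" and e: "(2::nat) - 1 = 1" using ik by (simp_all add: atLeastAtMost_1_2)
  from sharp_square_bd[OF P x zero_less_numeral this(1) ik(2) is_box_map.ident]
  show ?thesis
    unfolding square_face_def sharp_square[OF P x, THEN conjunct2] e .
qed

lemma sharp_square_vertex: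
  assumes P: "precubical_set P" and x: "x \<in> cells P 2" and kl: "k \<in> {0,1}" "l \<in> {0,1}"
  shows "sharp P 2 x 0 (square_vertex k l) = bd P 1 1 k (bd P 2 2 l x)"
proof -
  have l: "(2::nat) \<in> {1,2}" "(1::nat) \<in> {1..1}" by simp_all
  from sharp_square_bd[OF P x zero_less_one l(2) kl(1) box_map_square_face[OF l(1) kl(2)]]
  have "sharp P 2 x 0 (compose (cube 0) (square_face 2 l) (coface 0 1 k)) = bd P 1 1 k (sharp P 2 x 1 (square_face 2 l))"
    unfolding diff_self_eq_0 .
  then show ?thesis
    unfolding compose_square_face[OF l(1) kl(2,1)] sharp_square_face[OF P x l(1) kl(2)] by simp
qed

text \<open>This and the next lemma are the forms in which regularity enters: injectivity of
  \<open>sharp\<close> in degree 1 keeps the four sides of the square apart, in degree 0 its four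
  vertices.\<close>

lemma regular_square_faces_inj:
  assumes P: "precubical_set P" and x: "x \<in> cells P 2" and r: "regular P 2 x"
    and "i \<in> {1,2}" "i' \<in> {1,2}" "k \<in> {0,1}" "k' \<in> {0,1}" "bd P 2 i k x = bd P 2 i' k' x"
  shows "i = i' \<and> k = k'"
proof -
  have "inj_on (sharp P 2 x 1) {f. is_box_map 1 2 f}"
    using r by (auto simp: regular_def cells_standard_cube)
  then have "square_face i k = square_face i' k'"
    by (rule inj_onD, unfold sharp_square_face[OF P x assms(4,6)] sharp_square_face[OF P x assms(5,7)])
       (use assms(4-8) box_map_square_face in blast)+
  then show ?thesis by (rule square_face_inj[OF assms(4-7)])
qed

lemma regular_square_vertices_inj:
  assumes P: "precubical_set P" and x: "x \<in> cells P 2" and r: "regular P 2 x"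
    and "k \<in> {0,1}" "l \<in> {0,1}" "k' \<in> {0,1}" "l' \<in> {0,1}"
    and "bd P 1 1 k (bd P 2 2 l x) = bd P 1 1 k' (bd P 2 2 l' x)"
  shows "k = k' \<and> l = l'"
proof -
  have "inj_on (sharp P 2 x 0) {f. is_box_map 0 2 f}"
    using r by (auto simp: regular_def cells_standard_cube)
  then have "square_vertex k l = square_vertex k' l'"
    by (rule inj_onD, unfold sharp_square_vertex[OF P x assms(4,5)] sharp_square_vertex[OF P x assms(6,7)])
       (use assms(4-8) box_map_square_vertex in blast)+
  then show ?thesis by (rule square_vertex_inj)
qed

section \<open>Collapsing a free corner\<close>

locale free_corner =
  fixes P :: "'a precubical" and b :: nat and x :: 'a
  assumes precubical: "precubical_set P"
    and b: "b \<in> {0, 1}"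
    and x: "x \<in> cells P 2"
    and regular: "regular P 2 x"
    and free_edges: "\<forall>y \<in> cells P 2 - {x}.
           \<not> in_boundary P 1 (bd P 2 1 (1 - b) x) 2 y \<and> \<not> in_boundary P 1 (bd P 2 2 b x) 2 y"
    and free_vertex: "{e \<in> cells P 1. in_boundary P 0 (bd P 1 1 (1 - b) (bd P 2 2 b x)) 1 e} =
           {bd P 2 1 (1 - b) x, bd P 2 2 b x}"
begin

section \<open>The removed cells and their incidences\<close>

text \<open>In the coordinates (s,t) of the square, \<open>edge1\<close> is the side s = 1 - b,
  \<open>edge2\<close> is the side t = b, and \<open>corner\<close> is their common vertex (1 - b,
  b). The kept sides are s = b and t = 1 - b.\<close>

definition edge1 :: 'a where "edge1 = bd P 2 1 (1 - b) x"
definition edge2 :: 'a where "edge2 = bd P 2 2 b x"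
definition corner :: 'a where "corner = bd P 1 1 (1 - b) edge2"

definition Q :: "'a precubical" where
  "Q = P\<lparr>cells := (cells P)(0 := cells P 0 - {corner}, 1 := cells P 1 - {edge1, edge2}, 2 := cells P 2 - {x})\<rparr>"

lemma b': "1 - b \<in> {0, 1}" "b \<noteq> 1 - b"
  using b by auto

lemma bit_cases: "k \<in> {0, 1} \<Longrightarrow> k = b \<or> k = 1 - b"
  using b by auto

lemma cells_Q:
  "cells Q n = (if n = 0 then cells P 0 - {corner} else if n = 1 then cells P 1 - {edge1, edge2}
     else if n = 2 then cells P 2 - {x} else cells P n)"
  by (simp add: Q_def)

lemma bd_Q [simp]: "bd Q = bd P"
  by (simp add: Q_def)

lemma square_face_cell: "i \<in> {1,2} \<Longrightarrow> k \<in> {0,1} \<Longrightarrow> bd P 2 i k x \<in> cells P 1"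
  using precubical_bd[OF precubical, of i 2 k x] x by (auto simp: atLeastAtMost_1_2)

lemma edge_cells: "edge1 \<in> cells P 1" "edge2 \<in> cells P 1"
  unfolding edge1_def edge2_def using square_face_cell b b' by auto

lemma edge_face_cell: "e \<in> cells P 1 \<Longrightarrow> k \<in> {0,1} \<Longrightarrow> bd P 1 1 k e \<in> cells P 0"
  using precubical_bd[OF precubical, of 1 1 k e] by auto

lemma corner_alt: "corner = bd P 1 1 b edge1"
  unfolding corner_def edge1_def edge2_def
  using precubical_square_bd_bd[OF precubical b'(1) b x] .

lemma face_eq_edge1:
  assumes "i \<in> {1,2}" "k \<in> {0,1}" shows "bd P 2 i k x = edge1 \<longleftrightarrow> i = 1 \<and> k = 1 - b"
  unfolding edge1_def
  using regular_square_faces_inj[OF precubical x regular assms(1) _ assms(2) b'(1), of 1] by auto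

lemma face_eq_edge2:
  assumes "i \<in> {1,2}" "k \<in> {0,1}" shows "bd P 2 i k x = edge2 \<longleftrightarrow> i = 2 \<and> k = b"
  unfolding edge2_def
  using regular_square_faces_inj[OF precubical x regular assms(1) _ assms(2) b, of 2] by auto

lemma edge1_neq_edge2: "edge1 \<noteq> edge2"
  using face_eq_edge2[of 1 "1 - b"] b' by (simp add: edge1_def)

text \<open>The four vertices of the square are distinct, so the far end of a free edge is not the
  corner and survives in \<open>Q\<close>.\<close>

lemma face_edge2_eq_corner:
  assumes k: "k \<in> {0,1}" shows "bd P 1 1 k edge2 = corner \<longleftrightarrow> k = 1 - b"
  unfolding corner_def edge2_def
  using regular_square_vertices_inj[OF precubical x regular k b b'(1) b] by blast

lemma face_edge1_eq_corner:
  assumes k: "k \<in> {0,1}" shows "bd P 1 1 k edge1 = corner \<longleftrightarrow> k = b"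
proof -
  have "bd P 1 1 k edge1 = bd P 1 1 (1 - b) (bd P 2 2 k x)"
    unfolding edge1_def by (rule precubical_square_bd_bd[OF precubical b'(1) k x, symmetric])
  then show ?thesis
    unfolding corner_def edge2_def
    using regular_square_vertices_inj[OF precubical x regular b'(1) k b'(1) b] by auto
qed

lemma not_face_of_square:
  assumes "y \<in> cells P 2" "y \<noteq> x" "i \<in> {1,2}" "k \<in> {0,1}"
  shows "bd P 2 i k y \<noteq> edge1" "bd P 2 i k y \<noteq> edge2"
proof -
  have "in_boundary P 1 (bd P (Suc 1) i k y) (Suc 1) y"
    by (rule in_boundary.one) (use assms in \<open>auto simp: Suc_1\<close>)
  then have "in_boundary P 1 (bd P 2 i k y) 2 y" by (simp only: Suc_1)
  then show "bd P 2 i k y \<noteq> edge1" "bd P 2 i k y \<noteq> edge2"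
    using free_edges assms(1,2) unfolding edge1_def edge2_def by auto
qed

lemma not_face_of_edge:
  assumes "e \<in> cells P 1" "e \<noteq> edge1" "e \<noteq> edge2" "k \<in> {0,1}"
  shows "bd P 1 1 k e \<noteq> corner"
proof -
  have "in_boundary P 0 (bd P (Suc 0) 1 k e) (Suc 0) e"
    by (rule in_boundary.one) (use assms in auto)
  then have "in_boundary P 0 (bd P 1 1 k e) 1 e" by simp
  moreover have "{e \<in> cells P 1. in_boundary P 0 corner 1 e} = {edge1, edge2}"
    using free_vertex by (simp only: corner_def edge1_def edge2_def)
  ultimately show ?thesis using assms(1-3) by force
qed

lemma edge_in_face:
  assumes "y \<in> cells P 2" "i \<in> {1,2}" "k \<in> {0,1}"
  shows "bd P 2 i k y = edge1 \<Longrightarrow> y = x" "bd P 2 i k y = edge2 \<Longrightarrow> y = x"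
  using not_face_of_square[OF assms(1) _ assms(2,3)] by blast+

section \<open>Closure of the kept cells under boundary operators\<close>

lemma cube_face_cell: "z \<in> cells P 3 \<Longrightarrow> i \<in> {1,2,3} \<Longrightarrow> k \<in> {0,1} \<Longrightarrow> bd P 3 i k z \<in> cells P 2"
  using precubical_bd[OF precubical, of i 3 k z] by auto

text \<open>If a face of a 3-cube is \<open>x\<close>, then so are the two other faces at the corner of the cube
  that corresponds to the free corner of \<open>x\<close>, because each of them contains a free edge. The edges
  at that corner are then identified in a way that contradicts regularity.\<close>

lemma not_face_of_cube:
  assumes z: "z \<in> cells P 3" and i: "i \<in> {1,2,3}" and k: "k \<in> {0,1}"
  shows "bd P 3 i k z \<noteq> x"
proof
  assume eq: "bd P 3 i k z = x"
  have rel: "bd P 2 i k (bd P 3 j l z) = bd P 2 (j - 1) l (bd P 3 i k z)"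
    if "1 \<le> i" "i < j" "j \<le> 3" "k \<in> {0,1}" "l \<in> {0,1}" for i j k l
    using precubical_bd_bd[OF precubical that z] by simp
  consider "i = 1" | "i = 2" | "i = 3" using i by blast
  then show False
  proof cases
    case 1
    have a: "bd P 2 1 k (bd P 3 2 (1 - b) z) = edge1" "bd P 2 1 k (bd P 3 3 b z) = edge2"
      using rel[of 1 2 k "1 - b"] rel[of 1 3 k b] k b b' eq 1 by (simp_all add: edge1_def edge2_def)
    have "bd P 3 2 (1 - b) z = x" "bd P 3 3 b z = x"
      by (rule edge_in_face(1)[OF cube_face_cell[OF z _ b'(1)] _ k a(1)], simp_all)
         (rule edge_in_face(2)[OF cube_face_cell[OF z _ b] _ k a(2)], simp_all)
    then show False using a edge1_neq_edge2 by simp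
  next
    case 2
    have a: "bd P 2 1 k (bd P 3 1 (1 - b) z) = edge1" "bd P 2 2 k (bd P 3 3 b z) = edge2"
      using rel[of 1 2 "1 - b" k] rel[of 2 3 k b] k b b' eq 2 by (simp_all add: edge1_def edge2_def)
    have "bd P 3 1 (1 - b) z = x" "bd P 3 3 b z = x"
      by (rule edge_in_face(1)[OF cube_face_cell[OF z _ b'(1)] _ k a(1)], simp_all)
         (rule edge_in_face(2)[OF cube_face_cell[OF z _ b] _ k a(2)], simp_all)
    then show False using a k b' face_eq_edge1[of 1 k] face_eq_edge2[of 2 k] by simp
  next
    case 3
    have a: "bd P 2 2 k (bd P 3 1 (1 - b) z) = edge1"
      using rel[of 1 3 "1 - b" k] k b b' eq 3 by (simp_all add: edge1_def edge2_def)
    have "bd P 3 1 (1 - b) z = x"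
      by (rule edge_in_face(1)[OF cube_face_cell[OF z _ b'(1)] _ k a(1)], simp_all)
    then show False using a k face_eq_edge1[of 2 k] by simp
  qed
qed

lemma precubical_subset_Q: "precubical_subset Q P"
proof -
  have face: "bd P n i k y \<in> cells Q (n - 1)"
    if n: "n > 0" and i: "i \<in> {1..n}" and k: "k \<in> {0,1}" and y: "y \<in> cells Q n" for n i k y
  proof -
    have yP: "y \<in> cells P n" using y by (auto simp: cells_Q split: if_splits)
    have "bd P n i k y \<in> cells P (n - 1)" using precubical_bd[OF precubical i k yP] .
    moreover have "n = 1 \<Longrightarrow> bd P 1 i k y \<noteq> corner"
      using not_face_of_edge[of y k] y i k by (simp add: cells_Q)
    moreover have "n = 2 \<Longrightarrow> bd P 2 i k y \<noteq> edge1 \<and> bd P 2 i k y \<noteq> edge2"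
      using not_face_of_square[of y i k] y i k by (simp add: cells_Q atLeastAtMost_1_2)
    moreover have "n = 3 \<Longrightarrow> bd P 3 i k y \<noteq> x"
      using not_face_of_cube[of y i k] yP i k by force
    \<comment> \<open>Cells are removed in degrees 0, 1 and 2 only, so only the faces of cells of
      degree 1, 2 and 3 need an argument.\<close>
    moreover have "n = 1 \<or> n = 2 \<or> n = 3 \<or> n - 1 \<noteq> 0 \<and> n - 1 \<noteq> 1 \<and> n - 1 \<noteq> 2" using n by linarith
    ultimately show ?thesis unfolding cells_Q by (elim disjE) simp_all
  qed
  have QP: "cells Q n \<subseteq> cells P n" for n
    by (auto simp: cells_Q split: if_splits)
  have "bd P (n - 1) i k (bd P n j l y) = bd P (n - 1) (j - 1) l (bd P n i k y)"
    if "1 \<le> i" "i < j" "j \<le> n" "k \<in> {0,1}" "l \<in> {0,1}" "y \<in> cells Q n" for n i j k l y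
    using precubical_bd_bd[OF precubical that(1-5)] QP that(6) by blast
  then have "precubical_set Q"
    using face unfolding precubical_set_def bd_Q by blast
  then show ?thesis
    unfolding precubical_subset_def bd_Q using QP by blast
qed

section \<open>Extremal vertices\<close>

text \<open>Away from the corner, a free edge ends at the vertex (1 - b, 1 - b) or (b, b) of the
  square. There a kept side of the square also ends, and the two either both start or both finish at
  that vertex, so one can be exchanged for the other.\<close>

lemma edge_in_Q:
  assumes w: "w \<noteq> corner" and k: "k \<in> {0,1}"
  shows "(\<exists>e \<in> cells P 1. bd P 1 1 k e = w) \<longleftrightarrow> (\<exists>e \<in> cells Q 1. bd P 1 1 k e = w)"
proof
  assume "\<exists>e \<in> cells P 1. bd P 1 1 k e = w"
  then obtain e where e: "e \<in> cells P 1" "bd P 1 1 k e = w" by blast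
  have square_face: "bd P 2 i l x \<in> cells Q 1" if "(i, l) = (1, b) \<or> (i, l) = (2, 1 - b)" for i l
    using that face_eq_edge1[of i l] face_eq_edge2[of i l] square_face_cell[of i l] b b'
    by (auto simp: cells_Q)
  consider "e = edge1" | "e = edge2" | "e \<in> cells Q 1" using e by (auto simp: cells_Q)
  then show "\<exists>e \<in> cells Q 1. bd P 1 1 k e = w"
  proof cases
    case 1
    then have k': "k = 1 - b" using face_edge1_eq_corner[OF k] bit_cases[OF k] e w by blast
    have "w = bd P 1 1 (1 - b) (bd P 2 2 (1 - b) x)"
      using e(2) unfolding 1 k' edge1_def using precubical_square_bd_bd[OF precubical b'(1) b'(1) x] by simp
    then show ?thesis using square_face[of 2 "1 - b"] k' by blast
  next
    case 2
    then have k': "k = b" using face_edge2_eq_corner[OF k] bit_cases[OF k] e w by blast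
    have "w = bd P 1 1 b (bd P 2 1 b x)"
      using e(2) unfolding 2 k' edge2_def using precubical_square_bd_bd[OF precubical b b x] by simp
    then show ?thesis using square_face[of 1 b] k' by blast
  qed (use e in blast)
qed (auto simp: cells_Q)

text \<open>The corner finishes one free edge and starts the other. It is therefore neither minimal
  nor maximal, and dropping it loses no extremal vertex.\<close>

lemma corner_is_target_and_source: "\<exists>e \<in> cells P 1. bd P 1 1 k e = corner" if "k \<in> {0,1}"
  using bit_cases[OF that] corner_def corner_alt edge_cells by metis

lemma minimal_vertex_Q: "minimal_vertex Q w \<longleftrightarrow> minimal_vertex P w"
proof (cases "w = corner")
  case True
  then show ?thesis
    using corner_is_target_and_source[of 1] by (auto simp: minimal_vertex_def cells_Q)
next
  case False
  then show ?thesis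
    unfolding minimal_vertex_def bd_Q using edge_in_Q[OF False, of 1] by (simp add: cells_Q)
qed

lemma maximal_vertex_Q: "maximal_vertex Q w \<longleftrightarrow> maximal_vertex P w"
proof (cases "w = corner")
  case True
  then show ?thesis
    using corner_is_target_and_source[of 0] by (auto simp: maximal_vertex_def cells_Q)
next
  case False
  then show ?thesis
    unfolding maximal_vertex_def bd_Q using edge_in_Q[OF False, of 0] by (simp add: cells_Q)
qed

lemma Extrl_Q: "Extrl Q = Extrl P"
  unfolding Extrl_def minimal_vertex_Q maximal_vertex_Q by (simp add: Q_def)

lemma Extrl_cells_Q: "w \<in> cells (Extrl P) 0 \<Longrightarrow> w \<in> cells Q 0"
  unfolding Extrl_Q[symmetric] by (auto simp: Extrl_def minimal_vertex_def maximal_vertex_def)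

end

section \<open>Maps out of a realization\<close>

lemma equiv_gluing_equiv: "equiv UNIV (gluing_equiv P)"
proof (rule equivI)
  show "sym (gluing_equiv P)"
    unfolding gluing_equiv_def by (rule sym_rtrancl) (auto simp: sym_def)
qed (auto simp: gluing_equiv_def refl_rtrancl trans_rtrancl)

lemma pt_eq_iff: "pt P n y u = pt P m y' u' \<longleftrightarrow> ((n, y, u), (m, y', u')) \<in> gluing_equiv P"
  unfolding pt_def by (rule eq_equiv_class_iff[OF equiv_gluing_equiv]) simp_all

lemma gluing_equiv_invariant:
  assumes "\<And>p q. (p, q) \<in> gluing P \<Longrightarrow> f p = f q" and "(p, q) \<in> gluing_equiv P"
  shows "f p = f q"
  using assms(2) unfolding gluing_equiv_def
  by (induction rule: rtrancl_induct) (use assms(1) in \<open>fastforce+\<close>)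

lemma gluingE:
  assumes "(p, q) \<in> gluing P"
  obtains n i k y u where "p = (n, bd P (Suc n) i k y, u)" "q = (Suc n, y, coface n i k u)"
    "y \<in> cells P (Suc n)" "i \<in> {1..Suc n}" "k \<in> {0,1}" "u \<in> cube n"
  using assms unfolding gluing_def by blast

lemma pt_face:
  assumes "y \<in> cells P (Suc n)" "i \<in> {1..Suc n}" "k \<in> {0,1}" "u \<in> cube n"
  shows "pt P n (bd P (Suc n) i k y) u = pt P (Suc n) y (coface n i k u)"
proof -
  have "((n, bd P (Suc n) i k y, u), (Suc n, y, coface n i k u)) \<in> gluing P"
    using assms unfolding gluing_def by blast
  then show ?thesis unfolding pt_eq_iff gluing_equiv_def by blast
qed

lemma pt_edge_face:
  assumes "e \<in> cells P 1" "k \<in> {0,1}"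
  shows "pt P 0 (bd P 1 1 k e) unit_point = pt P 1 e (edge_point k)"
  using pt_face[of e P 0 1 k unit_point] assms coface_0[of k] by simp

lemma pt_square_face:
  assumes "y \<in> cells P 2" "k \<in> {0,1}" "0 \<le> t" "t \<le> 1"
  shows "pt P 1 (bd P 2 1 k y) (edge_point t) = pt P 2 y (square_point k t)"
    and "pt P 1 (bd P 2 2 k y) (edge_point t) = pt P 2 y (square_point t k)"
  using pt_face[of y P 1 1 k "edge_point t"] pt_face[of y P 1 2 k "edge_point t"] assms
  unfolding coface_1 Suc_1 by simp_all

lemma topspace_precells: "topspace (precells P) = {(n, y, u). y \<in> cells P n \<and> u \<in> cube n}"
  unfolding precells_def by auto

lemma points_realization:
  "A \<in> points (realization P) \<longleftrightarrow> (\<exists>n y u. y \<in> cells P n \<and> u \<in> cube n \<and> A = pt P n y u)"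
  unfolding realization_def pt_def by (auto simp: quotient_def topspace_precells)

lemma pt_in_points: "y \<in> cells P n \<Longrightarrow> u \<in> cube n \<Longrightarrow> pt P n y u \<in> points (realization P)"
  unfolding points_realization by blast

lemma quotient_map_realization:
  "quotient_map (precells P) (topo (realization P)) (\<lambda>p. gluing_equiv P `` {p})"
  unfolding quotient_map_def realization_def dspace.select_convs topspace_quotient_topology openin_quotient_topology
  by (auto simp: quotient_def)

section \<open>Continuous maps and d-maps described cell by cell\<close>

text \<open>A point of the realization is a class of precells. If \<open>f\<close> respects the
  gluing, its image on a class is a singleton, and \<open>the_elem\<close> extracts the common
  value.\<close>

definition lift :: "('a precell \<Rightarrow> 'b) \<Rightarrow> 'a precell set \<Rightarrow> 'b" where
  "lift f A = the_elem (f ` A)"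

lemma lift_class:
  assumes "\<And>p q. (p, q) \<in> gluing P \<Longrightarrow> f p = f q"
  shows "lift f (gluing_equiv P `` {p}) = f p"
proof -
  have "p \<in> gluing_equiv P `` {p}" by (simp add: gluing_equiv_def)
  moreover have "f q = f p" if "q \<in> gluing_equiv P `` {p}" for q
    using gluing_equiv_invariant[of P f, OF assms] that by auto
  ultimately have "f ` (gluing_equiv P `` {p}) = {f p}" by blast
  then show ?thesis by (simp add: lift_def)
qed

lemma lift_pt:
  assumes "\<And>p q. (p, q) \<in> gluing P \<Longrightarrow> f p = f q"
  shows "lift f (pt P n y u) = f (n, y, u)"
  unfolding pt_def using assms by (rule lift_class)

text \<open>The cells form an open cover of the disjoint union, so by pasting continuity there can
  be checked one cell at a time.\<close>

lemma openin_precells_cell: "y \<in> cells P n \<Longrightarrow> openin (precells P) ({n} \<times> {y} \<times> cube n)"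
proof -
  assume y: "y \<in> cells P n"
  have "openin (prod_topology (discrete_topology (cells P m)) (cube_topology m)) {z. (m, z) \<in> {n} \<times> {y} \<times> cube n}" for m
  proof (cases "m = n")
    case True
    then have "{z. (m, z) \<in> {n} \<times> {y} \<times> cube n} = {y} \<times> topspace (cube_topology n)" by auto
    then show ?thesis using True y by (simp add: openin_prod_Times_iff del: topspace_cube_topology)
  next
    case False
    then have "{z. (m, z) \<in> {n} \<times> {y} \<times> cube n} = {}" by auto
    then show ?thesis by (simp only: openin_empty)
  qed
  moreover have "{n} \<times> {y} \<times> cube n \<subseteq> Sigma UNIV (topspace \<circ> (\<lambda>n. prod_topology (discrete_topology (cells P n)) (cube_topology n)))"
    using y by auto
  ultimately show ?thesis
    unfolding precells_def openin_sum_topology by blast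
qed

lemma continuous_map_cell_coordinates:
  assumes y: "y \<in> cells P n"
  shows "continuous_map (subtopology (precells P) ({n} \<times> {y} \<times> cube n)) (cube_topology n) (\<lambda>p. snd (snd p))"
proof -
  let ?T = "{n} \<times> {y} \<times> cube n"
  have "openin (precells P) {p \<in> ?T. snd (snd p) \<in> U}" if U: "openin (cube_topology n) U" for U
  proof -
    have sub: "U \<subseteq> cube n" using openin_subset[OF U] by simp
    have "openin (prod_topology (discrete_topology (cells P m)) (cube_topology m)) {z. (m, z) \<in> {n} \<times> {y} \<times> U}" for m
    proof (cases "m = n")
      case True
      then have "{z. (m, z) \<in> {n} \<times> {y} \<times> U} = {y} \<times> U" by auto
      then show ?thesis using True y U by (simp add: openin_prod_Times_iff)
    next
      case False
      then have "{z. (m, z) \<in> {n} \<times> {y} \<times> U} = {}" by auto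
      then show ?thesis by (simp only: openin_empty)
    qed
    moreover have "{n} \<times> {y} \<times> U \<subseteq> Sigma UNIV (topspace \<circ> (\<lambda>n. prod_topology (discrete_topology (cells P n)) (cube_topology n)))"
      using y sub by auto
    ultimately have "openin (precells P) ({n} \<times> {y} \<times> U)"
      unfolding precells_def openin_sum_topology by blast
    moreover have "{p \<in> ?T. snd (snd p) \<in> U} = {n} \<times> {y} \<times> U" using sub by auto
    ultimately show ?thesis by simp
  qed
  then show ?thesis
    using openin_precells_cell[OF y] y
    by (auto simp: continuous_map_def openin_open_subtopology topspace_precells Int_def conj_commute
        intro: back_subst[of "openin (precells P)"])
qed

text \<open>Quotient maps are preserved by the product with the locally compact interval.\<close>

lemma continuous_map_lift:
  fixes F :: "real \<times> 'a precell \<Rightarrow> 'a precell set"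
  assumes compat: "\<And>s p q. s \<in> {0..1} \<Longrightarrow> (p, q) \<in> gluing P \<Longrightarrow> F (s, p) = F (s, q)"
    and cell: "\<And>n y. y \<in> cells P n \<Longrightarrow> \<exists>m y' G. y' \<in> cells P m \<and>
       continuous_map (prod_topology (top_of_set {0..1}) (cube_topology n)) (cube_topology m) G \<and>
       (\<forall>s\<in>{0..1}. \<forall>u\<in>cube n. F (s, (n, y, u)) = pt P m y' (G (s, u)))"
  shows "continuous_map (prod_topology (top_of_set {0..1}) (topo (realization P))) (topo (realization P))
           (\<lambda>(s, A). lift (\<lambda>p. F (s, p)) A)"
proof -
  let ?I = "top_of_set {0..1::real}" and ?R = "topo (realization P)"
  have q: "quotient_map (prod_topology ?I (precells P)) (prod_topology ?I ?R) (\<lambda>(s, p). (s, gluing_equiv P `` {p}))"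
  proof (rule quotient_map_prod_right[OF _ _ quotient_map_realization])
    show "locally_compact_space ?I"
      by (intro compact_imp_locally_compact_space) (simp add: compact_space_subtopology)
    show "Hausdorff_space ?I \<or> regular_space ?I" by (simp add: Hausdorff_space_subtopology)
  qed
  have F: "continuous_map (prod_topology ?I (precells P)) ?R F"
  proof (rule pasting_lemma[where I = "{(n, y). y \<in> cells P n}" and f = "\<lambda>_. F"
        and T = "\<lambda>(n, y). {0..1} \<times> ({n} \<times> {y} \<times> cube n)"])
    fix i assume "i \<in> {(n, y). y \<in> cells P n}"
    then obtain n y where i: "i = (n, y)" and y: "y \<in> cells P n" by blast
    let ?T = "{n} \<times> {y} \<times> cube n"
    show "openin (prod_topology ?I (precells P)) (case i of (n, y) \<Rightarrow> {0..1} \<times> ({n} \<times> {y} \<times> cube n))"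
      using openin_precells_cell[OF y] i by (simp add: openin_prod_Times_iff)
    obtain m y' G where G: "y' \<in> cells P m"
       "continuous_map (prod_topology ?I (cube_topology n)) (cube_topology m) G"
       "\<And>s u. s \<in> {0..1} \<Longrightarrow> u \<in> cube n \<Longrightarrow> F (s, (n, y, u)) = pt P m y' (G (s, u))"
      using cell[OF y] by blast
    have Z: "subtopology (prod_topology ?I (precells P)) ({0..1} \<times> ?T) = prod_topology ?I (subtopology (precells P) ?T)"
      by (simp add: subtopology_Times subtopology_subtopology)
    have "continuous_map (prod_topology ?I (subtopology (precells P) ?T)) (prod_topology ?I (cube_topology n))
        (\<lambda>z. (fst z, ((\<lambda>p. snd (snd p)) \<circ> snd) z))"
      by (intro continuous_map_pairedI continuous_map_fst
          continuous_map_compose[OF continuous_map_snd continuous_map_cell_coordinates[OF y]])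
    from continuous_map_compose[OF continuous_map_compose[OF this G(2)] continuous_map_pt[OF G(1)]]
    have "continuous_map (prod_topology ?I (subtopology (precells P) ?T)) ?R F"
      by (rule continuous_map_eq) (auto simp: G(3))
    then show "continuous_map (subtopology (prod_topology ?I (precells P)) (case i of (n, y) \<Rightarrow> {0..1} \<times> ({n} \<times> {y} \<times> cube n))) ?R F"
      using Z i by simp
  qed (auto simp: topspace_precells)
  show ?thesis
  proof (rule continuous_compose_quotient_map[OF q])
    show "continuous_map (prod_topology ?I (precells P)) ?R
        ((\<lambda>(s, A). lift (\<lambda>p. F (s, p)) A) \<circ> (\<lambda>(s, p). (s, gluing_equiv P `` {p})))"
    proof (rule continuous_map_eq[OF F])
      fix z assume "z \<in> topspace (prod_topology ?I (precells P))"
      then have s: "fst z \<in> {0..1}" by auto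
      have "lift (\<lambda>p. F (fst z, p)) (gluing_equiv P `` {snd z}) = F (fst z, snd z)"
        by (rule lift_class) (rule compat[OF s])
      then show "F z = ((\<lambda>(s, A). lift (\<lambda>p. F (s, p)) A) \<circ> (\<lambda>(s, p). (s, gluing_equiv P `` {p}))) z"
        by (simp add: case_prod_unfold)
    qed
  qed
qed

text \<open>An order-preserving map between cubes turns a directed path in one cell into a directed
  path in one cell; concatenation and reparametrization commute with composition. The target cell
  may have another degree, as a free edge is moved through the square.\<close>

lemma dmap_lift:
  assumes compat: "\<And>p q. (p, q) \<in> gluing P \<Longrightarrow> f p = f q"
    and cont: "continuous_map (topo (realization P)) (topo (realization P)) (lift f)"
    and cell: "\<And>n y. y \<in> cells P n \<Longrightarrow> \<exists>m y' G. y' \<in> cells P m \<and>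
       continuous_map (cube_topology n) (cube_topology m) G \<and>
       (\<forall>u\<in>cube n. \<forall>w\<in>cube n. (\<forall>j\<in>{1..n}. u j \<le> w j) \<longrightarrow> (\<forall>j\<in>{1..m}. G u j \<le> G w j)) \<and>
       (\<forall>u\<in>cube n. f (n, y, u) = pt P m y' (G u))"
  shows "dmap (realization P) (realization P) (lift f)"
  unfolding dmap_def
proof (intro conjI cont ballI)
  have fc: "compose {0..1} (lift f) \<omega> \<in> finite_concats P" if "\<omega> \<in> finite_concats P" for \<omega>
    using that
  proof induction
    case (cell y n \<alpha>)
    from assms(3)[OF cell(1)] obtain m y' G
      where G: "y' \<in> cells P m" "continuous_map (cube_topology n) (cube_topology m) G"
      and G3: "\<forall>u\<in>cube n. \<forall>w\<in>cube n. (\<forall>j\<in>{1..n}. u j \<le> w j) \<longrightarrow> (\<forall>j\<in>{1..m}. G u j \<le> G w j)"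
      and G4: "\<forall>u\<in>cube n. f (n, y, u) = pt P m y' (G u)"
      by (elim exE conjE)
    have \<alpha>: "continuous_map (top_of_set {0..1}) (cube_topology n) \<alpha>"
      "\<And>j s t. j \<in> {1..n} \<Longrightarrow> s \<in> {0..1} \<Longrightarrow> t \<in> {0..1} \<Longrightarrow> s \<le> t \<Longrightarrow> \<alpha> s j \<le> \<alpha> t j"
      using cell(2) by (auto simp: cube_dpath_def monotone_on_def)
    have \<alpha>c: "\<alpha> t \<in> cube n" if "t \<in> {0..1}" for t
      using continuous_map_funspace[OF \<alpha>(1)] that by (auto simp: Pi_iff)
    have "cube_dpath m (G \<circ> \<alpha>)"
      unfolding cube_dpath_def
    proof (intro conjI ballI mono_onI)
      show "continuous_map (top_of_set {0..1}) (cube_topology m) (G \<circ> \<alpha>)"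
        by (rule continuous_map_compose[OF \<alpha>(1) G(2)])
      fix j s t assume "j \<in> {1..m}" "s \<in> {0..1::real}" "t \<in> {0..1}" "s \<le> t"
      then show "(G \<circ> \<alpha>) s j \<le> (G \<circ> \<alpha>) t j"
        unfolding o_def using \<alpha>c \<alpha>(2) by (intro G3[rule_format]) auto
    qed
    from finite_concats.cell[OF G(1) this]
    have "(\<lambda>t\<in>{0..1}. pt P m y' (G (\<alpha> t))) \<in> finite_concats P" by simp
    moreover have "compose {0..1} (lift f) (\<lambda>t\<in>{0..1}. pt P n y (\<alpha> t)) = (\<lambda>t\<in>{0..1}. pt P m y' (G (\<alpha> t)))"
      using \<alpha>c G4 lift_pt[of P f, OF compat] by (auto simp: compose_def fun_eq_iff)
    ultimately show ?case by (simp only:)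
  next
    case (concat \<omega> \<nu>)
    have "compose {0..1} (lift f) \<omega> 1 = compose {0..1} (lift f) \<nu> 0"
      using concat.hyps(3) by (simp add: compose_def)
    then show ?case
      unfolding compose_path_concat by (rule finite_concats.concat[OF concat.IH])
  qed
  fix \<omega> assume "\<omega> \<in> dpaths (realization P)"
  then obtain \<nu> \<phi> where w: "\<omega> = compose {0..1} \<nu> \<phi>" "\<nu> \<in> finite_concats P" "reparam \<phi>"
    unfolding realization_def by auto
  have "compose {0..1} (lift f) \<omega> = compose {0..1} (compose {0..1} (lift f) \<nu>) \<phi>"
    unfolding w(1) using w(3) by (auto simp: compose_def reparam_def Pi_iff fun_eq_iff)
  then show "compose {0..1} (lift f) \<omega> \<in> dpaths (realization P)"
    unfolding realization_def using fc[OF w(2)] w(3) by auto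
qed

section \<open>Directed paths in a cell\<close>

definition spread :: "'a precell \<Rightarrow> real" where
  "spread p = (case p of (n, y, u) \<Rightarrow> \<Sum>i\<in>{1..n}. u i * (1 - u i))"

text \<open>The inserted coordinate is 0 or 1 and contributes nothing to the sum. Hence
  \<open>spread\<close> descends to points of the realization.\<close>

lemma spread_coface:
  assumes i: "i \<in> {1..Suc n}" and k: "k \<in> {0,1}"
  shows "spread (Suc n, y, coface n i k u) = spread (n, z, u)"
proof -
  let ?f = "\<lambda>j. coface n i k u j * (1 - coface n i k u j)"
  have "sum ?f {1..Suc n} = ?f i + sum ?f ({1..Suc n} - {i})"
    using i by (intro sum.remove) auto
  also have "?f i = 0" using i k by (auto simp: coface_def)
  also have "sum ?f ({1..Suc n} - {i}) = (\<Sum>j\<in>{1..n}. u j * (1 - u j))"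
    by (rule sum.reindex_bij_witness[where j = "\<lambda>j. if j < i then j else j - 1" and i = "\<lambda>j. if j < i then j else Suc j"])
      (use i in \<open>auto simp: coface_def\<close>)
  finally show ?thesis by (simp add: spread_def)
qed

lemma spread_pt:
  assumes "pt P n y u = pt P m y' u'" shows "spread (n, y, u) = spread (m, y', u')"
proof (rule gluing_equiv_invariant)
  show "((n, y, u), (m, y', u')) \<in> gluing_equiv P" using assms by (simp add: pt_eq_iff)
  show "spread p = spread q" if "(p, q) \<in> gluing P" for p q
    using that by (elim gluingE) (auto simp: spread_coface[symmetric])
qed

lemma spread_square_point: "spread (2, y, square_point s t) = s * (1 - s) + t * (1 - t)"
  by (simp add: spread_def atLeastAtMost_1_2)

lemma continuous_map_square_point:
  assumes "continuous_map X euclideanreal f" "continuous_map X euclideanreal g"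
    and "\<And>z. z \<in> topspace X \<Longrightarrow> f z \<in> {0..1} \<and> g z \<in> {0..1}"
  shows "continuous_map X (cube_topology 2) (\<lambda>z. square_point (f z) (g z))"
  unfolding cube_topology_def continuous_map_componentwise atLeastAtMost_1_2
  using assms by (auto simp: square_point_def continuous_map_in_subtopology)

lemma square_dpath:
  assumes y: "y \<in> cells P 2" and "0 \<le> s" "s \<le> s'" "s' \<le> 1" "0 \<le> t" "t \<le> t'" "t' \<le> 1"
  shows "dpaths_between (realization P) (pt P 2 y (square_point s t)) (pt P 2 y (square_point s' t')) \<noteq> {}"
proof -
  have i: "s + r * (s' - s) \<in> {s..s'}" "t + r * (t' - t) \<in> {t..t'}" if "r \<in> {0..1}" for r
    using that assms mult_left_le_one_le[of "s' - s" r] mult_left_le_one_le[of "t' - t" r] by auto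
  define \<alpha> where "\<alpha> r = square_point (s + r * (s' - s)) (t + r * (t' - t))" for r
  have "continuous_map (top_of_set {0..1}) (cube_topology 2) \<alpha>"
    unfolding \<alpha>_def
  proof (rule continuous_map_square_point)
    show "continuous_map (top_of_set {0..1}) euclideanreal (\<lambda>r. s + r * (s' - s))"
      "continuous_map (top_of_set {0..1}) euclideanreal (\<lambda>r. t + r * (t' - t))"
      by (auto intro!: continuous_intros)
    show "s + r * (s' - s) \<in> {0..1} \<and> t + r * (t' - t) \<in> {0..1}" if "r \<in> topspace (top_of_set {0..1})" for r
      using i[of r] that assms by auto
  qed
  moreover have "mono_on {0..1} (\<lambda>r. \<alpha> r j)" if "j \<in> {1..2}" for j
    using that assms unfolding atLeastAtMost_1_2 \<alpha>_def by (auto intro!: mono_onI mult_right_mono)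
  ultimately have "cube_dpath 2 \<alpha>" by (simp add: cube_dpath_def)
  from finite_concats_fixed[OF finite_concats.cell[OF y this]]
  have "(\<lambda>r\<in>{0..1}. pt P 2 y (\<alpha> r)) \<in> dpaths (realization P)" by (simp add: dpaths_realization)
  then have "(\<lambda>r\<in>{0..1}. pt P 2 y (\<alpha> r)) \<in>
      dpaths_between (realization P) (pt P 2 y (square_point s t)) (pt P 2 y (square_point s' t'))"
    by (simp add: dpaths_between_def \<alpha>_def)
  then show ?thesis by blast
qed

section \<open>Pushing in the square\<close>

text \<open>At time 1 a point goes to the point of the kept sides with the same coordinate sum.
  These sides form a directed path from (0,0) to (1,1), along which s + t grows from 0 to 2: for b =
  1 along the bottom and then the right side, for b = 0 along the left and then the top side.
  Monotonicity is inherited from that of s + t.\<close>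

definition push :: "nat \<Rightarrow> real \<Rightarrow> real \<Rightarrow> real \<Rightarrow> nat \<Rightarrow> real" where
  "push b r s t =
     (let hi = min 1 (s + t); lo = max 0 (s + t - 1) in
      square_point ((1 - r) * s + r * (if b = 1 then hi else lo)) ((1 - r) * t + r * (if b = 1 then lo else hi)))"

lemma push_0: "push b 0 s t = square_point s t"
  by (simp add: push_def)

lemma push_fixed:
  assumes "b \<in> {0,1}" "0 \<le> s" "s \<le> 1" "0 \<le> t" "t \<le> 1" "s = real b \<or> t = real (1 - b)"
  shows "push b r s t = square_point s t"
  using assms by (auto simp: push_def algebra_simps)

lemma convex_bounds:
  fixes r :: real
  assumes "0 \<le> r" "r \<le> 1" "0 \<le> s" "s \<le> 1" "0 \<le> t" "t \<le> 1"
  shows "0 \<le> (1 - r) * s + r * t" "(1 - r) * s + r * t \<le> 1"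
proof -
  show "0 \<le> (1 - r) * s + r * t" using assms by simp
  have "(1 - r) * s + r * t \<le> (1 - r) * 1 + r * 1"
    using assms by (intro add_mono mult_left_mono) auto
  then show "(1 - r) * s + r * t \<le> 1" by simp
qed

lemma push_bounds:
  assumes "0 \<le> r" "r \<le> 1" "0 \<le> s" "s \<le> 1" "0 \<le> t" "t \<le> 1"
  shows "push b r s t \<in> cube 2"
  unfolding push_def Let_def square_point_in_cube
  using convex_bounds[OF assms(1,2)] assms by auto

lemma push_mono:
  assumes "0 \<le> r" "r \<le> 1" "s \<le> s'" "t \<le> t'" "j \<in> {1..2}"
  shows "push b r s t j \<le> push b r s' t' j"
proof -
  have "(1 - r) * s + r * c \<le> (1 - r) * s' + r * c'" if "s \<le> s'" "c \<le> c'" for s s' c c' :: real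
    using that assms by (intro add_mono mult_left_mono) auto
  moreover have "min 1 (s + t) \<le> min 1 (s' + t')" "max 0 (s + t - 1) \<le> max 0 (s' + t' - 1)"
    using assms(3,4) by auto
  ultimately show ?thesis
    using assms(3-5) unfolding push_def Let_def atLeastAtMost_1_2 by (cases "b = 1") auto
qed

lemma push_1:
  "push b 1 s t = (if b = 1 then square_point (min 1 (s + t)) (max 0 (s + t - 1))
     else square_point (max 0 (s + t - 1)) (min 1 (s + t)))"
  by (simp add: push_def)

lemma continuous_map_push:
  assumes r: "continuous_map X euclideanreal r" and s: "continuous_map X euclideanreal s"
    and t: "continuous_map X euclideanreal t"
    and b: "\<And>z. z \<in> topspace X \<Longrightarrow> r z \<in> {0..1} \<and> s z \<in> {0..1} \<and> t z \<in> {0..1}"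
  shows "continuous_map X (cube_topology 2) (\<lambda>z. push b (r z) (s z) (t z))"
  unfolding push_def Let_def
proof (rule continuous_map_square_point)
  have hi: "continuous_map X euclideanreal (\<lambda>z. min 1 (s z + t z))"
    and lo: "continuous_map X euclideanreal (\<lambda>z. max 0 (s z + t z - 1))"
    by (intro continuous_intros s t continuous_map_real_min continuous_map_real_max)+
  show "continuous_map X euclideanreal (\<lambda>z. (1 - r z) * s z + r z * (if b = 1 then min 1 (s z + t z) else max 0 (s z + t z - 1)))"
    "continuous_map X euclideanreal (\<lambda>z. (1 - r z) * t z + r z * (if b = 1 then max 0 (s z + t z - 1) else min 1 (s z + t z)))"
    using hi lo by (cases "b = 1"; simp; intro continuous_intros r s t)+
  show "(1 - r z) * s z + r z * (if b = 1 then min 1 (s z + t z) else max 0 (s z + t z - 1)) \<in> {0..1} \<and>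
      (1 - r z) * t z + r z * (if b = 1 then max 0 (s z + t z - 1) else min 1 (s z + t z)) \<in> {0..1}"
    if "z \<in> topspace X" for z
    using push_bounds[of "r z" "s z" "t z" b] b[OF that] unfolding push_def Let_def by simp
qed

text \<open>The end at 0 or 1 forces \<open>d = 0\<close>, while the midpoint of the interval lies
  strictly between 0 and 1 and gives a positive value.\<close>

lemma not_constant_bump:
  fixes a c :: real
  assumes "0 \<le> a" "a < c" "c \<le> 1" and const: "\<And>z. z \<in> {a..c} \<Longrightarrow> z * (1 - z) = d"
    and ends: "a = 0 \<or> c = 1"
  shows False
proof -
  have "a * (1 - a) = d" "c * (1 - c) = d" "(a + c) / 2 * (1 - (a + c) / 2) = d"
    using assms by (intro const; simp)+
  moreover have "0 < (a + c) / 2 * (1 - (a + c) / 2)"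
    using assms by (intro mult_pos_pos) auto
  ultimately show False using ends by auto
qed

section \<open>The homotopy of the realization\<close>

context free_corner
begin

text \<open>The homotopy on representatives. Precells of the free edges and of the corner are moved
  as the boundary points of the square that they represent; every kept cell stands still.\<close>

definition move :: "real \<times> 'a precell \<Rightarrow> 'a precell set" where
  "move z = (case z of (r, (n, y, u)) \<Rightarrow>
     if n = 2 \<and> y = x then pt P 2 x (push b r (u 1) (u 2))
     else if n = 1 \<and> y = edge1 then pt P 2 x (push b r (1 - b) (u 1))
     else if n = 1 \<and> y = edge2 then pt P 2 x (push b r (u 1) b)
     else if n = 0 \<and> y = corner then pt P 2 x (push b r (1 - b) b)
     else pt P n y u)"

definition S :: "'a precell set set" where
  "S = {pt P n y u | n y u. y \<in> cells Q n \<and> u \<in> cube n}"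

lemma pt_edge1: "0 \<le> t \<Longrightarrow> t \<le> 1 \<Longrightarrow> pt P 1 edge1 (edge_point t) = pt P 2 x (square_point (1 - b) t)"
  unfolding edge1_def by (rule pt_square_face(1)[OF x b'(1)])

lemma pt_edge2: "0 \<le> t \<Longrightarrow> t \<le> 1 \<Longrightarrow> pt P 1 edge2 (edge_point t) = pt P 2 x (square_point t b)"
  unfolding edge2_def by (rule pt_square_face(2)[OF x b])

lemma pt_corner: "pt P 0 corner unit_point = pt P 2 x (square_point (1 - b) b)"
proof -
  have "pt P 0 corner unit_point = pt P 1 edge2 (edge_point (1 - b))"
    unfolding corner_def by (rule pt_edge_face[OF edge_cells(2) b'(1)])
  also have "\<dots> = pt P 2 x (square_point (1 - b) b)"
    by (rule pt_edge2) (use b in auto)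
  finally show ?thesis .
qed

lemma move_square: "move (r, (2, x, square_point s t)) = pt P 2 x (push b r s t)"
  by (simp add: move_def)

lemma move_edge1: "move (r, (1, edge1, edge_point t)) = pt P 2 x (push b r (1 - b) t)"
  by (simp add: move_def)

lemma move_edge2: "move (r, (1, edge2, edge_point t)) = pt P 2 x (push b r t b)"
  using edge1_neq_edge2 by (simp add: move_def)

lemma move_corner: "move (r, (0, corner, u)) = pt P 2 x (push b r (1 - b) b)"
  by (simp add: move_def)

lemma move_Q: "y \<in> cells Q n \<Longrightarrow> move (r, (n, y, u)) = pt P n y u"
  by (auto simp: move_def cells_Q split: if_splits)

lemma not_Q_cases:
  assumes "y \<in> cells P n" "y \<notin> cells Q n"
  shows "(n, y) \<in> {(2, x), (1, edge1), (1, edge2), (0, corner)}"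
  using assms by (auto simp: cells_Q split: if_splits)

lemma b_bounds: "0 \<le> real b" "real b \<le> 1" "0 \<le> real (1 - b)" "real (1 - b) \<le> 1"
  using b by auto

lemma face_in_Q:
  "k \<in> {0,1} \<Longrightarrow> k \<noteq> 1 - b \<Longrightarrow> bd P 2 1 k x \<in> cells Q 1"
  "k \<in> {0,1} \<Longrightarrow> k \<noteq> b \<Longrightarrow> bd P 2 2 k x \<in> cells Q 1"
  using face_eq_edge1 face_eq_edge2 square_face_cell by (simp_all add: cells_Q)

lemma Q_face:
  assumes "y \<in> cells Q (Suc n)" "i \<in> {1..Suc n}" "k \<in> {0,1}"
  shows "bd P (Suc n) i k y \<in> cells Q n"
proof -
  have "precubical_set Q" using precubical_subset_Q by (simp add: precubical_subset_def)
  from precubical_bd[OF this assms(2,3,1)] show ?thesis by simp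
qed

text \<open>This lets the homotopy descend to the quotient. A kept cell has kept faces, and nothing
  moves. A face of a removed cell is either removed as well and moves along with it, or kept, and
  then it lies on a side of the square where \<open>push\<close> is stationary.\<close>

lemma move_gluing:
  assumes "(p, q) \<in> gluing P"
  shows "move (r, p) = move (r, q)"
  using assms
proof (rule gluingE)
  fix n i k y u
  assume p: "p = (n, bd P (Suc n) i k y, u)" and q: "q = (Suc n, y, coface n i k u)"
    and y: "y \<in> cells P (Suc n)" and i: "i \<in> {1..Suc n}" and k: "k \<in> {0,1}" and u: "u \<in> cube n"
  note fixed = push_fixed[OF b]
  have k01: "0 \<le> real k" "real k \<le> 1" using k by auto
  consider "y \<in> cells Q (Suc n)" | "Suc n = 2" "y = x" | "Suc n = 1" "y = edge1" | "Suc n = 1" "y = edge2"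
    using not_Q_cases[OF y] by auto
  then show "move (r, p) = move (r, q)"
  proof cases
    case 1
    then show ?thesis
      unfolding p q move_Q[OF Q_face[OF 1 i k]] move_Q[OF 1] by (intro pt_face y i k u)
  next
    case 2
    then have n: "n = 1" by simp
    obtain t where t: "0 \<le> t" "t \<le> 1" "u = edge_point t" using u unfolding n by (rule cube_1E)
    consider "i = 1" | "i = 2" using i n by fastforce
    then show ?thesis
    proof cases
      case 1
      have q': "move (r, q) = pt P 2 x (push b r k t)"
        unfolding q 2 n t 1 coface_1 Suc_1 by (rule move_square)
      have p': "p = (1, bd P 2 1 k x, edge_point t)" unfolding p n 1 t 2 Suc_1 ..
      show ?thesis
      proof (cases "k = 1 - b")
        case True
        then have "bd P 2 1 k x = edge1" by (simp add: edge1_def)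
        then show ?thesis unfolding q' p' using True by (simp only: move_edge1)
      next
        case False
        then have kb: "k = b" using bit_cases[OF k] by blast
        have "move (r, p) = pt P 2 x (square_point k t)"
          unfolding p' move_Q[OF face_in_Q(1)[OF k False]] by (rule pt_square_face(1)[OF x k t(1,2)])
        also have "square_point k t = push b r k t" using fixed[OF k01 t(1,2)] kb by simp
        finally show ?thesis unfolding q' .
      qed
    next
      case i2: 2
      have q': "move (r, q) = pt P 2 x (push b r t k)"
        unfolding q 2 n t i2 coface_1 Suc_1 by (rule move_square)
      have p': "p = (1, bd P 2 2 k x, edge_point t)" unfolding p n i2 t 2 Suc_1 ..
      show ?thesis
      proof (cases "k = b")
        case True
        then have "bd P 2 2 k x = edge2" by (simp add: edge2_def)
        then show ?thesis unfolding q' p' using True by (simp only: move_edge2)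
      next
        case False
        then have kb: "k = 1 - b" using bit_cases[OF k] by blast
        have "move (r, p) = pt P 2 x (square_point t k)"
          unfolding p' move_Q[OF face_in_Q(2)[OF k False]] by (rule pt_square_face(2)[OF x k t(1,2)])
        also have "square_point t k = push b r t k" using fixed[OF t(1,2) k01] kb by simp
        finally show ?thesis unfolding q' .
      qed
    qed
  next
    case 3
    then have n: "n = 0" and i1: "i = 1" and u0: "u = unit_point" using i u by (simp_all add: cube_0 le_antisym)
    have q': "move (r, q) = pt P 2 x (push b r (1 - b) k)"
      using move_edge1[of r k] unfolding q n 3(2) i1 coface_0 by simp
    have p': "p = (0, bd P 1 1 k edge1, unit_point)" unfolding p n 3(2) i1 u0 by simp
    show ?thesis
    proof (cases "k = b")
      case True
      then have "bd P 1 1 k edge1 = corner" by (simp add: corner_alt)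
      then show ?thesis unfolding q' p' using True by (simp only: move_corner)
    next
      case False
      then have kb: "k = 1 - b" using bit_cases[OF k] by blast
      have "bd P 1 1 k edge1 \<in> cells Q 0"
        using face_edge1_eq_corner[OF k] False edge_face_cell[OF edge_cells(1) k] by (simp add: cells_Q)
      then have "move (r, p) = pt P 0 (bd P 1 1 k edge1) unit_point" unfolding p' by (rule move_Q)
      also have "\<dots> = pt P 2 x (square_point (1 - b) k)"
        unfolding pt_edge_face[OF edge_cells(1) k] by (rule pt_edge1[OF k01])
      also have "square_point (1 - b) k = push b r (1 - b) k"
        using fixed[OF b_bounds(3,4) k01] kb by simp
      finally show ?thesis unfolding q' .
    qed
  next
    case 4
    then have n: "n = 0" and i1: "i = 1" and u0: "u = unit_point" using i u by (simp_all add: cube_0 le_antisym)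
    have q': "move (r, q) = pt P 2 x (push b r k b)"
      using move_edge2[of r k] unfolding q n 4(2) i1 coface_0 by simp
    have p': "p = (0, bd P 1 1 k edge2, unit_point)" unfolding p n 4(2) i1 u0 by simp
    show ?thesis
    proof (cases "k = 1 - b")
      case True
      then have "bd P 1 1 k edge2 = corner" by (simp add: corner_def)
      then show ?thesis unfolding q' p' using True by (simp only: move_corner)
    next
      case False
      then have kb: "k = b" using bit_cases[OF k] by blast
      have "bd P 1 1 k edge2 \<in> cells Q 0"
        using face_edge2_eq_corner[OF k] False edge_face_cell[OF edge_cells(2) k] by (simp add: cells_Q)
      then have "move (r, p) = pt P 0 (bd P 1 1 k edge2) unit_point" unfolding p' by (rule move_Q)
      also have "\<dots> = pt P 2 x (square_point k b)"
        unfolding pt_edge_face[OF edge_cells(2) k] by (rule pt_edge2[OF k01])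
      also have "square_point k b = push b r k b"
        using fixed[OF k01 b_bounds(1,2)] kb by simp
      finally show ?thesis unfolding q' .
    qed
  qed
qed

lemma continuous_map_prod_cube_coordinate:
  assumes "j \<in> {1..n}"
  shows "continuous_map (prod_topology (top_of_set {0..1::real}) (cube_topology n)) euclideanreal (\<lambda>z. snd z j)"
proof -
  have "continuous_map (cube_topology n) (top_of_set {0..1}) (\<lambda>u. u j)"
    unfolding cube_topology_def using assms by (rule continuous_map_product_projection)
  from continuous_map_compose[OF continuous_map_snd continuous_map_into_fulltopology[OF this]]
  show ?thesis by (simp add: o_def)
qed

lemma cube_coordinate: "u \<in> cube n \<Longrightarrow> j \<in> {1..n} \<Longrightarrow> u j \<in> {0..1}"
  by (auto simp: cube_def)

text \<open>The common input for continuity and for the d-map property: on a kept cell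
  \<open>G\<close> is the projection that forgets time, on a removed cell it is \<open>push\<close>
  in the coordinates of the square.\<close>

lemma move_cell:
  assumes y: "y \<in> cells P n"
  shows "\<exists>m y' G. y' \<in> cells P m \<and>
       continuous_map (prod_topology (top_of_set {0..1}) (cube_topology n)) (cube_topology m) G \<and>
       (\<forall>r\<in>{0..1}. \<forall>u\<in>cube n. \<forall>w\<in>cube n. (\<forall>j\<in>{1..n}. u j \<le> w j) \<longrightarrow> (\<forall>j\<in>{1..m}. G (r, u) j \<le> G (r, w) j)) \<and>
       (\<forall>r\<in>{0..1}. \<forall>u\<in>cube n. move (r, (n, y, u)) = pt P m y' (G (r, u)))"
proof (cases "y \<in> cells Q n")
  case True
  show ?thesis
    by (rule exI[of _ n], rule exI[of _ y], rule exI[of _ snd])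
      (use move_Q[OF True] y continuous_map_snd in auto)
next
  case False
  let ?Z = "prod_topology (top_of_set {0..1::real}) (cube_topology n)"
  \<comment> \<open>Treats the four removed cells at once: \<open>f\<close> and \<open>g\<close> are
    the two coordinates, in the square, of a point of the cell; they are constant in the directions
    in which the cell is degenerate.\<close>
  have square: ?thesis
    if c: "continuous_map ?Z euclideanreal (f \<circ> snd)" "continuous_map ?Z euclideanreal (g \<circ> snd)"
      and fg: "\<And>u. u \<in> cube n \<Longrightarrow> f u \<in> {0..1} \<and> g u \<in> {0..1}"
      and mono: "\<And>u w. (\<forall>j\<in>{1..n}. u j \<le> w j) \<Longrightarrow> f u \<le> f w \<and> g u \<le> g w"
      and eq: "\<And>r u. u \<in> cube n \<Longrightarrow> move (r, (n, y, u)) = pt P 2 x (push b r (f u) (g u))" for f g :: "(nat \<Rightarrow> real) \<Rightarrow> real"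
  proof (intro exI[of _ 2] exI[of _ x] exI[of _ "\<lambda>z. push b (fst z) (f (snd z)) (g (snd z))"] conjI ballI impI x)
    have "continuous_map ?Z euclideanreal fst"
      by (rule continuous_map_into_fulltopology[OF continuous_map_fst])
    from continuous_map_push[OF this c, of b]
    show "continuous_map ?Z (cube_topology 2) (\<lambda>z. push b (fst z) (f (snd z)) (g (snd z)))"
      using fg by auto
  qed (use mono eq in \<open>auto intro!: push_mono\<close>)
  have proj: "continuous_map ?Z euclideanreal ((\<lambda>u. u j) \<circ> snd)" if "j \<in> {1..n}" for j
    using continuous_map_prod_cube_coordinate[OF that] by (simp add: o_def)
  have const: "continuous_map ?Z euclideanreal ((\<lambda>u. c) \<circ> snd)" for c
    by simp
  consider "n = 2" "y = x" | "n = 1" "y = edge1" | "n = 1" "y = edge2" | "n = 0" "y = corner"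
    using not_Q_cases[OF y False] by auto
  then show ?thesis
  proof cases
    case 1
    show ?thesis
      by (rule square[OF proj[of 1] proj[of 2]]) (use 1 cube_coordinate[of _ 2] in \<open>auto simp: move_def\<close>)
  next
    case 2
    show ?thesis
      by (rule square[OF const[of "1 - b"] proj[of 1]]) (use 2 b cube_coordinate[of _ 1 1] in \<open>auto simp: move_def\<close>)
  next
    case 3
    show ?thesis
      by (rule square[OF proj[of 1] const[of b]]) (use 3 b cube_coordinate[of _ 1 1] edge1_neq_edge2 in \<open>auto simp: move_def\<close>)
  next
    case 4
    show ?thesis
      by (rule square[OF const[of "1 - b"] const[of b]]) (use 4 b in \<open>auto simp: move_def\<close>)
  qed
qed

definition H :: "real \<times> 'a precell set \<Rightarrow> 'a precell set" where
  "H z = (case z of (r, A) \<Rightarrow> lift (\<lambda>p. move (r, p)) A)"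

lemma H_pt: "H (r, pt P n y u) = move (r, (n, y, u))"
  unfolding H_def using lift_pt[of P "\<lambda>p. move (r, p)", OF move_gluing] by simp

lemma H_square: "H (r, pt P 2 x (square_point s t)) = pt P 2 x (push b r s t)"
  unfolding H_pt by (rule move_square)

lemma H_S: "A \<in> S \<Longrightarrow> H (r, A) = A"
  unfolding S_def using H_pt move_Q by auto

text \<open>Points of the free edges and the corner are absorbed as boundary points of the square,
  so only one kind of point outside \<open>S\<close> has to be considered.\<close>

lemma square_or_S:
  assumes "A \<in> points (realization P)"
  obtains "A \<in> S" | s t where "0 \<le> s" "s \<le> 1" "0 \<le> t" "t \<le> 1" "A = pt P 2 x (square_point s t)"
proof -
  obtain n y u where A: "y \<in> cells P n" "u \<in> cube n" "A = pt P n y u"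
    using assms unfolding points_realization by blast
  show ?thesis
  proof (cases "y \<in> cells Q n")
    case True
    then show ?thesis using A that(1) unfolding S_def by blast
  next
    case False
    consider "n = 2" "y = x" | "n = 1" "y = edge1" | "n = 1" "y = edge2" | "n = 0" "y = corner"
      using not_Q_cases[OF A(1) False] by auto
    then show ?thesis
    proof cases
      case 1
      then show ?thesis using A cube_2E[of u] that(2) by metis
    next
      case 2
      then obtain t where "0 \<le> t" "t \<le> 1" "u = edge_point t" using A(2) cube_1E by blast
      then show ?thesis using A 2 pt_edge1 that(2)[OF b_bounds(3,4)] by metis
    next
      case 3
      then obtain t where "0 \<le> t" "t \<le> 1" "u = edge_point t" using A(2) cube_1E by blast
      then show ?thesis using A 3 pt_edge2 that(2)[OF _ _ b_bounds(1,2)] by metis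
    next
      case 4
      then have "u = unit_point" using A(2) by (simp add: cube_0)
      then show ?thesis using A 4 pt_corner that(2)[OF b_bounds(3,4,1,2)] by metis
    qed
  qed
qed

lemma square_in_S:
  assumes "0 \<le> s" "s \<le> 1" "0 \<le> t" "t \<le> 1" "s = real b \<or> t = real (1 - b)"
  shows "pt P 2 x (square_point s t) \<in> S"
proof -
  have "bd P 2 1 b x \<in> cells Q 1" "bd P 2 2 (1 - b) x \<in> cells Q 1"
    using face_in_Q b b' by auto
  moreover have "pt P 1 (bd P 2 1 b x) (edge_point t) = pt P 2 x (square_point b t)"
    "pt P 1 (bd P 2 2 (1 - b) x) (edge_point s) = pt P 2 x (square_point s (1 - b))"
    using pt_square_face(1)[OF x b assms(3,4)] pt_square_face(2)[OF x b'(1) assms(1,2)] by simp_all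
  moreover have "edge_point t \<in> cube 1" "edge_point s \<in> cube 1" using assms by simp_all
  ultimately show ?thesis using assms(5) unfolding S_def by (smt (verit) mem_Collect_eq)
qed

sublocale dideformation_retract "realization P" S H
proof
  show "is_dspace (realization P)" by (rule is_dspace_realization)
  show "S \<subseteq> points (realization P)"
    unfolding S_def using precubical_subset_Q by (auto simp: precubical_subset_def intro!: pt_in_points)
  have H_eq: "(\<lambda>A. H (r, A)) = lift (\<lambda>p. move (r, p))" for r
    by (simp add: H_def)
  show cont: "continuous_map (prod_topology (top_of_set {0..1}) (topo (realization P))) (topo (realization P)) H"
  proof -
    have "continuous_map (prod_topology (top_of_set {0..1}) (topo (realization P))) (topo (realization P))
        (\<lambda>(s, A). lift (\<lambda>p. move (s, p)) A)"
    proof (rule continuous_map_lift)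
      fix n y assume "y \<in> cells P n"
      from move_cell[OF this]
      show "\<exists>m y' G. y' \<in> cells P m \<and>
          continuous_map (prod_topology (top_of_set {0..1}) (cube_topology n)) (cube_topology m) G \<and>
          (\<forall>r\<in>{0..1}. \<forall>u\<in>cube n. move (r, (n, y, u)) = pt P m y' (G (r, u)))"
        by (elim exE conjE) (intro exI conjI)
    qed (rule move_gluing)
    then show ?thesis by (simp add: H_def[abs_def])
  qed
  show "H (0, A) = A" if "A \<in> points (realization P)" for A
    using that
  proof (cases rule: square_or_S)
    case 1
    then show ?thesis by (simp add: H_S)
  next
    case (2 s t)
    then show ?thesis using H_square push_0 by simp
  qed
  show "H (1, A) \<in> S" if "A \<in> points (realization P)" for A
    using that
  proof (cases rule: square_or_S)
    case 1
    then show ?thesis by (simp add: H_S)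
  next
    case (2 s t)
    show ?thesis
    \<comment> \<open>According to whether s + t is at least or at most 1, one coordinate reaches
      the value b or 1 - b that puts the point on a kept side.\<close>
    proof (cases "b = 1")
      case True
      show ?thesis
        unfolding 2(5) H_square push_1 if_P[OF True]
        by (rule square_in_S; use 2(1-4) True in \<open>simp add: min_def max_def\<close>)
    next
      case False
      then have "b = 0" using b by simp
      show ?thesis
        unfolding 2(5) H_square push_1 if_not_P[OF False]
        by (rule square_in_S; use 2(1-4) \<open>b = 0\<close> in \<open>simp add: min_def max_def\<close>)
    qed
  qed
  show "H (r, A) = A" if "r \<in> {0..1}" "A \<in> S" for r A
    using that(2) by (rule H_S)
  show "dmap (realization P) (realization P) (\<lambda>A. H (r, A))" if r: "r \<in> {0..1}" for r
    unfolding H_eq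
  proof (rule dmap_lift)
    have "continuous_map (topo (realization P)) (prod_topology (top_of_set {0..1}) (topo (realization P))) (\<lambda>A. (r, A))"
      using r by (intro continuous_map_pairedI) auto
    from continuous_map_compose[OF this cont]
    show "continuous_map (topo (realization P)) (topo (realization P)) (lift (\<lambda>p. move (r, p)))"
      by (simp add: o_def H_eq)
  next
    fix n y assume "y \<in> cells P n"
    from move_cell[OF this] obtain m y' G where y': "y' \<in> cells P m"
       and G: "continuous_map (prod_topology (top_of_set {0..1}) (cube_topology n)) (cube_topology m) G"
       "\<forall>r\<in>{0..1}. \<forall>u\<in>cube n. \<forall>w\<in>cube n. (\<forall>j\<in>{1..n}. u j \<le> w j) \<longrightarrow> (\<forall>j\<in>{1..m}. G (r, u) j \<le> G (r, w) j)"
       "\<forall>r\<in>{0..1}. \<forall>u\<in>cube n. move (r, (n, y, u)) = pt P m y' (G (r, u))"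
      by (elim exE conjE)
    have "continuous_map (cube_topology n) (prod_topology (top_of_set {0..1}) (cube_topology n)) (\<lambda>u. (r, u))"
      using r by (intro continuous_map_pairedI) auto
    from continuous_map_compose[OF this G(1)]
    have "continuous_map (cube_topology n) (cube_topology m) (\<lambda>u. G (r, u))" by (simp add: o_def)
    then show "\<exists>m y' G. y' \<in> cells P m \<and> continuous_map (cube_topology n) (cube_topology m) G \<and>
       (\<forall>u\<in>cube n. \<forall>w\<in>cube n. (\<forall>j\<in>{1..n}. u j \<le> w j) \<longrightarrow> (\<forall>j\<in>{1..m}. G u j \<le> G w j)) \<and>
       (\<forall>u\<in>cube n. move (r, (n, y, u)) = pt P m y' (G u))"
      using y' G(2,3) r by (intro exI[of _ m] exI[of _ y'] exI[of _ "\<lambda>u. G (r, u)"]) simp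
  qed (rule move_gluing)
qed

section \<open>Extremal points\<close>

text \<open>Off the kept sides there is room to increase one coordinate and to decrease the other.
  This yields d-paths that leave the point and d-paths that enter it.\<close>

lemma outside_S:
  assumes "a \<in> points (realization P)" "a \<notin> S"
  obtains s t where "0 \<le> s" "s \<le> 1" "0 \<le> t" "t \<le> 1" "a = pt P 2 x (square_point s t)"
    "(if b = 1 then s < 1 \<and> 0 < t else 0 < s \<and> t < 1)"
  using assms(1)
proof (cases rule: square_or_S)
  case (2 s t)
  then have "s \<noteq> real b" "t \<noteq> real (1 - b)" using square_in_S[of s t] assms(2) by auto
  then show ?thesis using 2 b by (intro that[of s t]) (auto simp: less_le)
qed (use assms in blast)

lemma spread_square_eq:
  assumes "pt P 2 x (square_point s t) = pt P 2 x (square_point s' t')"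
  shows "s * (1 - s) + t * (1 - t) = s' * (1 - s') + t' * (1 - t')"
  using spread_pt[OF assms] by (simp add: spread_square_point)

lemma dpath_to_A:
  assumes "dpaths_between (realization P) a c \<noteq> {}" shows "dpaths_between A (g a) (g c) \<noteq> {}"
proof -
  obtain \<omega> where "\<omega> \<in> dpaths_between (realization P) a c" using assms by blast
  from dmap_dpaths_between[OF dmap_g this] show ?thesis by auto
qed

lemma dpath_from_A: "dpaths_between A a c \<noteq> {} \<Longrightarrow> dpaths_between (realization P) a c \<noteq> {}"
  by (auto simp: dpaths_between_def dpaths_A)

lemma square_in_points:
  "0 \<le> s \<Longrightarrow> s \<le> 1 \<Longrightarrow> 0 \<le> t \<Longrightarrow> t \<le> 1 \<Longrightarrow> pt P 2 x (square_point s t) \<in> points (realization P)"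
  by (rule pt_in_points[OF x]) simp

text \<open>If a minimal point lay outside \<open>S\<close>, all points of the square below it would
  coincide with it. Lowering the coordinate that has room down to 0 would then leave
  \<open>spread\<close> constant on a nondegenerate interval starting at 0.\<close>

lemma minimal_in_S:
  assumes m: "minimal_point (realization P) a" shows "a \<in> S"
proof (rule ccontr)
  assume "a \<notin> S"
  then obtain s t where st: "0 \<le> s" "s \<le> 1" "0 \<le> t" "t \<le> 1" "a = pt P 2 x (square_point s t)"
    "(if b = 1 then s < 1 \<and> 0 < t else 0 < s \<and> t < 1)"
    using m outside_S unfolding minimal_point_iff by metis
  have *: "s' * (1 - s') + t' * (1 - t') = s * (1 - s) + t * (1 - t)"
    if "0 \<le> s'" "s' \<le> s" "0 \<le> t'" "t' \<le> t" for s' t'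
  proof (rule spread_square_eq)
    show "pt P 2 x (square_point s' t') = pt P 2 x (square_point s t)"
      using m square_dpath[OF x that(1,2) st(2) that(3,4) st(4)] square_in_points[of s' t'] that st
      unfolding minimal_point_iff by auto
  qed
  show False
  proof (cases "b = 1")
    case True
    then have "0 < t" using st(6) by simp
    moreover have "z * (1 - z) = t * (1 - t)" if "z \<in> {0..t}" for z
      using *[of s z] that st(1) by simp
    ultimately show False by (rule not_constant_bump[OF order_refl _ st(4)]) simp_all
  next
    case False
    then have "0 < s" using st(6) by simp
    moreover have "z * (1 - z) = s * (1 - s)" if "z \<in> {0..s}" for z
      using *[of z t] that st(3) by simp
    ultimately show False by (rule not_constant_bump[OF order_refl _ st(2)]) simp_all
  qed
qed

text \<open>The same argument upward: the other coordinate has room to be raised to 1.\<close>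

lemma maximal_in_S:
  assumes m: "maximal_point (realization P) a" shows "a \<in> S"
proof (rule ccontr)
  assume "a \<notin> S"
  then obtain s t where st: "0 \<le> s" "s \<le> 1" "0 \<le> t" "t \<le> 1" "a = pt P 2 x (square_point s t)"
    "(if b = 1 then s < 1 \<and> 0 < t else 0 < s \<and> t < 1)"
    using m outside_S unfolding maximal_point_iff by metis
  have *: "s' * (1 - s') + t' * (1 - t') = s * (1 - s) + t * (1 - t)"
    if "s \<le> s'" "s' \<le> 1" "t \<le> t'" "t' \<le> 1" for s' t'
  proof (rule spread_square_eq)
    show "pt P 2 x (square_point s' t') = pt P 2 x (square_point s t)"
      using m square_dpath[OF x st(1) that(1,2) st(3) that(3,4)] square_in_points[of s' t'] that st
      unfolding maximal_point_iff by auto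
  qed
  show False
  proof (cases "b = 1")
    case True
    then have "s < 1" using st(6) by simp
    moreover have "z * (1 - z) = s * (1 - s)" if "z \<in> {s..1}" for z
      using *[of z t] that st(4) by simp
    ultimately show False by (rule not_constant_bump[OF st(1) _ order_refl]) simp_all
  next
    case False
    then have "t < 1" using st(6) by simp
    moreover have "z * (1 - z) = t * (1 - t)" if "z \<in> {t..1}" for z
      using *[of s z] that st(2) by simp
    ultimately show False by (rule not_constant_bump[OF st(3) _ order_refl]) simp_all
  qed
qed

text \<open>D-paths of \<open>A\<close> are d-paths of the realization, which settles one direction
  once minimal points are known to lie in \<open>S\<close>. Conversely, retracting a d-path from
  \<open>y\<close> to \<open>a\<close> gives \<open>g y = a\<close> by minimality in
  \<open>A\<close>. For \<open>y\<close> in \<open>S\<close> this is \<open>y = a\<close>; for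
  \<open>y\<close> outside \<open>S\<close> too many points of the square would have the same
  image.\<close>

lemma minimal_point_A: "minimal_point A a \<longleftrightarrow> minimal_point (realization P) a"
proof
  assume m: "minimal_point (realization P) a"
  show "minimal_point A a"
    using m minimal_in_S[OF m] dpath_from_A subset unfolding minimal_point_iff points_A by blast
next
  assume "minimal_point A a"
  then have aS: "a \<in> S" and m: "\<And>y. y \<in> S \<Longrightarrow> dpaths_between A y a \<noteq> {} \<Longrightarrow> y = a"
    unfolding minimal_point_iff points_A by blast+
  have ga: "g a = a" using fixed[of 1 a] aS by simp
  have m': "g y = a" if "y \<in> points (realization P)" "dpaths_between (realization P) y a \<noteq> {}" for y
    using m[OF finish[OF that(1)]] dpath_to_A[OF that(2)] ga by simp
  have "y = a" if y: "y \<in> points (realization P)" "dpaths_between (realization P) y a \<noteq> {}" for y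
  proof (rule ccontr)
    assume "y \<noteq> a"
    then have "y \<notin> S" using m'[OF y] fixed[of 1 y] by auto
    then obtain s t where st: "0 \<le> s" "s \<le> 1" "0 \<le> t" "t \<le> 1" "y = pt P 2 x (square_point s t)"
      "(if b = 1 then s < 1 \<and> 0 < t else 0 < s \<and> t < 1)"
      using y(1) outside_S by metis
    \<comment> \<open>Points of the square below \<open>y\<close> have d-paths to \<open>y\<close>,
      so their retractions have d-paths in \<open>A\<close> to \<open>a\<close> and equal it. The
      origin serves as reference point because \<open>spread\<close> vanishes there.\<close>
    have *: "pt P 2 x (push b 1 s' t') = pt P 2 x (push b 1 0 0)"
      if "0 \<le> s'" "s' \<le> s" "0 \<le> t'" "t' \<le> t" for s' t'
    proof -
      have "pt P 2 x (push b 1 s' t') = a" if "0 \<le> s'" "s' \<le> s" "0 \<le> t'" "t' \<le> t" for s' t'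
      proof -
        have "dpaths_between A (g (pt P 2 x (square_point s' t'))) (g y) \<noteq> {}"
          unfolding st(5) using square_dpath[OF x that(1,2) st(2) that(3,4) st(4)] by (rule dpath_to_A)
        then have d: "dpaths_between A (g (pt P 2 x (square_point s' t'))) a \<noteq> {}" unfolding m'[OF y] .
        have "pt P 2 x (square_point s' t') \<in> points (realization P)"
          by (rule square_in_points) (use that st in simp_all)
        from m[OF finish[OF this] d] show ?thesis unfolding H_square .
      qed
      then show ?thesis using that st by simp
    qed
    show False
    proof (cases "b = 1")
      case True
      then have "0 < t" using st(6) by simp
      \<comment> \<open>The retraction carries (0,z) on the free left side to (z,0) on the kept
        bottom side, and fixes the origin.\<close>
      moreover have "z * (1 - z) = 0" if "z \<in> {0..t}" for z
        using spread_square_eq[of z 0 0 0] *[of 0 z] that st(1-4) True by (simp add: push_1)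
      ultimately show False by (rule not_constant_bump[OF order_refl _ st(4)]) simp_all
    next
      case False
      then have "0 < s" using st(6) by simp
      moreover have "z * (1 - z) = 0" if "z \<in> {0..s}" for z
        using spread_square_eq[of 0 z 0 0] *[of z 0] that st(1-4) False by (simp add: push_1)
      ultimately show False by (rule not_constant_bump[OF order_refl _ st(2)]) simp_all
    qed
  qed
  then show "minimal_point (realization P) a"
    unfolding minimal_point_iff using aS subset by blast
qed

text \<open>Dual to \<open>minimal_point_A\<close>: the rectangle above \<open>y\<close> is
  collapsed, the reference point is (1,1), and the end of a free side is carried onto the end of a
  kept side.\<close>

lemma maximal_point_A: "maximal_point A a \<longleftrightarrow> maximal_point (realization P) a"
proof
  assume m: "maximal_point (realization P) a"
  show "maximal_point A a"
    using m maximal_in_S[OF m] dpath_from_A subset unfolding maximal_point_iff points_A by blast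
next
  assume "maximal_point A a"
  then have aS: "a \<in> S" and m: "\<And>y. y \<in> S \<Longrightarrow> dpaths_between A a y \<noteq> {} \<Longrightarrow> y = a"
    unfolding maximal_point_iff points_A by blast+
  have ga: "g a = a" using fixed[of 1 a] aS by simp
  have m': "g y = a" if "y \<in> points (realization P)" "dpaths_between (realization P) a y \<noteq> {}" for y
    using m[OF finish[OF that(1)]] dpath_to_A[OF that(2)] ga by simp
  have "y = a" if y: "y \<in> points (realization P)" "dpaths_between (realization P) a y \<noteq> {}" for y
  proof (rule ccontr)
    assume "y \<noteq> a"
    then have "y \<notin> S" using m'[OF y] fixed[of 1 y] by auto
    then obtain s t where st: "0 \<le> s" "s \<le> 1" "0 \<le> t" "t \<le> 1" "y = pt P 2 x (square_point s t)"
      "(if b = 1 then s < 1 \<and> 0 < t else 0 < s \<and> t < 1)"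
      using y(1) outside_S by metis
    have *: "pt P 2 x (push b 1 s' t') = pt P 2 x (push b 1 1 1)"
      if "s \<le> s'" "s' \<le> 1" "t \<le> t'" "t' \<le> 1" for s' t'
    proof -
      have "pt P 2 x (push b 1 s' t') = a" if "s \<le> s'" "s' \<le> 1" "t \<le> t'" "t' \<le> 1" for s' t'
      proof -
        have "dpaths_between A (g y) (g (pt P 2 x (square_point s' t'))) \<noteq> {}"
          unfolding st(5) using square_dpath[OF x st(1) that(1,2) st(3) that(3,4)] by (rule dpath_to_A)
        then have d: "dpaths_between A a (g (pt P 2 x (square_point s' t'))) \<noteq> {}" unfolding m'[OF y] .
        have "pt P 2 x (square_point s' t') \<in> points (realization P)"
          by (rule square_in_points) (use that st in simp_all)
        from m[OF finish[OF this] d] show ?thesis unfolding H_square .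
      qed
      then show ?thesis using that st by simp
    qed
    show False
    proof (cases "b = 1")
      case True
      then have "s < 1" using st(6) by simp
      \<comment> \<open>The retraction carries (z,1) on the free top side to (1,z) on the kept right
        side.\<close>
      moreover have "z * (1 - z) = 0" if "z \<in> {s..1}" for z
        using spread_square_eq[of 1 z 1 1] *[of z 1] that st(1-4) True by (simp add: push_1)
      ultimately show False by (rule not_constant_bump[OF st(1) _ order_refl]) simp_all
    next
      case False
      then have "t < 1" using st(6) by simp
      moreover have "z * (1 - z) = 0" if "z \<in> {t..1}" for z
        using spread_square_eq[of z 1 1 1] *[of 1 z] that st(1-4) False by (simp add: push_1)
      ultimately show False by (rule not_constant_bump[OF st(3) _ order_refl]) simp_all
    qed
  qed
  then show "maximal_point (realization P) a"
    unfolding maximal_point_iff using aS subset by blast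
qed

lemma subrealization_Q: "subrealization P Q = A"
  unfolding subrealization_def S_def ..

lemma extremal_vertex_in_S: "w \<in> cells (Extrl P) 0 \<Longrightarrow> pt P 0 w unit_point \<in> S"
  unfolding S_def using Extrl_cells_Q unit_point_in_cube by blast

end

theorem theorem6p2:
  fixes P Q :: "'a precubical" and b :: nat and x :: 'a
  assumes "precubical_set P"
    and "b \<in> {0, 1}"
    and "x \<in> cells P 2"
    and "regular P 2 x"
    and "\<forall>y \<in> cells P 2 - {x}.
           \<not> in_boundary P 1 (bd P 2 1 (1 - b) x) 2 y \<and> \<not> in_boundary P 1 (bd P 2 2 b x) 2 y"
    and "{e \<in> cells P 1. in_boundary P 0 (bd P 1 1 (1 - b) (bd P 2 2 b x)) 1 e} =
           {bd P 2 1 (1 - b) x, bd P 2 2 b x}"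
    and "Q = P\<lparr>cells := (cells P)
                 (0 := cells P 0 - {bd P 1 1 (1 - b) (bd P 2 2 b x)},
                  1 := cells P 1 - {bd P 2 1 (1 - b) x, bd P 2 2 b x},
                  2 := cells P 2 - {x})\<rparr>"
  shows "precubical_subset Q P \<and>
    dihomotopy_equivalence_rel (subrealization P Q) (subrealization P Q) (realization P) id \<and>
    Extrl P = Extrl Q \<and>
    is_category_iso
      (fundamental_bipartite_graph (subrealization P Q))
      (fundamental_bipartite_graph (realization P))
      id (induced_arrow (realization P) id) \<and>
    (\<forall>v \<in> cells (Extrl P) 0. \<forall>w \<in> cells (Extrl P) 0.
       homotopy_equivalence_map
         (dpath_space (subrealization P Q) (pt P 0 v unit_point) (pt P 0 w unit_point))
         (dpath_space (realization P) (pt P 0 v unit_point) (pt P 0 w unit_point))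
         (\<lambda>\<omega>. compose {0..1} id \<omega>))"
proof -
  interpret free_corner P b x
    by unfold_locales (fact assms)+
  have Q: "Q = free_corner.Q P b x"
    unfolding assms(7) Q_def corner_def edge1_def edge2_def ..
  show ?thesis
    unfolding Q subrealization_Q
    using precubical_subset_Q dihomotopy_equivalence Extrl_Q
      fundamental_bipartite_graph_iso[OF minimal_point_A maximal_point_A]
      dpath_space_equivalence[OF extremal_vertex_in_S extremal_vertex_in_S]
    by (intro conjI ballI) simp_all
qed

end
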